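(* Let $(G,\phi)$ be a finite magnetic group with $G_0=\ker\phi$, let $a\in G\setminus G_0$, let $\rho:G_0\to\operatorname{GL}(n)=\operatorname{GL}(\mathbb{C}^n)$ be an irreducible complex representation, and let $\rho^*$ be its conjugate representation. \begin{itemize} \item If $\rho$ is of real type and $T:\rho^*\to\rho$ is an isomorphism of representations such that $T\overline{T}=\rho(a^2)$, then \[ g\cdot v=\rho(g)v \ \text{ if } g\in G_0,\qquad a\cdot v=T(\mathbb{K}(v)), \] determines an irreducible representation of $(G,\phi)$ on $\mathbb{C}^n$. \item If $\rho$ is of complex type, then $\operatorname{Ind}^G_{G_0}\rho$ is an irreducible representation of $(G,\phi)$. \item If $\rho$ is of quaternionic type and $T:\rho^*\to\rho$ is an isomorphism of representations such that $T\overline{T}=-\rho(a^2)$, then $\operatorname{Ind}^G_{G_0}\rho$ is an irreducible representation of $(G,\phi)$ which, after the change of basis by the matrix $\begin{pmatrix}\mathrm{id}&0\\ 0&T\end{pmatrix}$, is the representation on $\mathbb{C}^{2n}$ determined by \[ g\longmapsto\begin{pmatrix}\rho(g)&0\\ 0&\rho(g)\end{pmatrix}\ \text{ if } g\in G_0,\qquad a\longmapsto\begin{pmatrix}0&-T\\ T&0\end{pmatrix}\circ\mathbb{K}. \] \end{itemize} Moreover, every irreducible representation of $(G,\phi)$ is, up to isomorphism, of one of these three forms for some irreducible representation $\rho$ of $G_0$.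
   Context: A magnetic group is a pair $(G,\phi)$ with $G$ a group and $\phi:G\to\mathbb{Z}/2$ a surjective homomorphism; $G_0=\ker\phi$. Throughout $G$ is finite and all representations are on finite-dimensional complex vector spaces. A map $A$ between complex vector spaces is antilinear if it is additive and $A(zv)=\overline{z}A(v)$. A representation of $(G,\phi)$ on $V$ is a homomorphism from $G$ to the group of invertible linear or antilinear maps $V\to V$ sending $g$ to a linear map if $\phi(g)=0$ and to an antilinear map if $\phi(g)=1$. Since $G=G_0\sqcup aG_0$, such a homomorphism is determined by its values on $G_0$ and at $a$, with $ag$ ($g\in G_0$) acting as the action of $a$ composed with that of $g$. Morphisms are $\mathbb{C}$-linear maps commuting with the actions. A representation is irreducible if it is nonzero and its only subrepresentations (invariant complex subspaces) are $0$ and itself. $\mathbb{K}$ denotes entrywise complex conjugation on $\mathbb{C}^m$, and for a linear operator $S$ on $\mathbb{C}^n$, $\overline{S}=\mathbb{K}S\mathbb{K}$. The conjugate representation of $\rho:G_0\to\operatorname{GL}(n)$ (with respect to $a$) is $\rho^*:G_0\to\operatorname{GL}(n)$, $\rho^*(g)=\overline{\rho(a^{-1}ga)}$. Types of an irreducible representation $\rho$ of $G_0$: complex type if $\rho\not\cong\rho^*$; real type if there is an isomorphism of representations $T:\rho^*\to\rho$ with $T\overline{T}=\rho(a^2)$; quaternionic type if there is an isomorphism of representations $T:\rho^*\to\rho$ with $T\overline{T}=-\rho(a^2)$. Induced representation: $\mathbb{C}[G,\phi]$ is the complex vector space with basis $G$ and left action $g\cdot\sum_i\lambda_ig_i=\sum_i\mathbb{K}^{\phi(g)}(\lambda_i)\,gg_i$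 of $(G,\phi)$, where $\mathbb{K}^{\phi(g)}$ is the identity of $\mathbb{C}$ if $\phi(g)=0$ and complex conjugation if $\phi(g)=1$. It is a right $\mathbb{C}[G_0]$-module via $(\lambda g)\cdot(\mu h)=\lambda\,\mathbb{K}^{\phi(g)}(\mu)\,gh$ for $g\in G$, $h\in G_0$, $\lambda,\mu\in\mathbb{C}$. For a representation $V$ of $G_0$, $\operatorname{Ind}^G_{G_0}V=\mathbb{C}[G,\phi]\otimes_{\mathbb{C}[G_0]}V$ with $(G,\phi)$ acting on the first factor. For $V=\mathbb{C}^n$ with action $\rho$, $\operatorname{Ind}^G_{G_0}\rho$ is identified with $\mathbb{C}^n\oplus\mathbb{C}^n$ via $(v,w)\mapsto 1\otimes v+a\otimes\overline{w}$; under this identification $g\in G_0$ acts by $\begin{pmatrix}\rho(g)&0\\ 0&\rho^*(g)\end{pmatrix}$ and $a$ acts by $\begin{pmatrix}0&\rho(a^2)\\ \mathrm{id}&0\end{pmatrix}\circ\mathbb{K}$. The change of basis by a matrix $P$ replaces each operator $A$ by $PAP^{-1}$. *)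

theory Defs
  imports
    "Jordan_Normal_Form.VS_Connect"
    "HOL-Algebra.Group_Action"
    "HOL-Algebra.Generated_Groups"
    "HOL-Algebra.Elementary_Groups"
    "HOL-Algebra.Free_Abelian_Groups"
begin

section \<open>Magnetic groups\<close>

definition magnetic_group :: "('g, 'b) monoid_scheme \<Rightarrow> ('g \<Rightarrow> int) \<Rightarrow> bool" where
  "magnetic_group G \<phi> \<longleftrightarrow> group G \<and> \<phi> \<in> epi G (integer_mod_group 2)"

definition unitary_subgroup ::
    "('g, 'b) monoid_scheme \<Rightarrow> ('g \<Rightarrow> int) \<Rightarrow> ('g, 'b) monoid_scheme" where
  "unitary_subgroup G \<phi> = G\<lparr>carrier := kernel G (integer_mod_group 2) \<phi>\<rparr>"


section \<open>Representations by linear and antilinear maps\<close>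

text \<open>A complex vector space is a module over \<open>class_ring :: complex ring\<close>, with an explicit
  carrier, so that spaces of varying dimension and quotient spaces can be treated uniformly.\<close>

definition antilinear_map ::
    "(complex, 'v, 'm) module_scheme \<Rightarrow> (complex, 'w, 'n) module_scheme \<Rightarrow> ('v \<Rightarrow> 'w) \<Rightarrow> bool" where
  "antilinear_map V W A \<longleftrightarrow>
     A \<in> carrier V \<rightarrow> carrier W \<and>
     (\<forall>u\<in>carrier V. \<forall>v\<in>carrier V. A (u \<oplus>\<^bsub>V\<^esub> v) = A u \<oplus>\<^bsub>W\<^esub> A v) \<and>
     (\<forall>z. \<forall>v\<in>carrier V. A (z \<odot>\<^bsub>V\<^esub> v) = cnj z \<odot>\<^bsub>W\<^esub> A v)"

text \<open>\<open>group_action\<close> says that \<open>r\<close> is a homomorphism into the group of bijections of \<open>carrier V\<close>,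
  whose elements are functions that are \<open>undefined\<close> outside \<open>carrier V\<close>.
  Ordinary complex representations of a group are the case \<open>\<phi> = (\<lambda>_. 0)\<close>.\<close>

definition representation ::
    "('g, 'b) monoid_scheme \<Rightarrow> ('g \<Rightarrow> int) \<Rightarrow> (complex, 'v, 'm) module_scheme \<Rightarrow>
     ('g \<Rightarrow> 'v \<Rightarrow> 'v) \<Rightarrow> bool" where
  "representation G \<phi> V r \<longleftrightarrow>
     vectorspace class_ring V \<and> vectorspace.fin_dim class_ring V \<and>
     group_action G (carrier V) r \<and>
     (\<forall>g\<in>carrier G.
        (\<phi> g = 0 \<longrightarrow> linear_map class_ring V V (r g)) \<and>
        (\<phi> g = 1 \<longrightarrow> antilinear_map V V (r g)))"

definition subrepresentation ::
    "('g, 'b) monoid_scheme \<Rightarrow> (complex, 'v, 'm) module_scheme \<Rightarrow> ('g \<Rightarrow> 'v \<Rightarrow> 'v) \<Rightarrow>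
     'v set \<Rightarrow> bool" where
  "subrepresentation G V r W \<longleftrightarrow>
     VectorSpace.subspace class_ring W V \<and> (\<forall>g\<in>carrier G. r g ` W \<subseteq> W)"

definition irreducible_representation ::
    "('g, 'b) monoid_scheme \<Rightarrow> ('g \<Rightarrow> int) \<Rightarrow> (complex, 'v, 'm) module_scheme \<Rightarrow>
     ('g \<Rightarrow> 'v \<Rightarrow> 'v) \<Rightarrow> bool" where
  "irreducible_representation G \<phi> V r \<longleftrightarrow>
     representation G \<phi> V r \<and> carrier V \<noteq> {\<zero>\<^bsub>V\<^esub>} \<and>
     (\<forall>W. subrepresentation G V r W \<longrightarrow> W = {\<zero>\<^bsub>V\<^esub>} \<or> W = carrier V)"

definition rep_iso ::
    "('g, 'b) monoid_scheme \<Rightarrow> (complex, 'v, 'm) module_scheme \<Rightarrow> ('g \<Rightarrow> 'v \<Rightarrow> 'v) \<Rightarrow>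
     (complex, 'w, 'n) module_scheme \<Rightarrow> ('g \<Rightarrow> 'w \<Rightarrow> 'w) \<Rightarrow> ('v \<Rightarrow> 'w) \<Rightarrow> bool" where
  "rep_iso G V r W s f \<longleftrightarrow>
     linear_map class_ring V W f \<and> bij_betw f (carrier V) (carrier W) \<and>
     (\<forall>g\<in>carrier G. \<forall>v\<in>carrier V. f (r g v) = s g (f v))"

definition rep_isomorphic ::
    "('g, 'b) monoid_scheme \<Rightarrow> (complex, 'v, 'm) module_scheme \<Rightarrow> ('g \<Rightarrow> 'v \<Rightarrow> 'v) \<Rightarrow>
     (complex, 'w, 'n) module_scheme \<Rightarrow> ('g \<Rightarrow> 'w \<Rightarrow> 'w) \<Rightarrow> bool" where
  "rep_isomorphic G V r W s \<longleftrightarrow> (\<exists>f. rep_iso G V r W s f)"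

text \<open>The action of \<open>(G, \<phi>)\<close> on a space with carrier \<open>S\<close> determined by operators \<open>s g\<close> for
  \<open>g\<close> in the kernel of \<open>\<phi>\<close> and an operator \<open>A\<close> for \<open>a\<close>: the element \<open>a \<otimes> g\<close> acts as \<open>A \<circ> s g\<close>.\<close>

definition determined_action ::
    "('g, 'b) monoid_scheme \<Rightarrow> ('g \<Rightarrow> int) \<Rightarrow> 'g \<Rightarrow> 'v set \<Rightarrow> ('g \<Rightarrow> 'v \<Rightarrow> 'v) \<Rightarrow> ('v \<Rightarrow> 'v) \<Rightarrow>
     'g \<Rightarrow> 'v \<Rightarrow> 'v" where
  "determined_action G \<phi> a S s A x =
     (if x \<in> carrier (unitary_subgroup G \<phi>) then s x
      else compose S A (s (inv\<^bsub>G\<^esub> a \<otimes>\<^bsub>G\<^esub> x)))"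


section \<open>Matrix representations and their types\<close>

abbreviation GL :: "nat \<Rightarrow> complex mat monoid" where
  "GL n \<equiv> units_of (ring_mat TYPE(complex) n ())"

abbreviation cspace :: "nat \<Rightarrow> (complex, complex vec) module" where
  "cspace n \<equiv> module_vec TYPE(complex) n"

definition mat_op :: "nat \<Rightarrow> complex mat \<Rightarrow> complex vec \<Rightarrow> complex vec" where
  "mat_op n A = (\<lambda>v\<in>carrier_vec n. A *\<^sub>v v)"

text \<open>The operator \<open>A \<circ> K\<close>, where \<open>K\<close> is entrywise complex conjugation.\<close>

definition conj_mat_op :: "nat \<Rightarrow> complex mat \<Rightarrow> complex vec \<Rightarrow> complex vec" where
  "conj_mat_op n A = (\<lambda>v\<in>carrier_vec n. A *\<^sub>v conjugate v)"

definition cnj_mat :: "complex mat \<Rightarrow> complex mat" where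
  "cnj_mat S = map_mat cnj S"

lemma cnj_mat_mult_vec:
  assumes "S \<in> carrier_mat m n" and "v \<in> carrier_vec n"
  shows "cnj_mat S *\<^sub>v v = conjugate (S *\<^sub>v conjugate v)"
  using assms
  by (intro eq_vecI) (auto simp: cnj_mat_def scalar_prod_def)

definition conjugate_rep ::
    "('g, 'b) monoid_scheme \<Rightarrow> 'g \<Rightarrow> ('g \<Rightarrow> complex mat) \<Rightarrow> 'g \<Rightarrow> complex mat" where
  "conjugate_rep G a \<rho> g = cnj_mat (\<rho> (inv\<^bsub>G\<^esub> a \<otimes>\<^bsub>G\<^esub> g \<otimes>\<^bsub>G\<^esub> a))"

definition irreducible_matrix_rep ::
    "('g, 'b) monoid_scheme \<Rightarrow> nat \<Rightarrow> ('g \<Rightarrow> complex mat) \<Rightarrow> bool" where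
  "irreducible_matrix_rep H n \<rho> \<longleftrightarrow>
     \<rho> \<in> hom H (GL n) \<and>
     irreducible_representation H (\<lambda>_. 0) (cspace n) (\<lambda>g. mat_op n (\<rho> g))"

definition matrix_rep_iso ::
    "('g, 'b) monoid_scheme \<Rightarrow> nat \<Rightarrow> ('g \<Rightarrow> complex mat) \<Rightarrow> ('g \<Rightarrow> complex mat) \<Rightarrow>
     complex mat \<Rightarrow> bool" where
  "matrix_rep_iso H n \<sigma> \<rho> T \<longleftrightarrow>
     T \<in> carrier_mat n n \<and>
     rep_iso H (cspace n) (\<lambda>g. mat_op n (\<sigma> g)) (cspace n) (\<lambda>g. mat_op n (\<rho> g)) (mat_op n T)"

text \<open>The types are used only for irreducible \<open>\<rho>\<close>.\<close>

definition complex_type ::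
    "('g, 'b) monoid_scheme \<Rightarrow> ('g \<Rightarrow> int) \<Rightarrow> 'g \<Rightarrow> nat \<Rightarrow> ('g \<Rightarrow> complex mat) \<Rightarrow> bool" where
  "complex_type G \<phi> a n \<rho> \<longleftrightarrow>
     \<not> rep_isomorphic (unitary_subgroup G \<phi>)
         (cspace n) (\<lambda>g. mat_op n (\<rho> g)) (cspace n) (\<lambda>g. mat_op n (conjugate_rep G a \<rho> g))"

definition real_type ::
    "('g, 'b) monoid_scheme \<Rightarrow> ('g \<Rightarrow> int) \<Rightarrow> 'g \<Rightarrow> nat \<Rightarrow> ('g \<Rightarrow> complex mat) \<Rightarrow> bool" where
  "real_type G \<phi> a n \<rho> \<longleftrightarrow>
     (\<exists>T. matrix_rep_iso (unitary_subgroup G \<phi>) n (conjugate_rep G a \<rho>) \<rho> T \<and>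
          T * cnj_mat T = \<rho> (a \<otimes>\<^bsub>G\<^esub> a))"

definition quaternionic_type ::
    "('g, 'b) monoid_scheme \<Rightarrow> ('g \<Rightarrow> int) \<Rightarrow> 'g \<Rightarrow> nat \<Rightarrow> ('g \<Rightarrow> complex mat) \<Rightarrow> bool" where
  "quaternionic_type G \<phi> a n \<rho> \<longleftrightarrow>
     (\<exists>T. matrix_rep_iso (unitary_subgroup G \<phi>) n (conjugate_rep G a \<rho>) \<rho> T \<and>
          T * cnj_mat T = - \<rho> (a \<otimes>\<^bsub>G\<^esub> a))"

text \<open>Replacing an operator \<open>A\<close> by \<open>P A P\<inverse>\<close>.\<close>

definition change_basis ::
    "nat \<Rightarrow> complex mat \<Rightarrow> (complex vec \<Rightarrow> complex vec) \<Rightarrow> complex vec \<Rightarrow> complex vec" where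
  "change_basis n P A = (\<lambda>v\<in>carrier_vec n. P *\<^sub>v A (inv\<^bsub>GL n\<^esub> P *\<^sub>v v))"


section \<open>The twisted group algebra and induced representations\<close>

text \<open>A finitely supported function \<open>m\<close> stands for the formal sum of the \<open>lookup m g\<close> times \<open>g\<close>.
  As the monoid structure on \<open>'g\<close> is an explicit record, the convolution product of type
  \<open>poly_mapping\<close> is not used.\<close>

definition group_space :: "('g, 'b) monoid_scheme \<Rightarrow> ('g \<Rightarrow>\<^sub>0 complex) set" where
  "group_space G = {m. Poly_Mapping.keys m \<subseteq> carrier G}"

definition conj_pow :: "int \<Rightarrow> complex \<Rightarrow> complex" where
  "conj_pow e z = (if e = 0 then z else cnj z)"

definition group_space_scale :: "complex \<Rightarrow> ('g \<Rightarrow>\<^sub>0 complex) \<Rightarrow> ('g \<Rightarrow>\<^sub>0 complex)" where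
  "group_space_scale z m = Poly_Mapping.map ((*) z) m"

definition left_translate ::
    "('g, 'b) monoid_scheme \<Rightarrow> ('g \<Rightarrow> int) \<Rightarrow> 'g \<Rightarrow> ('g \<Rightarrow>\<^sub>0 complex) \<Rightarrow> ('g \<Rightarrow>\<^sub>0 complex)" where
  "left_translate G \<phi> g m =
     (\<Sum>k\<in>Poly_Mapping.keys m.
        Poly_Mapping.single (g \<otimes>\<^bsub>G\<^esub> k) (conj_pow (\<phi> g) (Poly_Mapping.lookup m k)))"

definition right_mult ::
    "('g, 'b) monoid_scheme \<Rightarrow> ('g \<Rightarrow> int) \<Rightarrow> ('g \<Rightarrow>\<^sub>0 complex) \<Rightarrow> ('g \<Rightarrow>\<^sub>0 complex) \<Rightarrow>
     ('g \<Rightarrow>\<^sub>0 complex)" where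
  "right_mult G \<phi> m x =
     (\<Sum>g\<in>Poly_Mapping.keys m. \<Sum>h\<in>Poly_Mapping.keys x.
        Poly_Mapping.single (g \<otimes>\<^bsub>G\<^esub> h)
          (Poly_Mapping.lookup m g * conj_pow (\<phi> g) (Poly_Mapping.lookup x h)))"

text \<open>The left module structure over the group algebra on a representation \<open>(V, r)\<close>.\<close>

definition algebra_act ::
    "(complex, 'v, 'm) module_scheme \<Rightarrow> ('g \<Rightarrow> 'v \<Rightarrow> 'v) \<Rightarrow> ('g \<Rightarrow>\<^sub>0 complex) \<Rightarrow> 'v \<Rightarrow> 'v" where
  "algebra_act V r x v =
     finsum V (\<lambda>h. Poly_Mapping.lookup x h \<odot>\<^bsub>V\<^esub> r h v) (Poly_Mapping.keys x)"

text \<open>The tensor product over the group algebra of the kernel of \<open>\<phi>\<close>: the free abelian group on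
  pairs, modulo the subgroup generated by the bilinearity and balancing relations.\<close>

definition pair_group ::
    "('g, 'b) monoid_scheme \<Rightarrow> (complex, 'v, 'm) module_scheme \<Rightarrow>
     ((('g \<Rightarrow>\<^sub>0 complex) \<times> 'v) \<Rightarrow>\<^sub>0 int) monoid" where
  "pair_group G V = free_Abelian_group (group_space G \<times> carrier V)"

definition tensor_relators ::
    "('g, 'b) monoid_scheme \<Rightarrow> ('g \<Rightarrow> int) \<Rightarrow> (complex, 'v, 'm) module_scheme \<Rightarrow>
     ('g \<Rightarrow> 'v \<Rightarrow> 'v) \<Rightarrow> ((('g \<Rightarrow>\<^sub>0 complex) \<times> 'v) \<Rightarrow>\<^sub>0 int) set" where
  "tensor_relators G \<phi> V r =
     {frag_of (m + m', v) - frag_of (m, v) - frag_of (m', v) | m m' v.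
        m \<in> group_space G \<and> m' \<in> group_space G \<and> v \<in> carrier V} \<union>
     {frag_of (m, v \<oplus>\<^bsub>V\<^esub> v') - frag_of (m, v) - frag_of (m, v') | m v v'.
        m \<in> group_space G \<and> v \<in> carrier V \<and> v' \<in> carrier V} \<union>
     {frag_of (right_mult G \<phi> m x, v) - frag_of (m, algebra_act V r x v) | m x v.
        m \<in> group_space G \<and> x \<in> group_space (unitary_subgroup G \<phi>) \<and> v \<in> carrier V}"

definition tensor_kernel ::
    "('g, 'b) monoid_scheme \<Rightarrow> ('g \<Rightarrow> int) \<Rightarrow> (complex, 'v, 'm) module_scheme \<Rightarrow>
     ('g \<Rightarrow> 'v \<Rightarrow> 'v) \<Rightarrow> ((('g \<Rightarrow>\<^sub>0 complex) \<times> 'v) \<Rightarrow>\<^sub>0 int) set" where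
  "tensor_kernel G \<phi> V r = generate (pair_group G V) (tensor_relators G \<phi> V r)"

definition tensor ::
    "('g, 'b) monoid_scheme \<Rightarrow> ('g \<Rightarrow> int) \<Rightarrow> (complex, 'v, 'm) module_scheme \<Rightarrow>
     ('g \<Rightarrow> 'v \<Rightarrow> 'v) \<Rightarrow> ('g \<Rightarrow>\<^sub>0 complex) \<Rightarrow> 'v \<Rightarrow> ((('g \<Rightarrow>\<^sub>0 complex) \<times> 'v) \<Rightarrow>\<^sub>0 int) set" where
  "tensor G \<phi> V r m v = tensor_kernel G \<phi> V r #>\<^bsub>pair_group G V\<^esub> frag_of (m, v)"

text \<open>The map \<open>m \<otimes> v \<mapsto> f m \<otimes> v\<close> on cosets. For \<open>f\<close> additive and commuting with the right
  multiplication, all members of the union are the same coset.\<close>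

definition first_factor_map ::
    "('g, 'b) monoid_scheme \<Rightarrow> ('g \<Rightarrow> int) \<Rightarrow> (complex, 'v, 'm) module_scheme \<Rightarrow>
     ('g \<Rightarrow> 'v \<Rightarrow> 'v) \<Rightarrow> (('g \<Rightarrow>\<^sub>0 complex) \<Rightarrow> ('g \<Rightarrow>\<^sub>0 complex)) \<Rightarrow>
     ((('g \<Rightarrow>\<^sub>0 complex) \<times> 'v) \<Rightarrow>\<^sub>0 int) set \<Rightarrow> ((('g \<Rightarrow>\<^sub>0 complex) \<times> 'v) \<Rightarrow>\<^sub>0 int) set" where
  "first_factor_map G \<phi> V r f X =
     (\<Union>c\<in>X. tensor_kernel G \<phi> V r #>\<^bsub>pair_group G V\<^esub>
               frag_extend (\<lambda>(m, v). frag_of (f m, v)) c)"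

definition Ind ::
    "('g, 'b) monoid_scheme \<Rightarrow> ('g \<Rightarrow> int) \<Rightarrow> (complex, 'v, 'm) module_scheme \<Rightarrow>
     ('g \<Rightarrow> 'v \<Rightarrow> 'v) \<Rightarrow> (complex, ((('g \<Rightarrow>\<^sub>0 complex) \<times> 'v) \<Rightarrow>\<^sub>0 int) set) module" where
  "Ind G \<phi> V r =
     (let Q = pair_group G V Mod tensor_kernel G \<phi> V r in
      \<lparr>carrier = carrier Q, monoid.mult = undefined, one = undefined,
       ring.zero = \<one>\<^bsub>Q\<^esub>, add = monoid.mult Q,
       smult = (\<lambda>z. first_factor_map G \<phi> V r (group_space_scale z))\<rparr>)"

definition Ind_act ::
    "('g, 'b) monoid_scheme \<Rightarrow> ('g \<Rightarrow> int) \<Rightarrow> (complex, 'v, 'm) module_scheme \<Rightarrow>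
     ('g \<Rightarrow> 'v \<Rightarrow> 'v) \<Rightarrow> 'g \<Rightarrow>
     ((('g \<Rightarrow>\<^sub>0 complex) \<times> 'v) \<Rightarrow>\<^sub>0 int) set \<Rightarrow> ((('g \<Rightarrow>\<^sub>0 complex) \<times> 'v) \<Rightarrow>\<^sub>0 int) set" where
  "Ind_act G \<phi> V r g =
     (\<lambda>X\<in>carrier (Ind G \<phi> V r). first_factor_map G \<phi> V r (left_translate G \<phi> g) X)"

text \<open>For a matrix representation \<open>\<rho>\<close> of the kernel of \<open>\<phi>\<close> on \<open>\<complex>\<^sup>n\<close>, the identification
  \<open>(v, w) \<mapsto> 1 \<otimes> v + a \<otimes> conjugate w\<close> and the induced action read through it.\<close>

abbreviation Ind_mat ::
    "('g, 'b) monoid_scheme \<Rightarrow> ('g \<Rightarrow> int) \<Rightarrow> nat \<Rightarrow> ('g \<Rightarrow> complex mat) \<Rightarrow>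
     (complex, ((('g \<Rightarrow>\<^sub>0 complex) \<times> complex vec) \<Rightarrow>\<^sub>0 int) set) module" where
  "Ind_mat G \<phi> n \<rho> \<equiv> Ind G \<phi> (cspace n) (\<lambda>g. mat_op n (\<rho> g))"

abbreviation Ind_mat_act ::
    "('g, 'b) monoid_scheme \<Rightarrow> ('g \<Rightarrow> int) \<Rightarrow> nat \<Rightarrow> ('g \<Rightarrow> complex mat) \<Rightarrow> 'g \<Rightarrow>
     ((('g \<Rightarrow>\<^sub>0 complex) \<times> complex vec) \<Rightarrow>\<^sub>0 int) set \<Rightarrow>
     ((('g \<Rightarrow>\<^sub>0 complex) \<times> complex vec) \<Rightarrow>\<^sub>0 int) set" where
  "Ind_mat_act G \<phi> n \<rho> \<equiv> Ind_act G \<phi> (cspace n) (\<lambda>g. mat_op n (\<rho> g))"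

definition Ind_ident ::
    "('g, 'b) monoid_scheme \<Rightarrow> ('g \<Rightarrow> int) \<Rightarrow> 'g \<Rightarrow> nat \<Rightarrow> ('g \<Rightarrow> complex mat) \<Rightarrow> complex vec \<Rightarrow>
     ((('g \<Rightarrow>\<^sub>0 complex) \<times> complex vec) \<Rightarrow>\<^sub>0 int) set" where
  "Ind_ident G \<phi> a n \<rho> u =
     tensor G \<phi> (cspace n) (\<lambda>g. mat_op n (\<rho> g))
       (Poly_Mapping.single \<one>\<^bsub>G\<^esub> 1) (vec_first u n)
     \<oplus>\<^bsub>Ind_mat G \<phi> n \<rho>\<^esub>
     tensor G \<phi> (cspace n) (\<lambda>g. mat_op n (\<rho> g))
       (Poly_Mapping.single a 1) (conjugate (vec_last u n))"

definition Ind_coords ::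
    "('g, 'b) monoid_scheme \<Rightarrow> ('g \<Rightarrow> int) \<Rightarrow> 'g \<Rightarrow> nat \<Rightarrow> ('g \<Rightarrow> complex mat) \<Rightarrow>
     'g \<Rightarrow> complex vec \<Rightarrow> complex vec" where
  "Ind_coords G \<phi> a n \<rho> g =
     (\<lambda>u\<in>carrier_vec (n + n).
        inv_into (carrier_vec (n + n)) (Ind_ident G \<phi> a n \<rho>)
          (Ind_mat_act G \<phi> n \<rho> g (Ind_ident G \<phi> a n \<rho> u)))"

end

theory Submission
  imports Defs "Jordan_Normal_Form.Spectral_Radius"
begin

text \<open>
  Fix an irreducible representation \<open>\<rho>\<close> of the kernel on \<open>\<complex>\<^sup>n\<close>. The induced representation acts on
  \<open>\<complex>\<^sup>n \<oplus> \<complex>\<^sup>n\<close> by \<open>\<rho>\<close> and its conjugate \<open>\<rho>\<^sup>*\<close> on the two summands, while \<open>a\<close> exchanges the summands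
  (\<open>block\<close>). The main point is that a proper nonzero invariant subspace of this representation
  is the graph of an isomorphism \<open>S : \<rho> \<rightarrow> \<rho>\<^sup>*\<close> (\<open>invariant_subspace_is_graph\<close>). In complex type there is
  no such \<open>S\<close>. In quaternionic type \<open>T S\<close> is a scalar \<open>c\<close> by Schur's lemma, and invariance of the graph
  under \<open>a\<close> would give \<open>1 + \<bar>c\<bar>\<^sup>2 = 0\<close>. So the induced representation is irreducible in these two
  cases. In real type \<open>\<rho>\<close> itself extends to the whole group by \<open>a \<mapsto> T \<circ> K\<close>.

  For the classification, take a constituent \<open>j : \<rho> \<rightarrow> V\<close> of the restriction of \<open>V\<close> to the kernel. The
  map \<open>(u, v) \<mapsto> j u + a j (K v)\<close> is equivariant from the induced representation onto \<open>V\<close>, and its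
  kernel is again zero or a graph (\<open>constituent_dichotomy\<close>). In the second case \<open>j\<close> is an isomorphism
  and \<open>V\<close> is an extension of \<open>\<rho>\<close> as in real type. In the first case \<open>V\<close> is induced. If moreover
  \<open>\<rho> \<cong> \<rho>\<^sup>*\<close>, an intertwiner can be scaled so that \<open>T \<circ> K\<close> has square \<open>\<rho>(a\<^sup>2)\<close> or \<open>- \<rho>(a\<^sup>2)\<close>
  (\<open>normalised_intertwiner\<close>). The positive sign is excluded because the vectors \<open>(T w, w)\<close> would form
  an invariant subspace (\<open>block_reducible_real\<close>), so the type is quaternionic.

  It remains to compare the tensor product with the block form (\<open>Ind_ident_iso\<close>). Every tensor can be
  rewritten with \<open>1\<close> or \<open>a\<close> as its left factor, hence \<open>(v, w) \<mapsto> 1 \<otimes> v + a \<otimes> K w\<close> is onto. It is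
  injective because \<open>m \<otimes> v \<mapsto> m \<cdot> (v, 0)\<close>, computed in the block form, is a well-defined map in the
  opposite direction.
\<close>

section \<open>Linear algebra over explicit carriers\<close>

lemma linear_map_iff:
  "linear_map class_ring V W f \<longleftrightarrow>
     vectorspace class_ring V \<and> vectorspace class_ring W \<and> f \<in> carrier V \<rightarrow> carrier W \<and>
     (\<forall>u\<in>carrier V. \<forall>v\<in>carrier V. f (u \<oplus>\<^bsub>V\<^esub> v) = f u \<oplus>\<^bsub>W\<^esub> f v) \<and>
     (\<forall>z. \<forall>v\<in>carrier V. f (z \<odot>\<^bsub>V\<^esub> v) = z \<odot>\<^bsub>W\<^esub> f v)"
  unfolding linear_map_def mod_hom_def mod_hom_axioms_def LinearCombinations.module_hom_def
  by (auto simp: vectorspace_def)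

lemma subspace_iff:
  "VectorSpace.subspace class_ring W V \<longleftrightarrow>
     vectorspace class_ring V \<and> W \<subseteq> carrier V \<and> \<zero>\<^bsub>V\<^esub> \<in> W \<and>
     (\<forall>u\<in>W. \<forall>v\<in>W. u \<oplus>\<^bsub>V\<^esub> v \<in> W) \<and> (\<forall>z. \<forall>v\<in>W. z \<odot>\<^bsub>V\<^esub> v \<in> W)"
  unfolding VectorSpace.subspace_def submodule_def
  by (auto simp: vectorspace_def)

lemma cspace_simps [simp]:
  "carrier (cspace n) = carrier_vec n" "\<zero>\<^bsub>cspace n\<^esub> = 0\<^sub>v n"
  "u \<oplus>\<^bsub>cspace n\<^esub> v = u + v" "z \<odot>\<^bsub>cspace n\<^esub> v = z \<cdot>\<^sub>v v"
  by (simp_all add: module_vec_simps)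

lemma cspace_fin_dim: "vectorspace.fin_dim class_ring (cspace n)"
  using vec_space.fin_dim .

text \<open>A maximal linearly independent subset of the subspace is a basis of it and remains independent in
  the whole space. This bounds its size, and equality of dimensions makes it a basis of the whole
  space.\<close>

lemma subspace_fin_dim:
  assumes "vectorspace K V" "vectorspace.fin_dim K V" "VectorSpace.subspace K W V"
  shows "vectorspace.fin_dim K (V\<lparr>carrier := W\<rparr>)"
    and "vectorspace.dim K (V\<lparr>carrier := W\<rparr>) \<le> vectorspace.dim K V"
    and "vectorspace.dim K (V\<lparr>carrier := W\<rparr>) = vectorspace.dim K V \<Longrightarrow> W = carrier V"
proof -
  interpret V: vectorspace K V by fact
  interpret W: vectorspace K "V\<lparr>carrier := W\<rparr>" by (rule V.subspace_is_vs) fact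
  have sub: "submodule K W V" using assms(3) by simp
  have WV: "W \<subseteq> carrier V" using sub by (simp add: submodule_def)
  have li: "V.lin_dep S \<longleftrightarrow> W.lin_dep S" if "S \<subseteq> W" for S
    using V.span_li_not_depend(2)[OF that sub] by simp
  let ?P = "\<lambda>S. S \<subseteq> carrier (V\<lparr>carrier := W\<rparr>) \<and> W.lin_indpt S"
  have "\<exists>A. finite A \<and> maximal A ?P"
  proof (rule maximal_exists)
    show "?P {}" using W.finite_lin_indpt2[of "{}"] by simp
    fix A assume "?P A"
    then show "finite A \<and> card A \<le> V.dim"
      using V.li_le_dim[OF assms(2)] WV li[of A] by auto
  qed
  then obtain A where A: "finite A" "maximal A ?P" by blast
  have b: "W.basis A" by (rule W.max_li_is_basis) (rule A(2))
  then show fd: "W.fin_dim" using A(1) unfolding W.fin_dim_def W.basis_def by blast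
  have AW: "A \<subseteq> W" "W.lin_indpt A" "W.span A = W" using b unfolding W.basis_def by auto
  have lA: "V.lin_indpt A" using li AW by blast
  have dimA: "W.dim = card A" by (rule W.dim_basis[OF A(1) b])
  show "W.dim \<le> V.dim"
    unfolding dimA using V.li_le_dim(2)[OF assms(2) _ lA] AW WV by blast
  assume "W.dim = V.dim"
  then have "V.basis A"
    using V.dim_li_is_basis[OF assms(2) A(1) _ lA] AW WV dimA by auto
  then have "V.span A = carrier V" unfolding V.basis_def by simp
  moreover have "V.span A = W.span A" using V.span_li_not_depend(1)[OF AW(1) sub] by simp
  ultimately show "W = carrier V" using AW(3) by simp
qed

lemma coordinates_exist:
  assumes "vectorspace class_ring V" "vectorspace.fin_dim class_ring V"
  shows "\<exists>n j. linear_map class_ring (cspace n) V j \<and> bij_betw j (carrier_vec n) (carrier V)"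
proof -
  interpret V: vectorspace class_ring V by fact
  obtain B where B: "finite B" "V.basis B" using V.finite_basis_exists[OF assms(2)] by blast
  then have BV: "B \<subseteq> carrier V" unfolding V.basis_def by blast
  define n where "n = card B"
  obtain e where e: "bij_betw e B {0..<n}" 
    using ex_bij_betw_finite_nat[OF B(1)] unfolding n_def by blast
  define j where "j = (\<lambda>v::complex vec. V.lincomb (\<lambda>b. v $ e b) B)"
  have en: "e b < n" if "b \<in> B" for b using e that by (auto dest!: bij_betwE)
  have uniq: "\<exists>!a. a \<in> B \<rightarrow>\<^sub>E UNIV \<and> V.lincomb a B = v" if "v \<in> carrier V" for v
    using V.basis_criterion[OF B(1) BV] B(2) that by simp
  have cong: "V.lincomb a B = V.lincomb b B" if "\<And>x. x \<in> B \<Longrightarrow> a x = b x" for a b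
    unfolding V.lincomb_def using that BV by (intro V.M.add.finprod_cong') auto
  have "linear_map class_ring (cspace n) V j"
    unfolding linear_map_iff
  proof (intro conjI ballI allI)
    show "vectorspace class_ring (cspace n)" by (rule vec_vs)
    show "vectorspace class_ring V" by fact
    show "j \<in> carrier (cspace n) \<rightarrow> carrier V"
      unfolding j_def using V.lincomb_closed[OF BV] by auto
    fix u v :: "complex vec" and z :: complex
    assume v: "v \<in> carrier (cspace n)"
    { assume u: "u \<in> carrier (cspace n)"
      have "j (u \<oplus>\<^bsub>cspace n\<^esub> v) = V.lincomb (\<lambda>b. (u $ e b) \<oplus>\<^bsub>class_ring\<^esub> (v $ e b)) B"
        unfolding j_def using u v en by (intro cong) auto
      then show "j (u \<oplus>\<^bsub>cspace n\<^esub> v) = j u \<oplus>\<^bsub>V\<^esub> j v"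
        using V.lincomb_sum[OF B(1) BV] by (simp add: j_def) }
    have "j (z \<odot>\<^bsub>cspace n\<^esub> v) = V.lincomb (\<lambda>b. z \<otimes>\<^bsub>class_ring\<^esub> (v $ e b)) B"
      unfolding j_def using v en by (intro cong) auto
    then show "j (z \<odot>\<^bsub>cspace n\<^esub> v) = z \<odot>\<^bsub>V\<^esub> j v"
      using V.lincomb_smult[OF BV] by (simp add: j_def)
  qed
  moreover have "bij_betw j (carrier_vec n) (carrier V)"
  proof (rule bij_betw_imageI)
    show "inj_on j (carrier_vec n)"
    proof (rule inj_onI)
      fix u v assume u: "u \<in> carrier_vec n" and v: "v \<in> carrier_vec n" and eq: "j u = j v"
      let ?r = "\<lambda>w. restrict (\<lambda>b. w $ e b) B"
      have "V.lincomb (?r u) B = j u" "V.lincomb (?r v) B = j v"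
        unfolding j_def by (auto intro!: cong)
      moreover have "j u \<in> carrier V" unfolding j_def using V.lincomb_closed[OF BV] by auto
      ultimately have "?r u = ?r v" using uniq[of "j u"] eq by (metis UNIV_I restrict_PiE_iff)
      then have h: "u $ e b = v $ e b" if "b \<in> B" for b using that by (metis restrict_apply')
      show "u = v"
      proof (rule eq_vecI)
        fix i assume "i < dim_vec v"
        then have "i \<in> {0..<n}" using v by simp
        then obtain b where "b \<in> B" "e b = i" using e by (metis bij_betw_imp_surj_on imageE)
        then show "u $ i = v $ i" using h by blast
      qed (use u v in simp)
    qed
    show "j ` carrier_vec n = carrier V"
    proof (intro equalityI subsetI)
      fix w assume "w \<in> j ` carrier_vec n"
      then show "w \<in> carrier V" unfolding j_def using V.lincomb_closed[OF BV] by auto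
    next
      fix w assume "w \<in> carrier V"
      then obtain a where a: "V.lincomb a B = w" using uniq by blast
      let ?v = "vec n (\<lambda>i. a (inv_into B e i))"
      have "j ?v = w"
        unfolding j_def a[symmetric] using en e by (intro cong) (auto simp: bij_betw_def)
      then show "w \<in> j ` carrier_vec n" by (metis image_eqI vec_carrier)
    qed
  qed
  ultimately show ?thesis by blast
qed

text \<open>The induced module is given by its operations alone; its vector space structure will be obtained
  from coordinates by this lemma.\<close>

lemma vectorspace_transport:
  fixes V :: "(complex, 'v, 'm) module_scheme" and W :: "(complex, 'w, 'n) module_scheme"
  assumes vs: "vectorspace class_ring V" and fd: "vectorspace.fin_dim class_ring V"
    and bij: "bij_betw f (carrier V) (carrier W)"
    and add: "\<And>u v. u \<in> carrier V \<Longrightarrow> v \<in> carrier V \<Longrightarrow> f (u \<oplus>\<^bsub>V\<^esub> v) = f u \<oplus>\<^bsub>W\<^esub> f v"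
    and zero: "f \<zero>\<^bsub>V\<^esub> = \<zero>\<^bsub>W\<^esub>"
    and smult: "\<And>z v. v \<in> carrier V \<Longrightarrow> f (z \<odot>\<^bsub>V\<^esub> v) = z \<odot>\<^bsub>W\<^esub> f v"
  shows "linear_map class_ring V W f" "vectorspace.fin_dim class_ring W"
proof -
  interpret V: vectorspace class_ring V by fact
  have carW: "carrier W = f ` carrier V"
    using bij by (simp add: bij_betw_def)
  have closed [simp]: "f v \<in> carrier W" if "v \<in> carrier V" for v
    using that carW by blast
  have "vectorspace class_ring W"
  proof (rule vs_criteria)
    show "field (class_ring :: complex ring)" by (rule class_field)
    show "\<zero>\<^bsub>W\<^esub> \<in> carrier W" unfolding zero[symmetric] by simp
    show "\<forall>v w. v \<in> carrier W \<and> w \<in> carrier W \<longrightarrow> v \<oplus>\<^bsub>W\<^esub> w \<in> carrier W"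
      by (auto simp: carW add[symmetric])
    show "\<forall>v\<in>carrier W. \<exists>neg_v\<in>carrier W. v \<oplus>\<^bsub>W\<^esub> neg_v = \<zero>\<^bsub>W\<^esub>"
    proof
      fix w assume "w \<in> carrier W"
      then obtain v where v: "v \<in> carrier V" "w = f v" using carW by blast
      then have "w \<oplus>\<^bsub>W\<^esub> f (\<ominus>\<^bsub>V\<^esub> v) = \<zero>\<^bsub>W\<^esub>" by (simp add: add[symmetric] zero V.M.r_neg)
      moreover have "f (\<ominus>\<^bsub>V\<^esub> v) \<in> carrier W" using v by simp
      ultimately show "\<exists>neg_v\<in>carrier W. w \<oplus>\<^bsub>W\<^esub> neg_v = \<zero>\<^bsub>W\<^esub>" by blast
    qed
    show "\<forall>c v. c \<in> carrier class_ring \<and> v \<in> carrier W \<longrightarrow> c \<odot>\<^bsub>W\<^esub> v \<in> carrier W"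
      by (auto simp: carW smult[symmetric])
    show "\<forall>v w. v \<in> carrier W \<and> w \<in> carrier W \<longrightarrow> v \<oplus>\<^bsub>W\<^esub> w = w \<oplus>\<^bsub>W\<^esub> v"
      by (auto simp: carW add[symmetric] V.M.a_comm)
    show "\<forall>v w x. v \<in> carrier W \<and> w \<in> carrier W \<and> x \<in> carrier W \<longrightarrow>
            v \<oplus>\<^bsub>W\<^esub> w \<oplus>\<^bsub>W\<^esub> x = v \<oplus>\<^bsub>W\<^esub> (w \<oplus>\<^bsub>W\<^esub> x)"
      by (auto simp: carW add[symmetric] V.M.a_assoc)
    show "\<forall>v\<in>carrier W. v \<oplus>\<^bsub>W\<^esub> \<zero>\<^bsub>W\<^esub> = v"
      by (auto simp: carW zero[symmetric] add[symmetric])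
    show "\<forall>a b v. a \<in> carrier class_ring \<and> b \<in> carrier class_ring \<and> v \<in> carrier W \<longrightarrow>
            (a \<otimes>\<^bsub>class_ring\<^esub> b) \<odot>\<^bsub>W\<^esub> v = a \<odot>\<^bsub>W\<^esub> (b \<odot>\<^bsub>W\<^esub> v)"
      using V.smult_assoc1 by (auto simp: carW smult[symmetric])
    show "\<forall>v\<in>carrier W. \<one>\<^bsub>class_ring\<^esub> \<odot>\<^bsub>W\<^esub> v = v"
      using V.smult_one by (auto simp: carW smult[symmetric])
    show "\<forall>a b v. a \<in> carrier class_ring \<and> b \<in> carrier class_ring \<and> v \<in> carrier W \<longrightarrow>
            (a \<oplus>\<^bsub>class_ring\<^esub> b) \<odot>\<^bsub>W\<^esub> v = a \<odot>\<^bsub>W\<^esub> v \<oplus>\<^bsub>W\<^esub> b \<odot>\<^bsub>W\<^esub> v"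
      using V.smult_l_distr by (auto simp: carW smult[symmetric] add[symmetric])
    show "\<forall>a v w. a \<in> carrier class_ring \<and> v \<in> carrier W \<and> w \<in> carrier W \<longrightarrow>
            a \<odot>\<^bsub>W\<^esub> (v \<oplus>\<^bsub>W\<^esub> w) = a \<odot>\<^bsub>W\<^esub> v \<oplus>\<^bsub>W\<^esub> a \<odot>\<^bsub>W\<^esub> w"
      using V.smult_r_distr by (auto simp: carW smult[symmetric] add[symmetric])
  qed
  then show lm: "linear_map class_ring V W f"
    unfolding linear_map_iff using vs add smult by simp
  show "vectorspace.fin_dim class_ring W"
    using linear_map.surj_fin_dim[OF lm fd] bij by (simp add: bij_betw_def)
qed

lemma linear_map_cspace_matrix:
  assumes "linear_map class_ring (cspace n) (cspace m) f"
  shows "\<exists>A\<in>carrier_mat m n. \<forall>v\<in>carrier_vec n. f v = A *\<^sub>v v"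
proof -
  have f: "f v \<in> carrier_vec m" "f (u + v) = f u + f v" "f (z \<cdot>\<^sub>v v) = z \<cdot>\<^sub>v f v"
    if "u \<in> carrier_vec n" "v \<in> carrier_vec n" for u v z
    using assms that unfolding linear_map_iff by auto
  define A where "A = mat m n (\<lambda>(i,k). f (unit_vec n k) $ i)"
  have A: "A \<in> carrier_mat m n" unfolding A_def by simp
  have "0 \<cdot>\<^sub>v f (0\<^sub>v n) = 0\<^sub>v m" "0 \<cdot>\<^sub>v 0\<^sub>v n = (0\<^sub>v n :: complex vec)"
    using f(1)[of "0\<^sub>v n" "0\<^sub>v n"] by (auto intro!: eq_vecI)
  then have f0: "f (0\<^sub>v n) = 0\<^sub>v m" using f(3)[of "0\<^sub>v n" "0\<^sub>v n" 0] by simp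
  \<comment> \<open>induction on the number of coordinates that may be nonzero\<close>
  have "\<forall>v\<in>carrier_vec n. (\<forall>i. k \<le> i \<and> i < n \<longrightarrow> v $ i = 0) \<longrightarrow> f v = A *\<^sub>v v" if "k \<le> n" for k
    using that
  proof (induction k)
    case 0
    show ?case
    proof (intro ballI impI)
      fix v :: "complex vec" assume v: "v \<in> carrier_vec n" "\<forall>i. 0 \<le> i \<and> i < n \<longrightarrow> v $ i = 0"
      then have "v = 0\<^sub>v n" by (intro eq_vecI) auto
      then show "f v = A *\<^sub>v v" using f0 A by auto
    qed
  next
    case (Suc k)
    show ?case
    proof (intro ballI impI)
      fix v :: "complex vec" assume v: "v \<in> carrier_vec n" "\<forall>i. Suc k \<le> i \<and> i < n \<longrightarrow> v $ i = 0"
      let ?w = "v - v $ k \<cdot>\<^sub>v unit_vec n k"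
      have w: "?w \<in> carrier_vec n" using v by simp
      have nth_eq: "v $ i = (if i = k then v $ k else 0)" if "k \<le> i" "i < n" for i
        using v(2) that Suc_leI[of k i] by (cases "i = k") auto
      have "\<forall>i. k \<le> i \<and> i < n \<longrightarrow> ?w $ i = 0"
      proof (intro allI impI)
        fix i assume i: "k \<le> i \<and> i < n"
        then have "?w $ i = v $ i - v $ k * unit_vec n k $ i" using v(1) by simp
        then show "?w $ i = 0" using nth_eq[of i] i by (auto simp: unit_vec_def)
      qed
      then have IH: "f ?w = A *\<^sub>v ?w" using Suc.IH[OF Suc_leD[OF Suc.prems]] w by blast
      have ve: "v = ?w + v $ k \<cdot>\<^sub>v unit_vec n k" using v(1) by (intro eq_vecI) auto
      have "f (unit_vec n k) = A *\<^sub>v unit_vec n k"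
        using f(1)[of "unit_vec n k" "unit_vec n k"] Suc.prems A
        by (intro eq_vecI) (auto simp: A_def scalar_prod_right_unit)
      then have "f (?w + v $ k \<cdot>\<^sub>v unit_vec n k) = A *\<^sub>v (?w + v $ k \<cdot>\<^sub>v unit_vec n k)"
        using w IH A f(2)[of ?w "v $ k \<cdot>\<^sub>v unit_vec n k"]
        by (simp add: f(3)[of "unit_vec n k"] mult_add_distrib_mat_vec mult_mat_vec)
      then show "f v = A *\<^sub>v v" using ve by simp
    qed
  qed
  from this[of n] have "\<forall>v\<in>carrier_vec n. f v = A *\<^sub>v v" by (metis le_refl linorder_not_le)
  with A show ?thesis by blast
qed

lemma mat_eqI_mult_vec:
  assumes "A \<in> carrier_mat m n" "B \<in> carrier_mat m n"
    and eq: "\<And>v. v \<in> carrier_vec n \<Longrightarrow> A *\<^sub>v v = (B :: complex mat) *\<^sub>v v"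
  shows "A = B"
proof (rule eq_matI)
  fix i k assume "i < dim_row B" "k < dim_col B"
  then show "A $$ (i,k) = B $$ (i,k)"
    using arg_cong[OF eq[of "unit_vec n k"], of "\<lambda>v. v $ i"] assms(1,2)
    by (simp add: scalar_prod_right_unit)
qed (use assms in auto)

lemma linear_map_compose:
  assumes "linear_map class_ring U V f" "linear_map class_ring V W g"
  shows "linear_map class_ring U W (\<lambda>u. g (f u))"
  using assms unfolding linear_map_iff by (auto simp: Pi_iff)

lemma linear_map_inv_into:
  fixes V :: "(complex, 'v, 'm) module_scheme" and W :: "(complex, 'w, 'n) module_scheme"
  assumes "linear_map class_ring V W f" and bij: "bij_betw f (carrier V) (carrier W)"
  shows "linear_map class_ring W V (inv_into (carrier V) f)"
proof -
  let ?g = "inv_into (carrier V) f"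
  interpret V: vectorspace class_ring V using assms unfolding linear_map_iff by blast
  have g: "f v \<in> carrier W" "?g (f v) = v" if "v \<in> carrier V" for v
    using that bij by (auto simp: bij_betw_def)
  have surj: "\<exists>v\<in>carrier V. w = f v" if "w \<in> carrier W" for w
    using that bij by (auto simp: bij_betw_def)
  show ?thesis
    unfolding linear_map_iff
  proof (intro conjI ballI allI)
    show "vectorspace class_ring W" "vectorspace class_ring V"
      using assms(1) unfolding linear_map_iff by blast+
    show "?g \<in> carrier W \<rightarrow> carrier V" using bij by (auto simp: bij_betw_def inv_into_into)
    fix u v z assume "v \<in> carrier W"
    then obtain v' where v': "v' \<in> carrier V" "v = f v'" using surj by blast
    { assume "u \<in> carrier W"
      then obtain u' where u': "u' \<in> carrier V" "u = f u'" using surj by blast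
      then have "u \<oplus>\<^bsub>W\<^esub> v = f (u' \<oplus>\<^bsub>V\<^esub> v')" using v' assms unfolding linear_map_iff by auto
      then show "?g (u \<oplus>\<^bsub>W\<^esub> v) = ?g u \<oplus>\<^bsub>V\<^esub> ?g v" using u' v' g by simp }
    have "z \<odot>\<^bsub>W\<^esub> v = f (z \<odot>\<^bsub>V\<^esub> v')" using v' assms unfolding linear_map_iff by auto
    then show "?g (z \<odot>\<^bsub>W\<^esub> v) = z \<odot>\<^bsub>V\<^esub> ?g v" using v' g by simp
  qed
qed

section \<open>Representations\<close>

lemma group_actionI:
  assumes "group G"
    and ext: "\<And>g. g \<in> carrier G \<Longrightarrow> r g \<in> extensional S"
    and cl: "\<And>g x. g \<in> carrier G \<Longrightarrow> x \<in> S \<Longrightarrow> r g x \<in> S"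
    and mult: "\<And>g h x. g \<in> carrier G \<Longrightarrow> h \<in> carrier G \<Longrightarrow> x \<in> S \<Longrightarrow>
                 r (g \<otimes>\<^bsub>G\<^esub> h) x = r g (r h x)"
    and one: "\<And>x. x \<in> S \<Longrightarrow> r \<one>\<^bsub>G\<^esub> x = x"
  shows "group_action G S r"
proof -
  interpret group G by fact
  have inv: "r g (r (inv\<^bsub>G\<^esub> g) x) = x" "r (inv\<^bsub>G\<^esub> g) (r g x) = x"
    if "g \<in> carrier G" "x \<in> S" for g x
    using that by (simp_all add: mult[symmetric] one)
  have bij: "r g \<in> Bij S" if g: "g \<in> carrier G" for g
  proof -
    have "bij_betw (r g) S S"
      by (rule bij_betwI[where g = "r (inv\<^bsub>G\<^esub> g)"]) (use g cl inv in auto)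
    then show ?thesis using ext g by (simp add: Bij_def)
  qed
  have "r (g \<otimes>\<^bsub>G\<^esub> h) = compose S (r g) (r h)"
    if "g \<in> carrier G" "h \<in> carrier G" for g h
    using that ext[of "g \<otimes>\<^bsub>G\<^esub> h"] mult
    by (intro extensionalityI[where A = S]) (auto simp: compose_def)
  then have "r \<in> hom G (BijGroup S)"
    using bij by (auto simp: hom_def BijGroup_def)
  then show ?thesis
    by (simp add: group_action_def group_hom_def group_hom_axioms_def group_BijGroup assms(1))
qed

lemma group_actionD:
  assumes "group_action G S r"
  shows "group G"
    and "g \<in> carrier G \<Longrightarrow> r g \<in> extensional S"
    and "g \<in> carrier G \<Longrightarrow> x \<in> S \<Longrightarrow> r g x \<in> S"
    and "g \<in> carrier G \<Longrightarrow> h \<in> carrier G \<Longrightarrow> x \<in> S \<Longrightarrow> r (g \<otimes>\<^bsub>G\<^esub> h) x = r g (r h x)"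
    and "x \<in> S \<Longrightarrow> r \<one>\<^bsub>G\<^esub> x = x"
proof -
  interpret group_action G S r by fact
  show "group G" using group_hom by (simp add: group_hom_def)
  show "g \<in> carrier G \<Longrightarrow> r g \<in> extensional S" using bij_prop0 by (simp add: Bij_def)
  show "g \<in> carrier G \<Longrightarrow> x \<in> S \<Longrightarrow> r g x \<in> S" by (rule element_image) auto
  show "g \<in> carrier G \<Longrightarrow> h \<in> carrier G \<Longrightarrow> x \<in> S \<Longrightarrow> r (g \<otimes>\<^bsub>G\<^esub> h) x = r g (r h x)"
    by (rule composition_rule)
  show "x \<in> S \<Longrightarrow> r \<one>\<^bsub>G\<^esub> x = x" using id_eq_one by (metis restrict_apply')
qed

lemma rep_iso_sym:
  assumes iso: "rep_iso G V r W s f"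
    and r: "\<And>g v. g \<in> carrier G \<Longrightarrow> v \<in> carrier V \<Longrightarrow> r g v \<in> carrier V"
  shows "rep_iso G W s V r (inv_into (carrier V) f)"
proof -
  have bij: "bij_betw f (carrier V) (carrier W)"
    and eq: "\<And>g v. g \<in> carrier G \<Longrightarrow> v \<in> carrier V \<Longrightarrow> f (r g v) = s g (f v)"
    using iso unfolding rep_iso_def by auto
  have "inv_into (carrier V) f (s g w) = r g (inv_into (carrier V) f w)"
    if g: "g \<in> carrier G" and w: "w \<in> carrier W" for g w
  proof -
    obtain v where v: "v \<in> carrier V" "w = f v"
      using bij w by (auto simp: bij_betw_def)
    then have "s g w = f (r g v)" using eq g by simp
    then show ?thesis using v r g bij by (simp add: bij_betw_def)
  qed
  then show ?thesis
    using iso linear_map_inv_into bij_betw_inv_into unfolding rep_iso_def by blast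
qed

lemma rep_iso_trans:
  assumes "rep_iso G U q V r f" "rep_iso G V r W s g"
  shows "rep_iso G U q W s (\<lambda>u. g (f u))"
proof -
  have "f u \<in> carrier V" if "u \<in> carrier U" for u
    using assms(1) that unfolding rep_iso_def by (auto simp: bij_betw_def)
  then show ?thesis
    using assms linear_map_compose[of U V f W g] bij_betw_trans[of f "carrier U" "carrier V" g "carrier W"]
    unfolding rep_iso_def by (simp add: comp_def)
qed

lemma representation_transport:
  assumes rep: "representation G \<phi> V r" and iso: "rep_iso G V r W s f"
    and ext: "\<And>g. g \<in> carrier G \<Longrightarrow> s g \<in> extensional (carrier W)"
  shows "representation G \<phi> W s"
proof -
  have lm: "linear_map class_ring V W f" and bij: "bij_betw f (carrier V) (carrier W)"
    and eq: "\<And>g v. g \<in> carrier G \<Longrightarrow> v \<in> carrier V \<Longrightarrow> f (r g v) = s g (f v)"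
    using iso unfolding rep_iso_def by auto
  have carW: "carrier W = f ` carrier V" using bij by (simp add: bij_betw_def)
  have V: "vectorspace class_ring V" "vectorspace.fin_dim class_ring V"
    and ga: "group_action G (carrier V) r"
    using rep unfolding representation_def by auto
  have f: "f (u \<oplus>\<^bsub>V\<^esub> v) = f u \<oplus>\<^bsub>W\<^esub> f v" "f (z \<odot>\<^bsub>V\<^esub> v) = z \<odot>\<^bsub>W\<^esub> f v"
    if "u \<in> carrier V" "v \<in> carrier V" for u v z
    using lm that unfolding linear_map_iff by auto
  interpret V: vectorspace class_ring V by fact
  note gaD = group_actionD[OF ga]
  interpret G: group G by (rule gaD(1))
  have clV: "u \<oplus>\<^bsub>V\<^esub> v \<in> carrier V" "z \<odot>\<^bsub>V\<^esub> v \<in> carrier V"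
    if "u \<in> carrier V" "v \<in> carrier V" for u v z
    using that V.smult_closed[of z] by auto
  have s: "s g (f v) = f (r g v)" if "g \<in> carrier G" "v \<in> carrier V" for g v
    using eq that by simp
  have "group_action G (carrier W) s"
    by (rule group_actionI) (auto simp: carW s gaD ext[unfolded carW] intro: G.is_group)
  moreover have "linear_map class_ring W W (s g)" if g: "g \<in> carrier G" and "\<phi> g = 0" for g
  proof -
    have "linear_map class_ring V V (r g)" using rep that unfolding representation_def by auto
    then show ?thesis
      using lm unfolding linear_map_iff by (auto simp: carW s g f[symmetric] gaD(3) clV)
  qed
  moreover have "antilinear_map W W (s g)" if g: "g \<in> carrier G" and "\<phi> g = 1" for g
  proof -
    have "antilinear_map V V (r g)" using rep that unfolding representation_def by auto
    then show ?thesis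
      unfolding antilinear_map_def by (auto simp: carW s g f[symmetric] gaD(3) clV)
  qed
  ultimately show ?thesis
    using lm linear_map.surj_fin_dim[OF lm V(2)] carW
    unfolding representation_def linear_map_iff by auto
qed

lemma irreducible_transport:
  assumes irr: "irreducible_representation G \<phi> V r" and iso: "rep_iso G V r W s f"
    and ext: "\<And>g. g \<in> carrier G \<Longrightarrow> s g \<in> extensional (carrier W)"
  shows "irreducible_representation G \<phi> W s"
proof -
  have rep: "representation G \<phi> V r" using irr unfolding irreducible_representation_def by blast
  have repW: "representation G \<phi> W s" by (rule representation_transport[OF rep iso ext])
  have lm: "linear_map class_ring V W f" and bij: "bij_betw f (carrier V) (carrier W)"
    and eq: "\<And>g v. g \<in> carrier G \<Longrightarrow> v \<in> carrier V \<Longrightarrow> f (r g v) = s g (f v)"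
    using iso unfolding rep_iso_def by auto
  have carW: "carrier W = f ` carrier V" using bij by (simp add: bij_betw_def)
  have f: "f (u \<oplus>\<^bsub>V\<^esub> v) = f u \<oplus>\<^bsub>W\<^esub> f v" "f (z \<odot>\<^bsub>V\<^esub> v) = z \<odot>\<^bsub>W\<^esub> f v"
    if "u \<in> carrier V" "v \<in> carrier V" for u v z
    using lm that unfolding linear_map_iff by auto
  have V: "vectorspace class_ring V" and ga: "group_action G (carrier V) r"
    using rep unfolding representation_def by auto
  interpret V: vectorspace class_ring V by fact
  have smV: "z \<odot>\<^bsub>V\<^esub> v \<in> carrier V" if "v \<in> carrier V" for v z
    using that V.smult_closed[of z] by auto
  have f0: "f \<zero>\<^bsub>V\<^esub> = \<zero>\<^bsub>W\<^esub>" 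
    by (rule linear_map.T0_is_0[OF lm])
  have "carrier W \<noteq> {\<zero>\<^bsub>W\<^esub>}"
  proof
    assume "carrier W = {\<zero>\<^bsub>W\<^esub>}"
    then have "\<forall>v\<in>carrier V. f v = f \<zero>\<^bsub>V\<^esub>" using carW f0 by auto
    then have "\<forall>v\<in>carrier V. v = \<zero>\<^bsub>V\<^esub>"
      by (meson bij bij_betw_imp_inj_on inj_onD V.M.zero_closed)
    then have "carrier V = {\<zero>\<^bsub>V\<^esub>}" using V.M.zero_closed by blast
    then show False using irr unfolding irreducible_representation_def by blast
  qed
  moreover have "U = {\<zero>\<^bsub>W\<^esub>} \<or> U = carrier W" if U: "subrepresentation G W s U" for U
  proof -
    let ?P = "{v \<in> carrier V. f v \<in> U}"
    have sub: "U \<subseteq> carrier W" "\<zero>\<^bsub>W\<^esub> \<in> U" "\<And>u v. u \<in> U \<Longrightarrow> v \<in> U \<Longrightarrow> u \<oplus>\<^bsub>W\<^esub> v \<in> U"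
      "\<And>z v. v \<in> U \<Longrightarrow> z \<odot>\<^bsub>W\<^esub> v \<in> U" "\<And>g v. g \<in> carrier G \<Longrightarrow> v \<in> U \<Longrightarrow> s g v \<in> U"
      using U unfolding subrepresentation_def subspace_iff image_subset_iff by auto
    have "subrepresentation G V r ?P"
      unfolding subrepresentation_def subspace_iff
      using V sub f smV f0 eq group_actionD(3)[OF ga] by auto
    then have "?P = {\<zero>\<^bsub>V\<^esub>} \<or> ?P = carrier V"
      using irr unfolding irreducible_representation_def by blast
    moreover have "U = f ` ?P" using sub(1) carW by auto
    ultimately show ?thesis using f0 carW by auto
  qed
  ultimately show ?thesis
    using repW unfolding irreducible_representation_def by blast
qed

section \<open>Matrix representations and Schur's lemma\<close>

lemma GL_simps [simp]:
  "monoid.mult (GL n) = (*)" "one (GL n) = 1\<^sub>m n"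
  by (simp_all add: units_of_def ring_mat_simps)

lemma group_GL: "group (GL n)"
  by (intro monoid.units_group ring.is_monoid ring_mat)

lemma GL_carrier_iff:
  "A \<in> carrier (GL n) \<longleftrightarrow>
     A \<in> carrier_mat n n \<and> (\<exists>B\<in>carrier_mat n n. B * A = 1\<^sub>m n \<and> A * B = 1\<^sub>m n)"
  by (auto simp: units_of_def Units_def ring_mat_simps)

lemma mat_op_simps [simp]:
  "v \<in> carrier_vec n \<Longrightarrow> mat_op n A v = A *\<^sub>v v"
  "v \<in> carrier_vec n \<Longrightarrow> conj_mat_op n A v = A *\<^sub>v conjugate v"
  "mat_op n A \<in> extensional (carrier_vec n)"
  "conj_mat_op n A \<in> extensional (carrier_vec n)"
  by (simp_all add: mat_op_def conj_mat_op_def)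

lemma linear_map_mat_op:
  assumes "A \<in> carrier_mat n n" shows "linear_map class_ring (cspace n) (cspace n) (mat_op n A)"
  unfolding linear_map_iff using assms
  by (auto simp: vec_vs mult_add_distrib_mat_vec mult_mat_vec)

lemma antilinear_map_conj_mat_op:
  assumes "A \<in> carrier_mat n n" shows "antilinear_map (cspace n) (cspace n) (conj_mat_op n A)"
  unfolding antilinear_map_def using assms
  by (auto simp: mult_add_distrib_mat_vec mult_mat_vec conjugate_add_vec[of _ n] conjugate_smult_vec)

lemma hom_GL_D:
  assumes "group H" and \<rho>: "\<rho> \<in> hom H (GL n)"
  shows "g \<in> carrier H \<Longrightarrow> \<rho> g \<in> carrier_mat n n"
    and "g \<in> carrier H \<Longrightarrow> h \<in> carrier H \<Longrightarrow> \<rho> (g \<otimes>\<^bsub>H\<^esub> h) = \<rho> g * \<rho> h"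
    and "\<rho> \<one>\<^bsub>H\<^esub> = 1\<^sub>m n"
proof -
  interpret group_hom H "GL n" \<rho>
    using assms group_GL by (simp add: group_hom_def group_hom_axioms_def)
  show "g \<in> carrier H \<Longrightarrow> \<rho> g \<in> carrier_mat n n" using hom_closed GL_carrier_iff by blast
  show "g \<in> carrier H \<Longrightarrow> h \<in> carrier H \<Longrightarrow> \<rho> (g \<otimes>\<^bsub>H\<^esub> h) = \<rho> g * \<rho> h" by simp
  show "\<rho> \<one>\<^bsub>H\<^esub> = 1\<^sub>m n" using hom_one by simp
qed

lemma matrix_representation:
  assumes "group H" and "\<rho> \<in> hom H (GL n)"
  shows "representation H (\<lambda>_. 0) (cspace n) (\<lambda>g. mat_op n (\<rho> g))"
proof -
  note D = hom_GL_D[OF assms]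
  have "group_action H (carrier_vec n) (\<lambda>g. mat_op n (\<rho> g))"
    by (rule group_actionI[OF assms(1)])
       (auto simp: D mult_mat_vec_carrier[of _ n n] intro!: assoc_mult_mat_vec[of _ n n _ n] D)
  then show ?thesis
    unfolding representation_def by (auto simp: vec_vs cspace_fin_dim linear_map_mat_op D)
qed

lemma matrix_subrepresentation_iff:
  "subrepresentation H (cspace n) (\<lambda>g. mat_op n (\<rho> g)) W \<longleftrightarrow>
     W \<subseteq> carrier_vec n \<and> 0\<^sub>v n \<in> W \<and> (\<forall>u\<in>W. \<forall>v\<in>W. u + v \<in> W) \<and> (\<forall>z. \<forall>v\<in>W. z \<cdot>\<^sub>v v \<in> W) \<and>
     (\<forall>g\<in>carrier H. \<forall>v\<in>W. \<rho> g *\<^sub>v v \<in> W)"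
  unfolding subrepresentation_def subspace_iff
  by (auto simp: vec_vs subset_iff image_subset_iff)

lemma irreducible_matrix_repD:
  assumes "irreducible_matrix_rep H n \<rho>"
  shows "0 < n" and "\<rho> \<in> hom H (GL n)" and "group H"
    and "subrepresentation H (cspace n) (\<lambda>g. mat_op n (\<rho> g)) W \<Longrightarrow>
           W = {0\<^sub>v n} \<or> W = carrier_vec n"
proof -
  have "carrier_vec n \<noteq> {0\<^sub>v n :: complex vec}"
    using assms unfolding irreducible_matrix_rep_def irreducible_representation_def by auto
  moreover have "carrier_vec 0 = {0\<^sub>v 0 :: complex vec}"
  proof -
    have "v = 0\<^sub>v 0" if "v \<in> carrier_vec 0" for v :: "complex vec"
      using that by (intro eq_vecI) auto
    then show ?thesis using zero_carrier_vec by blast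
  qed
  ultimately show "0 < n" by (cases n) auto
  show "\<rho> \<in> hom H (GL n)" using assms unfolding irreducible_matrix_rep_def by blast
  have "group_action H (carrier (cspace n)) (\<lambda>g. mat_op n (\<rho> g))"
    using assms
    unfolding irreducible_matrix_rep_def irreducible_representation_def representation_def by blast
  then show "group H" by (rule group_actionD(1))
  show "W = {0\<^sub>v n} \<or> W = carrier_vec n"
    if "subrepresentation H (cspace n) (\<lambda>g. mat_op n (\<rho> g)) W"
    using assms that unfolding irreducible_matrix_rep_def irreducible_representation_def by auto
qed

text \<open>A complex matrix has an eigenvalue, and its eigenspace is invariant under everything that
  commutes with it.\<close>

lemma Schur_scalar:
  assumes irr: "irreducible_matrix_rep H n \<rho>"
    and lm: "linear_map class_ring (cspace n) (cspace n) f"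
    and comm: "\<And>h v. h \<in> carrier H \<Longrightarrow> v \<in> carrier_vec n \<Longrightarrow> f (\<rho> h *\<^sub>v v) = \<rho> h *\<^sub>v f v"
  shows "\<exists>c. \<forall>v\<in>carrier_vec n. f v = c \<cdot>\<^sub>v v"
proof -
  note irrD = irreducible_matrix_repD[OF irr]
  note \<rho> = hom_GL_D[OF irrD(3,2)]
  obtain A where A: "A \<in> carrier_mat n n" "\<And>v. v \<in> carrier_vec n \<Longrightarrow> f v = A *\<^sub>v v"
    using linear_map_cspace_matrix[OF lm] by blast
  obtain c where "eigenvalue A c"
    using spectrum_non_empty[OF A(1) irrD(1)] unfolding spectrum_def by blast
  then obtain w where w: "w \<in> carrier_vec n" "w \<noteq> 0\<^sub>v n" "f w = c \<cdot>\<^sub>v w"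
    using A unfolding eigenvalue_def eigenvector_def by auto
  have f: "f (u + v) = f u + f v" "f (z \<cdot>\<^sub>v v) = z \<cdot>\<^sub>v f v"
    if "u \<in> carrier_vec n" "v \<in> carrier_vec n" for u v z
    using lm that unfolding linear_map_iff by auto
  let ?W = "{v \<in> carrier_vec n. f v = c \<cdot>\<^sub>v v}"
  have "f (0\<^sub>v n) = c \<cdot>\<^sub>v 0\<^sub>v n" using A by auto
  then have "subrepresentation H (cspace n) (\<lambda>g. mat_op n (\<rho> g)) ?W"
    unfolding matrix_subrepresentation_iff
    using f comm \<rho>(1)
    by (auto simp: smult_add_distrib_vec[of _ n] smult_smult_assoc mult.commute mult_mat_vec[of _ n n]
        mult_mat_vec_carrier[of _ n n])
  moreover have "w \<in> ?W" using w by simp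
  ultimately have "?W = carrier_vec n" using irrD(4) w(2) by blast
  then show ?thesis by blast
qed

section \<open>Actions determined on the kernel and at one antilinear element\<close>

locale magnetic = group G for G :: "('g, 'b) monoid_scheme" (structure) +
  fixes \<phi> :: "'g \<Rightarrow> int" and a :: 'g
  assumes magnetic: "magnetic_group G \<phi>"
    and a_carrier [simp]: "a \<in> carrier G"
    and a_notin: "a \<notin> carrier (unitary_subgroup G \<phi>)"
begin

abbreviation H where "H \<equiv> unitary_subgroup G \<phi>"

lemma carrier_H: "carrier H = {g \<in> carrier G. \<phi> g = 0}"
  by (simp add: unitary_subgroup_def kernel_def)

lemma H_simps [simp]: "x \<otimes>\<^bsub>H\<^esub> y = x \<otimes> y" "\<one>\<^bsub>H\<^esub> = \<one>"
  by (simp_all add: unitary_subgroup_def)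

lemma phi_hom: "group_hom G (integer_mod_group 2) \<phi>"
  using magnetic is_group
  by (simp add: magnetic_group_def epi_def group_hom_def group_hom_axioms_def)

lemma group_H [simp]: "group H"
  unfolding unitary_subgroup_def
  using subgroup.subgroup_is_group[OF group_hom.subgroup_kernel[OF phi_hom] is_group] .

lemma phi_range: "g \<in> carrier G \<Longrightarrow> \<phi> g = 0 \<or> \<phi> g = 1"
  using group_hom.hom_closed[OF phi_hom, of g] by (auto simp: carrier_integer_mod_group)

lemma phi_mult: "g \<in> carrier G \<Longrightarrow> h \<in> carrier G \<Longrightarrow> \<phi> (g \<otimes> h) = (\<phi> g + \<phi> h) mod 2"
  using group_hom.hom_mult[OF phi_hom] by simp

lemma phi_one [simp]: "\<phi> \<one> = 0"
  using group_hom.hom_one[OF phi_hom] by simp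

lemma phi_inv: "g \<in> carrier G \<Longrightarrow> \<phi> (inv g) = \<phi> g"
  using phi_mult[of "inv g" g] phi_range[of g] phi_range[of "inv g"] by auto

lemma phi_a [simp]: "\<phi> a = 1"
  using phi_range[of a] a_notin by (auto simp: carrier_H)

lemma H_mem [simp]:
  "\<one> \<in> carrier H" "a \<otimes> a \<in> carrier H"
  "h \<in> carrier H \<Longrightarrow> inv a \<otimes> h \<otimes> a \<in> carrier H"
  "h \<in> carrier H \<Longrightarrow> k \<in> carrier H \<Longrightarrow> h \<otimes> k \<in> carrier H"
  by (simp_all add: carrier_H phi_mult phi_inv)

lemma coset_mem:
  "x \<in> carrier G \<Longrightarrow> x \<notin> carrier H \<Longrightarrow> inv a \<otimes> x \<in> carrier H"
  "h \<in> carrier H \<Longrightarrow> a \<otimes> h \<notin> carrier H"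
  using phi_range[of x] by (auto simp: carrier_H phi_mult phi_inv)

lemma H_sub [simp]: "h \<in> carrier H \<Longrightarrow> h \<in> carrier G"
  by (simp add: carrier_H)

lemma cancel_a [simp]:
  "x \<in> carrier G \<Longrightarrow> a \<otimes> (inv a \<otimes> x) = x" "x \<in> carrier G \<Longrightarrow> inv a \<otimes> (a \<otimes> x) = x"
  by (simp_all add: m_assoc[symmetric])

lemma carrier_cases:
  assumes "x \<in> carrier G"
  obtains "x \<in> carrier H" | h where "h \<in> carrier H" "x = a \<otimes> h"
proof (cases "x \<in> carrier H")
  case False
  have "x = a \<otimes> (inv a \<otimes> x)" using assms by simp
  then show ?thesis using that(2) coset_mem(1)[OF assms False] by blast
qed (rule that(1))

lemma determined_action_H:
  "h \<in> carrier H \<Longrightarrow> determined_action G \<phi> a S s A h = s h"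
  by (simp add: determined_action_def)

lemma determined_action_coset:
  assumes "h \<in> carrier H" "v \<in> S"
  shows "determined_action G \<phi> a S s A (a \<otimes> h) v = A (s h v)"
  using assms coset_mem(2)[of h]
  by (simp add: determined_action_def compose_def m_assoc[symmetric])

text \<open>The hypotheses \<open>comm\<close> and \<open>sq\<close> express conjugation by \<open>a\<close> on the kernel and the position of
  \<open>a\<^sup>2\<close> in it. These two relations reduce a product of elements of the form \<open>h\<close> or \<open>a h\<close> to this
  form again, which gives multiplicativity in all four cases.\<close>

lemma determined_action_representation:
  assumes rep: "representation H (\<lambda>_. 0) V s" and A: "antilinear_map V V A"
    and comm: "\<And>h v. h \<in> carrier H \<Longrightarrow> v \<in> carrier V \<Longrightarrow> s h (A v) = A (s (inv a \<otimes> h \<otimes> a) v)"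
    and sq: "\<And>v. v \<in> carrier V \<Longrightarrow> A (A v) = s (a \<otimes> a) v"
  shows "representation G \<phi> V (determined_action G \<phi> a (carrier V) s A)"
proof -
  let ?r = "determined_action G \<phi> a (carrier V) s A"
  have V: "vectorspace class_ring V" "vectorspace.fin_dim class_ring V"
    and ga: "group_action H (carrier V) s"
    and lin: "\<And>h. h \<in> carrier H \<Longrightarrow> linear_map class_ring V V (s h)"
    using rep unfolding representation_def by auto
  note s = group_actionD[OF ga, simplified]
  have Acl: "A v \<in> carrier V" if "v \<in> carrier V" for v
    using A that unfolding antilinear_map_def by auto
  note rH = determined_action_H and ra = determined_action_coset
  have "group_action G (carrier V) ?r"
  proof (rule group_actionI[OF is_group])
    fix g assume g: "g \<in> carrier G"
    show "?r g \<in> extensional (carrier V)"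
      using s(2) by (simp add: determined_action_def)
    show "?r g x \<in> carrier V" if "x \<in> carrier V" for x
      using g by (cases rule: carrier_cases) (auto simp: rH ra s(3) Acl that)
    fix k x assume k: "k \<in> carrier G" and x: "x \<in> carrier V"
    show "?r (g \<otimes> k) x = ?r g (?r k x)"
      using g
    proof (cases rule: carrier_cases)
      case 1
      show ?thesis
        using k
      proof (cases rule: carrier_cases)
        case 1
        then show ?thesis using \<open>g \<in> carrier H\<close> x by (simp add: rH s)
      next
        case (2 h)
        have "g \<otimes> k = a \<otimes> ((inv a \<otimes> g \<otimes> a) \<otimes> h)"
          using 1 2 \<open>g \<in> carrier H\<close> by (simp add: m_assoc)
        then show ?thesis
          using 1 2 \<open>g \<in> carrier H\<close> x by (simp add: rH ra s comm)
      qed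
    next
      case (2 h)
      show ?thesis
        using k
      proof (cases rule: carrier_cases)
        case 1
        then have "g \<otimes> k = a \<otimes> (h \<otimes> k)" using 2 by (simp add: m_assoc)
        then show ?thesis using 1 2 x by (simp add: rH ra s)
      next
        case (2 h')
        have "(a \<otimes> h) \<otimes> (a \<otimes> h') = (a \<otimes> a) \<otimes> ((inv a \<otimes> h \<otimes> a) \<otimes> h')"
          using 2 \<open>h \<in> carrier H\<close> by (simp add: m_assoc)
        then show ?thesis
          using 2 \<open>h \<in> carrier H\<close> \<open>g = a \<otimes> h\<close> x
          by (simp add: rH ra s comm sq Acl)
      qed
    qed
  next
    show "?r \<one> x = x" if "x \<in> carrier V" for x using that by (simp add: rH s)
  qed
  moreover have "linear_map class_ring V V (?r g)" if "g \<in> carrier G" "\<phi> g = 0" for g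
  proof -
    have "g \<in> carrier H" using that unfolding carrier_H by blast
    then show ?thesis using lin by (simp add: rH)
  qed
  moreover have "antilinear_map V V (?r g)" if "g \<in> carrier G" "\<phi> g = 1" for g
    using that(1)
  proof (cases rule: carrier_cases)
    case (2 h)
    interpret V: vectorspace class_ring V by (rule V(1))
    have smV: "z \<odot>\<^bsub>V\<^esub> v \<in> carrier V" if "v \<in> carrier V" for v z
      using that V.smult_closed[of z] by auto
    show ?thesis
      using A lin[OF 2(1)] unfolding 2(2) antilinear_map_def linear_map_iff
      by (auto simp: ra 2(1) smV s(3))
  next
    case 1
    then show ?thesis using that(2) unfolding carrier_H by simp
  qed
  ultimately show ?thesis using V unfolding representation_def by blast
qed

lemma invariant_by_generators:
  assumes rep: "representation G \<phi> V r" and W: "W \<subseteq> carrier V"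
    and inv: "\<And>h v. h \<in> carrier H \<Longrightarrow> v \<in> W \<Longrightarrow> r h v \<in> W" "\<And>v. v \<in> W \<Longrightarrow> r a v \<in> W"
    and g: "g \<in> carrier G"
  shows "r g ` W \<subseteq> W"
  using g
proof (cases rule: carrier_cases)
  case (2 h)
  have "group_action G (carrier V) r" using rep unfolding representation_def by blast
  then show ?thesis using 2 inv W by (auto simp: group_actionD(4) subset_iff)
qed (use inv in auto)

end

section \<open>The induced representation in block form\<close>

lemma vec_split:
  assumes "w \<in> carrier_vec (n + m)"
  obtains u v where "u \<in> carrier_vec n" "v \<in> carrier_vec m" "w = u @\<^sub>v v"
  using vec_first_last_append[OF assms] by (metis vec_first_carrier vec_last_carrier)

lemma append_vec_smult: "z \<cdot>\<^sub>v (u @\<^sub>v v) = (z \<cdot>\<^sub>v u) @\<^sub>v (z \<cdot>\<^sub>v v)" for z :: complex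
  by (intro eq_vecI) auto

lemma append_vec_conjugate: "conjugate (u @\<^sub>v v) = conjugate u @\<^sub>v conjugate (v :: complex vec)"
  by (intro eq_vecI) auto

lemma append_vec_zero: "0\<^sub>v n @\<^sub>v 0\<^sub>v m = (0\<^sub>v (n + m) :: complex vec)"
  by (intro eq_vecI) auto

lemma conjugate_carrier [simp]: "conjugate v \<in> carrier_vec n \<longleftrightarrow> v \<in> carrier_vec n"
  for v :: "complex vec"
  by (metis carrier_vec_conjugate conjugate_id)

lemma smult_neg_one: "u + (-1) \<cdot>\<^sub>v v = u - v" if "u \<in> carrier_vec n" "v \<in> carrier_vec n"
  for u v :: "complex vec"
  using that by (intro eq_vecI) auto

lemma zero_mat_mult_vec: "v \<in> carrier_vec n \<Longrightarrow> 0\<^sub>m m n *\<^sub>v v = (0\<^sub>v m :: complex vec)"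
  by (intro eq_vecI) auto

lemma cnj_mat_carrier [simp]: "cnj_mat A \<in> carrier_mat n m \<longleftrightarrow> A \<in> carrier_mat n m"
  by (simp add: cnj_mat_def)

locale magnetic_irrep = magnetic G \<phi> a
  for G :: "('g, 'b) monoid_scheme" (structure) and \<phi> and a +
  fixes n :: nat and \<rho> :: "'g \<Rightarrow> complex mat"
  assumes irr: "irreducible_matrix_rep H n \<rho>"
begin

abbreviation crho where "crho \<equiv> conjugate_rep G a \<rho>"
abbreviation Cn :: "complex vec set" where "Cn \<equiv> carrier_vec n"
abbreviation Cnn :: "complex vec set" where "Cnn \<equiv> carrier_vec (n + n)"
abbreviation Vn where "Vn \<equiv> cspace n"
abbreviation Vnn where "Vnn \<equiv> cspace (n + n)"
abbreviation rho_op where "rho_op \<equiv> (\<lambda>g. mat_op n (\<rho> g))"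
abbreviation crho_op where "crho_op \<equiv> (\<lambda>g. mat_op n (crho g))"

lemmas rho = hom_GL_D[OF group_H irreducible_matrix_repD(2)[OF irr], simplified]

lemma rho_cl [simp]:
  "h \<in> carrier H \<Longrightarrow> v \<in> Cn \<Longrightarrow> \<rho> h *\<^sub>v v \<in> Cn"
  using rho(1) by (metis mult_mat_vec_carrier)

lemma rho_mult:
  "h \<in> carrier H \<Longrightarrow> k \<in> carrier H \<Longrightarrow> v \<in> Cn \<Longrightarrow>
     \<rho> (h \<otimes> k) *\<^sub>v v = \<rho> h *\<^sub>v (\<rho> k *\<^sub>v v)"
  by (simp add: rho(2) assoc_mult_mat_vec[OF rho(1) rho(1)])

lemma rho_one [simp]: "v \<in> Cn \<Longrightarrow> \<rho> \<one> *\<^sub>v v = v"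
  by (simp add: rho(3))

lemma rho_lin:
  assumes "h \<in> carrier H" "u \<in> Cn" "v \<in> Cn"
  shows "\<rho> h *\<^sub>v (u + v) = \<rho> h *\<^sub>v u + \<rho> h *\<^sub>v v" "\<rho> h *\<^sub>v (z \<cdot>\<^sub>v v) = z \<cdot>\<^sub>v (\<rho> h *\<^sub>v v)"
    "\<rho> h *\<^sub>v 0\<^sub>v n = 0\<^sub>v n"
  using assms rho(1)[of h]
  by (auto simp: mult_add_distrib_mat_vec[of _ n n] mult_mat_vec[of _ n n])

lemma rho_zero [simp]: "h \<in> carrier H \<Longrightarrow> \<rho> h *\<^sub>v 0\<^sub>v n = 0\<^sub>v n"
  by (simp add: rho_lin(3)[of _ "0\<^sub>v n" "0\<^sub>v n"])

lemma rho_inj: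
  assumes h: "h \<in> carrier H" and v: "v \<in> Cn" and 0: "\<rho> h *\<^sub>v v = 0\<^sub>v n"
  shows "v = 0\<^sub>v n"
proof -
  have hi: "inv\<^bsub>H\<^esub> h \<in> carrier H" "inv\<^bsub>H\<^esub> h \<otimes> h = \<one>"
    using h group.inv_closed[OF group_H] group.l_inv[OF group_H h] by auto
  then have "v = \<rho> (inv\<^bsub>H\<^esub> h) *\<^sub>v (\<rho> h *\<^sub>v v)" using rho_mult[OF hi(1) h v] v by simp
  then show ?thesis using 0 hi(1) by simp
qed

lemma crho_eq:
  assumes "h \<in> carrier H" "v \<in> Cn"
  shows "crho h *\<^sub>v v = conjugate (\<rho> (inv a \<otimes> h \<otimes> a) *\<^sub>v conjugate v)"
  unfolding conjugate_rep_def by (rule cnj_mat_mult_vec[OF rho(1)]) (use assms in simp_all)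

lemma crho_carrier [simp]: "h \<in> carrier H \<Longrightarrow> crho h \<in> carrier_mat n n"
  unfolding conjugate_rep_def using rho(1) by simp

lemma crho_cl [simp]:
  "h \<in> carrier H \<Longrightarrow> v \<in> Cn \<Longrightarrow> crho h *\<^sub>v v \<in> Cn"
  by (simp add: crho_eq)

lemma crho_mult:
  assumes "h \<in> carrier H" "k \<in> carrier H" "v \<in> Cn"
  shows "crho (h \<otimes> k) *\<^sub>v v = crho h *\<^sub>v (crho k *\<^sub>v v)"
proof -
  have "inv a \<otimes> (h \<otimes> k) \<otimes> a = (inv a \<otimes> h \<otimes> a) \<otimes> (inv a \<otimes> k \<otimes> a)"
    using assms by (simp add: m_assoc)
  then show ?thesis using assms by (simp add: crho_eq rho_mult)
qed

lemma crho_one [simp]: "v \<in> Cn \<Longrightarrow> crho \<one> *\<^sub>v v = v"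
  by (simp add: crho_eq)

lemma crho_zero [simp]: "h \<in> carrier H \<Longrightarrow> crho h *\<^sub>v 0\<^sub>v n = 0\<^sub>v n"
  by (simp add: crho_eq)

text \<open>The matrix form of the induced representation on \<open>\<complex>\<^sup>n \<oplus> \<complex>\<^sup>n\<close>. It is defined without reference to
  the tensor product; the two are compared in \<open>Ind_ident_iso\<close>.\<close>

definition block :: "'g \<Rightarrow> complex vec \<Rightarrow> complex vec" where
  "block = determined_action G \<phi> a Cnn
     (\<lambda>h. mat_op (n + n) (four_block_mat (\<rho> h) (0\<^sub>m n n) (0\<^sub>m n n) (crho h)))
     (conj_mat_op (n + n) (four_block_mat (0\<^sub>m n n) (\<rho> (a \<otimes> a)) (1\<^sub>m n) (0\<^sub>m n n)))"

lemma block_H_op: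
  assumes "h \<in> carrier H" "u \<in> Cn" "v \<in> Cn"
  shows "mat_op (n + n) (four_block_mat (\<rho> h) (0\<^sub>m n n) (0\<^sub>m n n) (crho h)) (u @\<^sub>v v) =
         \<rho> h *\<^sub>v u @\<^sub>v crho h *\<^sub>v v"
  using assms mult_mat_vec_split[OF rho(1) crho_carrier] by simp

lemma block_a_op:
  assumes u: "u \<in> Cn" and v: "v \<in> Cn"
  shows "conj_mat_op (n + n) (four_block_mat (0\<^sub>m n n) (\<rho> (a \<otimes> a)) (1\<^sub>m n) (0\<^sub>m n n)) (u @\<^sub>v v) =
         \<rho> (a \<otimes> a) *\<^sub>v conjugate v @\<^sub>v conjugate u"
  using assms four_block_mat_mult_vec[OF zero_carrier_mat[of n n] rho(1) one_carrier_mat[of n]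
    zero_carrier_mat[of n n], of "a \<otimes> a" "conjugate u" "conjugate v"]
  by (simp add: append_vec_conjugate zero_mat_mult_vec)

lemma block_H:
  "h \<in> carrier H \<Longrightarrow> u \<in> Cn \<Longrightarrow> v \<in> Cn \<Longrightarrow>
     block h (u @\<^sub>v v) = \<rho> h *\<^sub>v u @\<^sub>v crho h *\<^sub>v v"
  unfolding block_def by (simp only: determined_action_H block_H_op)

lemma block_aH:
  assumes "h \<in> carrier H" "u \<in> Cn" "v \<in> Cn"
  shows "block (a \<otimes> h) (u @\<^sub>v v) = \<rho> (a \<otimes> a) *\<^sub>v conjugate (crho h *\<^sub>v v) @\<^sub>v conjugate (\<rho> h *\<^sub>v u)"
  using assms unfolding block_def
  by (subst determined_action_coset) (simp_all only: block_H_op block_a_op rho_cl crho_cl append_carrier_vec)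

lemma block_a:
  assumes "u \<in> Cn" "v \<in> Cn"
  shows "block a (u @\<^sub>v v) = \<rho> (a \<otimes> a) *\<^sub>v conjugate v @\<^sub>v conjugate u"
  using block_aH[of \<one>] assms by simp

lemma block_representation: "representation G \<phi> Vnn block"
proof -
  let ?s = "\<lambda>h. mat_op (n + n) (four_block_mat (\<rho> h) (0\<^sub>m n n) (0\<^sub>m n n) (crho h))"
  have car: "four_block_mat (\<rho> h) (0\<^sub>m n n) (0\<^sub>m n n) (crho h) \<in> carrier_mat (n + n) (n + n)"
    if "h \<in> carrier H" for h
    using that rho(1) by (intro four_block_carrier_mat) auto
  have "group_action H Cnn ?s"
  proof (rule group_actionI[OF group_H])
    fix g h and x :: "complex vec" assume g: "g \<in> carrier H" and x: "x \<in> Cnn"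
    obtain u v where uv: "u \<in> Cn" "v \<in> Cn" "x = u @\<^sub>v v"
      using vec_split[OF x] .
    show "?s g x \<in> Cnn" using g uv by (simp only: block_H_op) simp
    assume "h \<in> carrier H"
    then show "?s (g \<otimes>\<^bsub>H\<^esub> h) x = ?s g (?s h x)"
      using g uv by (simp only: block_H_op rho_cl crho_cl H_simps H_mem rho_mult crho_mult)
  next
    fix x :: "complex vec" assume x: "x \<in> Cnn"
    obtain u v where uv: "u \<in> Cn" "v \<in> Cn" "x = u @\<^sub>v v"
      using vec_split[OF x] .
    then show "?s \<one>\<^bsub>H\<^esub> x = x" by (simp only: block_H_op H_simps H_mem rho_one crho_one)
  qed simp
  then have rep: "representation H (\<lambda>_. 0) Vnn ?s"
    unfolding representation_def by (auto simp: vec_vs cspace_fin_dim linear_map_mat_op car)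
  have "representation G \<phi> Vnn (determined_action G \<phi> a (carrier Vnn) ?s
     (conj_mat_op (n + n) (four_block_mat (0\<^sub>m n n) (\<rho> (a \<otimes> a)) (1\<^sub>m n) (0\<^sub>m n n))))"
  proof (rule determined_action_representation[OF rep antilinear_map_conj_mat_op])
    show "four_block_mat (0\<^sub>m n n) (\<rho> (a \<otimes> a)) (1\<^sub>m n) (0\<^sub>m n n) \<in> carrier_mat (n + n) (n + n)"
      by (intro four_block_carrier_mat) auto
    fix x assume "x \<in> carrier Vnn"
    then obtain u v where uv: "u \<in> Cn" "v \<in> Cn" "x = u @\<^sub>v v"
      using vec_split[of x n n] by auto
    let ?A = "conj_mat_op (n + n) (four_block_mat (0\<^sub>m n n) (\<rho> (a \<otimes> a)) (1\<^sub>m n) (0\<^sub>m n n))"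
    { fix h assume h: "h \<in> carrier H"
      let ?t = "inv a \<otimes> h \<otimes> a"
      have "(a \<otimes> a) \<otimes> (inv a \<otimes> ?t \<otimes> a) = h \<otimes> (a \<otimes> a)"
        using h by (simp add: m_assoc)
      then have "\<rho> h *\<^sub>v (\<rho> (a \<otimes> a) *\<^sub>v conjugate v) =
            \<rho> (a \<otimes> a) *\<^sub>v (\<rho> (inv a \<otimes> ?t \<otimes> a) *\<^sub>v conjugate v)"
        using h uv rho_mult[of h "a \<otimes> a" "conjugate v"]
          rho_mult[of "a \<otimes> a" "inv a \<otimes> ?t \<otimes> a" "conjugate v"] by simp
      then have "\<rho> h *\<^sub>v (\<rho> (a \<otimes> a) *\<^sub>v conjugate v) = \<rho> (a \<otimes> a) *\<^sub>v conjugate (crho ?t *\<^sub>v v)"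
        using h uv by (simp add: crho_eq)
      moreover have "crho h *\<^sub>v conjugate u = conjugate (\<rho> ?t *\<^sub>v u)"
        using h uv by (simp add: crho_eq)
      ultimately show "?s h (?A x) = ?A (?s ?t x)"
        using h uv by (simp only: block_H_op block_a_op conjugate_carrier rho_cl crho_cl H_mem) }
    have "conjugate (\<rho> (a \<otimes> a) *\<^sub>v conjugate v) = crho (a \<otimes> a) *\<^sub>v v"
      using uv by (simp add: crho_eq m_assoc)
    then show "?A (?A x) = ?s (a \<otimes> a) x"
      using uv by (simp only: block_H_op block_a_op conjugate_carrier rho_cl H_mem conjugate_id)
  qed
  then show ?thesis unfolding block_def by simp
qed

end

section \<open>Invariant subspaces of the block form\<close>

context magnetic_irrep
begin

lemma block_subrepresentation_iff:
  "subrepresentation G Vnn block W \<longleftrightarrow>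
     W \<subseteq> Cnn \<and> 0\<^sub>v (n + n) \<in> W \<and> (\<forall>x\<in>W. \<forall>y\<in>W. x + y \<in> W) \<and>
     (\<forall>z. \<forall>x\<in>W. z \<cdot>\<^sub>v x \<in> W) \<and>
     (\<forall>h\<in>carrier H. \<forall>x\<in>W. block h x \<in> W) \<and> (\<forall>x\<in>W. block a x \<in> W)"
  (is "?L \<longleftrightarrow> ?R")
proof
  assume ?L
  then have "VectorSpace.subspace class_ring W Vnn"
    and "\<And>g. g \<in> carrier G \<Longrightarrow> block g ` W \<subseteq> W"
    unfolding subrepresentation_def by auto
  then show ?R unfolding subspace_iff by (auto simp: image_subset_iff)
next
  assume R: ?R
  then have "block g ` W \<subseteq> W" if "g \<in> carrier G" for g
    using invariant_by_generators[OF block_representation _ _ _ that, of W] by auto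
  then show ?L unfolding subrepresentation_def subspace_iff using R by (auto simp: vec_vs)
qed

text \<open>Since \<open>a\<close> exchanges the two summands, an invariant subspace that contains one of them contains the
  other. By irreducibility of \<open>\<rho>\<close> a proper one meets both trivially, so if it is nonzero it projects
  isomorphically to both. Statements about the second summand are deduced from the first by applying
  \<open>a\<close>.\<close>

lemma invariant_subspace_is_graph:
  assumes W: "subrepresentation G Vnn block W"
    and ne: "W \<noteq> {0\<^sub>v (n + n)}" and proper: "W \<noteq> Cnn"
  obtains S where
    "rep_iso H Vn rho_op Vn crho_op S"
    "\<And>u v. u \<in> Cn \<Longrightarrow> v \<in> Cn \<Longrightarrow> u @\<^sub>v v \<in> W \<longleftrightarrow> v = S u"
proof -
  note Wr = W[unfolded block_subrepresentation_iff]
  have Wc: "x \<in> Cnn" if "x \<in> W" for x using Wr that by blast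
  have W0: "0\<^sub>v n @\<^sub>v 0\<^sub>v n \<in> W" using Wr by (simp add: append_vec_zero)
  have Wadd: "(u + u') @\<^sub>v (v + v') \<in> W"
    if "u @\<^sub>v v \<in> W" "u' @\<^sub>v v' \<in> W" "u \<in> Cn" "v \<in> Cn"
      "u' \<in> Cn" "v' \<in> Cn" for u v u' v'
    using Wr that by (metis append_vec_add)
  have Wsm: "(z \<cdot>\<^sub>v u) @\<^sub>v (z \<cdot>\<^sub>v v) \<in> W" if "u @\<^sub>v v \<in> W" for u v z
    using Wr that by (metis append_vec_smult)
  have Wdiff: "(u - u') @\<^sub>v (v - v') \<in> W"
    if "u @\<^sub>v v \<in> W" "u' @\<^sub>v v' \<in> W" "u \<in> Cn" "v \<in> Cn"
      "u' \<in> Cn" "v' \<in> Cn" for u v u' v'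
    using Wadd[OF that(1) Wsm[OF that(2), of "-1"]] that by (simp add: smult_neg_one)
  have WH: "(\<rho> h *\<^sub>v u) @\<^sub>v (crho h *\<^sub>v v) \<in> W"
    if "h \<in> carrier H" "u @\<^sub>v v \<in> W" "u \<in> Cn" "v \<in> Cn" for h u v
    using Wr that block_H by metis
  have Wa: "(\<rho> (a \<otimes> a) *\<^sub>v conjugate v) @\<^sub>v conjugate u \<in> W"
    if "u @\<^sub>v v \<in> W" "u \<in> Cn" "v \<in> Cn" for u v
    using Wr that block_a by metis
  have zero_diff: "x - x = 0\<^sub>v n" if "x \<in> Cn" for x :: "complex vec"
    using that by auto
  have diff_zero: "x = y" if "x - y = 0\<^sub>v n" "x \<in> Cn" "y \<in> Cn"
    for x y :: "complex vec"
  proof (rule eq_vecI)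
    fix i assume "i < dim_vec y"
    then have i: "i < n" using that(3) by simp
    then have "x $ i - y $ i = (x - y) $ i" using that(3) by simp
    also have "\<dots> = 0" unfolding that(1) using i by simp
    finally show "x $ i = y $ i" by simp
  qed (use that in auto)
  have zcs: "z \<cdot>\<^sub>v 0\<^sub>v n = (0\<^sub>v n :: complex vec)" for z by (intro eq_vecI) auto

  \<comment> \<open>the intersection with the first summand vanishes, otherwise it is the whole summand, and
    applying \<open>a\<close> shows that the second summand lies in \<open>W\<close> as well\<close>
  define L where "L = {u \<in> Cn. u @\<^sub>v 0\<^sub>v n \<in> W}"
  have "subrepresentation H Vn rho_op L"
    unfolding matrix_subrepresentation_iff
  proof (intro conjI ballI allI)
    show "L \<subseteq> Cn" "0\<^sub>v n \<in> L" using W0 by (auto simp: L_def)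
    fix u v z h assume "u \<in> L"
    then have u: "u \<in> Cn" "u @\<^sub>v 0\<^sub>v n \<in> W" by (auto simp: L_def)
    show "z \<cdot>\<^sub>v u \<in> L" using Wsm[OF u(2), of z] u(1) by (simp add: L_def zcs)
    { assume "v \<in> L"
      then have v: "v \<in> Cn" "v @\<^sub>v 0\<^sub>v n \<in> W" by (auto simp: L_def)
      show "u + v \<in> L" using Wadd[OF u(2) v(2) u(1) _ v(1)] u(1) v(1) by (simp add: L_def) }
    assume "h \<in> carrier H"
    then show "\<rho> h *\<^sub>v u \<in> L" using WH[OF _ u(2) u(1)] u(1) by (simp add: L_def)
  qed
  from irreducible_matrix_repD(4)[OF irr this]
  consider "L = {0\<^sub>v n}" | "L = Cn" by blast
  then have L0: "L = {0\<^sub>v n}"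
  proof cases
    case 2
    have inL: "u @\<^sub>v 0\<^sub>v n \<in> W" if "u \<in> Cn" for u
      using that 2 unfolding L_def by blast
    have full: "u @\<^sub>v v \<in> W" if uv: "u \<in> Cn" "v \<in> Cn" for u v
    proof -
      have "u @\<^sub>v 0\<^sub>v n \<in> W" "conjugate v @\<^sub>v 0\<^sub>v n \<in> W"
        using inL uv by simp_all
      moreover from Wa[OF this(2)] uv have "0\<^sub>v n @\<^sub>v v \<in> W" by simp
      ultimately show ?thesis using Wadd[of u "0\<^sub>v n" "0\<^sub>v n" v] uv by simp
    qed
    have "x \<in> W" if "x \<in> Cnn" for x
      using vec_split[OF that] full by metis
    then show ?thesis using proper Wc by blast
  qed
  have first0: "u = 0\<^sub>v n" if "u @\<^sub>v 0\<^sub>v n \<in> W" "u \<in> Cn" for u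
    using that L0 unfolding L_def by blast
  have second0: "v = 0\<^sub>v n" if "0\<^sub>v n @\<^sub>v v \<in> W" "v \<in> Cn" for v
  proof -
    have "\<rho> (a \<otimes> a) *\<^sub>v conjugate v = 0\<^sub>v n"
      using Wa[OF that(1)] that(2) by (intro first0) auto
    then have "conjugate v = 0\<^sub>v n"
      using rho_inj[OF H_mem(2), of "conjugate v"] that(2) by simp
    then show ?thesis by simp
  qed

  \<comment> \<open>\<open>P\<close> is the projection of \<open>W\<close> to the first summand; it is invariant, and
    nonzero because \<open>W\<close> is not contained in the second summand\<close>
  define P where "P = {u \<in> Cn. \<exists>v\<in>Cn. u @\<^sub>v v \<in> W}"
  have subP: "subrepresentation H Vn rho_op P"
    unfolding matrix_subrepresentation_iff
  proof (intro conjI ballI allI)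
    show "P \<subseteq> Cn" "0\<^sub>v n \<in> P" using W0 by (auto simp: P_def)
    fix u v z h assume "u \<in> P"
    then obtain u' where u: "u \<in> Cn" "u' \<in> Cn" "u @\<^sub>v u' \<in> W"
      by (auto simp: P_def)
    show "z \<cdot>\<^sub>v u \<in> P" using Wsm[OF u(3), of z] u by (auto simp: P_def)
    { assume "v \<in> P"
      then obtain v' where v: "v \<in> Cn" "v' \<in> Cn" "v @\<^sub>v v' \<in> W"
        by (auto simp: P_def)
      have "u' + v' \<in> Cn" "u + v \<in> Cn" using u v by auto
      then show "u + v \<in> P" using Wadd[OF u(3) v(3) u(1,2) v(1,2)] unfolding P_def by blast }
    assume "h \<in> carrier H"
    then show "\<rho> h *\<^sub>v u \<in> P"
      using WH[OF _ u(3) u(1,2), of h] rho_cl[of h u] crho_cl[of h u'] u unfolding P_def by blast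
  qed
  have "P \<noteq> {0\<^sub>v n}"
  proof
    assume P: "P = {0\<^sub>v n}"
    have "x = 0\<^sub>v (n + n)" if x: "x \<in> W" for x
    proof -
      obtain u v where uv: "u \<in> Cn" "v \<in> Cn" "x = u @\<^sub>v v"
        using vec_split[OF Wc[OF x]] .
      then have "u \<in> P" using x unfolding P_def by blast
      then have "u = 0\<^sub>v n" using P by blast
      moreover from this have "v = 0\<^sub>v n" using second0[of v] uv x by simp
      ultimately show ?thesis using uv(3) by (simp add: append_vec_zero)
    qed
    then show False using ne Wr by blast
  qed
  with irreducible_matrix_repD(4)[OF irr subP] have P: "P = Cn" by blast

  define S where "S u = (SOME v. v \<in> Cn \<and> u @\<^sub>v v \<in> W)" for u
  have S: "S u \<in> Cn" "u @\<^sub>v S u \<in> W" if "u \<in> Cn" for u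
  proof -
    have "\<exists>v. v \<in> Cn \<and> u @\<^sub>v v \<in> W" using that P unfolding P_def by blast
    then show "S u \<in> Cn" "u @\<^sub>v S u \<in> W"
      unfolding S_def by (metis (mono_tags, lifting) someI_ex)+
  qed
  have Suniq: "v = S u" if "u \<in> Cn" "v \<in> Cn" "u @\<^sub>v v \<in> W" for u v
  proof -
    have "(u - u) @\<^sub>v (v - S u) \<in> W" using Wdiff[OF that(3) S(2)] S(1) that by blast
    then have "v - S u = 0\<^sub>v n" using that S(1) by (intro second0) (auto simp: zero_diff)
    then show ?thesis using diff_zero that S(1) by blast
  qed
  have lm: "linear_map class_ring Vn Vn S"
    unfolding linear_map_iff
  proof (intro conjI ballI allI)
    show "S \<in> carrier Vn \<rightarrow> carrier Vn" using S by auto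
    fix u v z assume "v \<in> carrier Vn"
    then have v: "v \<in> Cn" by simp
    { assume "u \<in> carrier Vn"
      then have u: "u \<in> Cn" by simp
      have "S u + S v = S (u + v)"
        using Wadd[OF S(2) S(2)] S u v by (intro Suniq) auto
      then show "S (u \<oplus>\<^bsub>Vn\<^esub> v) = S u \<oplus>\<^bsub>Vn\<^esub> S v" by simp }
    have "z \<cdot>\<^sub>v S v = S (z \<cdot>\<^sub>v v)" using Wsm[OF S(2)] S v by (intro Suniq) auto
    then show "S (z \<odot>\<^bsub>Vn\<^esub> v) = z \<odot>\<^bsub>Vn\<^esub> S v" by simp
  qed (rule vec_vs)+
  have bij: "bij_betw S Cn Cn"
  proof (rule bij_betw_imageI)
    show "inj_on S Cn"
    proof (rule inj_onI)
      fix u v assume uv: "u \<in> Cn" "v \<in> Cn" and eq: "S u = S v"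
      have "(u - v) @\<^sub>v (S u - S v) \<in> W" using Wdiff S uv by blast
      then have "(u - v) @\<^sub>v 0\<^sub>v n \<in> W" using eq S uv by (simp add: zero_diff)
      then show "u = v" using first0 diff_zero uv by auto
    qed
    have "v \<in> S ` Cn" if v: "v \<in> Cn" for v
    proof -
      have "(\<rho> (a \<otimes> a) *\<^sub>v conjugate (S (conjugate v))) @\<^sub>v conjugate (conjugate v) \<in> W"
        using v S by (intro Wa) auto
      then have "v = S (\<rho> (a \<otimes> a) *\<^sub>v conjugate (S (conjugate v)))"
        using v S by (intro Suniq) auto
      then show ?thesis using v S by (metis H_mem(2) conjugate_carrier image_eqI rho_cl)
    qed
    then show "S ` Cn = Cn" using S by auto
  qed
  have eqv: "S (\<rho> h *\<^sub>v u) = crho h *\<^sub>v S u" if "h \<in> carrier H" "u \<in> Cn" for h u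
    using WH[OF that(1) S(2)[OF that(2)]] S that by (intro Suniq[symmetric]) auto
  show ?thesis
  proof (rule that)
    show "rep_iso H Vn rho_op Vn crho_op S"
      unfolding rep_iso_def using lm bij eqv S by auto
    show "u @\<^sub>v v \<in> W \<longleftrightarrow> v = S u" if "u \<in> Cn" "v \<in> Cn" for u v
      using that S Suniq by blast
  qed
qed

lemma block_nonzero: "Cnn \<noteq> {0\<^sub>v (n + n) :: complex vec}"
proof
  assume "Cnn = {0\<^sub>v (n + n) :: complex vec}"
  then have "unit_vec (n + n) 0 = (0\<^sub>v (n + n) :: complex vec)"
    using unit_vec_carrier by blast
  then show False using irreducible_matrix_repD(1)[OF irr] unit_vec_nonzero by fastforce
qed

lemma block_irreducible_complex:
  assumes "complex_type G \<phi> a n \<rho>"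
  shows "irreducible_representation G \<phi> Vnn block"
proof -
  have "W = {0\<^sub>v (n + n)} \<or> W = Cnn"
    if "subrepresentation G Vnn block W" for W
    using invariant_subspace_is_graph[OF that] assms
    unfolding complex_type_def rep_isomorphic_def by metis
  then show ?thesis
    using block_representation block_nonzero unfolding irreducible_representation_def by auto
qed

lemma intertwinerD:
  assumes "matrix_rep_iso H n crho \<rho> T"
  shows "T \<in> carrier_mat n n"
    and "v \<in> Cn \<Longrightarrow> T *\<^sub>v v \<in> Cn"
    and "h \<in> carrier H \<Longrightarrow> v \<in> Cn \<Longrightarrow> T *\<^sub>v (crho h *\<^sub>v v) = \<rho> h *\<^sub>v (T *\<^sub>v v)"
    and "bij_betw (\<lambda>v. T *\<^sub>v v) Cn Cn"
proof -
  show T: "T \<in> carrier_mat n n" using assms unfolding matrix_rep_iso_def by blast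
  show "v \<in> Cn \<Longrightarrow> T *\<^sub>v v \<in> Cn" using T by simp
  show "h \<in> carrier H \<Longrightarrow> v \<in> Cn \<Longrightarrow> T *\<^sub>v (crho h *\<^sub>v v) = \<rho> h *\<^sub>v (T *\<^sub>v v)"
    using assms T unfolding matrix_rep_iso_def rep_iso_def by auto
  have "bij_betw (mat_op n T) Cn Cn"
    using assms unfolding matrix_rep_iso_def rep_iso_def by auto
  then show "bij_betw (\<lambda>v. T *\<^sub>v v) Cn Cn"
    by (subst bij_betw_cong[of _ _ "mat_op n T"]) simp_all
qed

lemma square_eq:
  assumes T: "T \<in> carrier_mat n n" and eq: "T * cnj_mat T = B" and v: "v \<in> Cn"
  shows "T *\<^sub>v conjugate (T *\<^sub>v conjugate v) = B *\<^sub>v v"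
  using assms by (auto simp: cnj_mat_mult_vec[symmetric] assoc_mult_mat_vec[of _ n n _ n])

text \<open>If the graph of \<open>S\<close> is invariant, then \<open>T S\<close> is a scalar \<open>c\<close> by Schur's lemma. Invariance of the graph
  under \<open>a\<close> then gives \<open>w = - \<bar>c\<bar>\<^sup>2 w\<close> for every \<open>w\<close> of the form \<open>T (K v)\<close>, which forces \<open>w = 0\<close>.\<close>

lemma block_irreducible_quaternionic:
  assumes T: "matrix_rep_iso H n crho \<rho> T" and sq: "T * cnj_mat T = - \<rho> (a \<otimes> a)"
  shows "irreducible_representation G \<phi> Vnn block"
proof -
  note TD = intertwinerD[OF T]
  have Tsm: "T *\<^sub>v (z \<cdot>\<^sub>v v) = z \<cdot>\<^sub>v (T *\<^sub>v v)" if "v \<in> Cn" for z v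
    using TD(1) that by (simp add: mult_mat_vec)
  have "W = {0\<^sub>v (n + n)} \<or> W = Cnn"
    if W: "subrepresentation G Vnn block W" for W
  proof (rule ccontr)
    assume "\<not> ?thesis"
    then obtain S where
      S: "rep_iso H Vn rho_op Vn crho_op S"
      and WS: "\<And>u v. u \<in> Cn \<Longrightarrow> v \<in> Cn \<Longrightarrow> u @\<^sub>v v \<in> W \<longleftrightarrow> v = S u"
      using invariant_subspace_is_graph[OF W] by metis
    have Scl: "S v \<in> Cn" if "v \<in> Cn" for v
      using S that unfolding rep_iso_def linear_map_iff by auto
    have "\<exists>c. \<forall>v\<in>Cn. T *\<^sub>v S v = c \<cdot>\<^sub>v v"
    proof (rule Schur_scalar[OF irr])
      have "linear_map class_ring Vn Vn (\<lambda>v. mat_op n T (S v))"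
        using S T unfolding rep_iso_def matrix_rep_iso_def by (blast intro: linear_map_compose)
      then show "linear_map class_ring Vn Vn (\<lambda>v. T *\<^sub>v S v)"
        using Scl TD(2) unfolding linear_map_iff by auto
      fix h and v :: "complex vec" assume "h \<in> carrier H" "v \<in> Cn"
      moreover from this have "S (\<rho> h *\<^sub>v v) = crho h *\<^sub>v S v"
        using S Scl unfolding rep_iso_def by auto
      ultimately show "T *\<^sub>v S (\<rho> h *\<^sub>v v) = \<rho> h *\<^sub>v (T *\<^sub>v S v)" using TD(3) Scl by simp
    qed
    then obtain c where c: "\<And>v. v \<in> Cn \<Longrightarrow> T *\<^sub>v S v = c \<cdot>\<^sub>v v" by blast
    define v where "v = (unit_vec n 0 :: complex vec)"
    have v: "v \<in> Cn" "v $ 0 = 1" "0 < n"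
      using irreducible_matrix_repD(1)[OF irr] by (auto simp: v_def)
    define w where "w = T *\<^sub>v conjugate v"
    have w: "w \<in> Cn" unfolding w_def using v TD(2) by simp
    let ?x = "\<rho> (a \<otimes> a) *\<^sub>v conjugate (S v)"
    have x: "?x \<in> Cn" using Scl v by simp
    have "v @\<^sub>v S v \<in> W" using WS v Scl by blast
    then have "?x @\<^sub>v conjugate v \<in> W"
      using W v Scl block_a[of v "S v"] unfolding block_subrepresentation_iff by metis
    then have "conjugate v = S ?x" using WS x v by simp
    then have 1: "w = c \<cdot>\<^sub>v ?x" unfolding w_def using c[OF x] by simp
    have "- ?x = T *\<^sub>v conjugate (T *\<^sub>v S v)"
      using square_eq[OF TD(1) sq, of "conjugate (S v)"] Scl[OF v(1)] rho(1)[of "a \<otimes> a"]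
      by (simp add: uminus_mult_mat_vec)
    also have "\<dots> = cnj c \<cdot>\<^sub>v w"
      using c[OF v(1)] v by (simp add: conjugate_smult_vec Tsm w_def)
    finally have 2: "- ?x = cnj c \<cdot>\<^sub>v w" .
    have "w $ i = 0" if "i < n" for i
    proof -
      have "w $ i = c * ?x $ i" using 1 x that by (metis carrier_vecD index_smult_vec(1))
      moreover have "- (?x $ i) = cnj c * w $ i"
        using 2 x w that by (metis carrier_vecD index_smult_vec(1) index_uminus_vec(1))
      ultimately have "(1 + c * cnj c) * w $ i = 0"
        by (simp add: algebra_simps) (metis add.commute add_eq_0_iff mult.assoc mult.commute mult_minus_right)
      moreover have "1 + c * cnj c \<noteq> 0"
      proof -
        have "Re (1 + c * cnj c) > 0" by (simp add: complex_mult_cnj add_pos_nonneg)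
        then show ?thesis by (metis less_irrefl zero_complex.simps(1))
      qed
      ultimately show ?thesis by simp
    qed
    then have "w = T *\<^sub>v 0\<^sub>v n" using w TD(1) by (intro eq_vecI) auto
    then have "conjugate v = 0\<^sub>v n"
      using TD(4) v unfolding w_def by (metis (no_types, lifting) bij_betw_imp_inj_on conjugate_carrier inj_onD zero_carrier_vec)
    then show False using v by (metis conjugate_zero_iff_vec index_zero_vec(1) zero_neq_one)
  qed
  then show ?thesis
    using block_representation block_nonzero unfolding irreducible_representation_def by auto
qed

text \<open>Irreducibility is inherited from the restriction to the kernel; the relation for \<open>T\<close> says that
  \<open>T \<circ> K\<close> squares to the action of \<open>a\<^sup>2\<close>.\<close>

lemma real_extension_irreducible:
  assumes T: "matrix_rep_iso H n crho \<rho> T" and sq: "T * cnj_mat T = \<rho> (a \<otimes> a)"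
  shows "irreducible_representation G \<phi> Vn
           (determined_action G \<phi> a Cn rho_op (conj_mat_op n T))"
    (is "irreducible_representation G \<phi> _ ?r")
proof -
  note TD = intertwinerD[OF T]
  have "representation H (\<lambda>_. 0) Vn rho_op"
    using matrix_representation irreducible_matrix_repD[OF irr] by blast
  then have "representation G \<phi> Vn
     (determined_action G \<phi> a (carrier Vn) rho_op (conj_mat_op n T))"
  proof (rule determined_action_representation[OF _ antilinear_map_conj_mat_op[OF TD(1)]])
    fix v assume "v \<in> carrier Vn"
    then have v: "v \<in> Cn" by simp
    show "conj_mat_op n T (conj_mat_op n T v) = mat_op n (\<rho> (a \<otimes> a)) v"
      using v TD(2) square_eq[OF TD(1) sq v] by simp
    fix h assume h: "h \<in> carrier H"
    have "T *\<^sub>v (crho h *\<^sub>v conjugate v) = \<rho> h *\<^sub>v (T *\<^sub>v conjugate v)" using TD(3) h v by simp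
    then show "mat_op n (\<rho> h) (conj_mat_op n T v) =
        conj_mat_op n T (mat_op n (\<rho> (inv a \<otimes> h \<otimes> a)) v)"
      using v h TD(2) by (simp add: crho_eq)
  qed
  then have rep: "representation G \<phi> Vn ?r" by simp
  have "W = {0\<^sub>v n} \<or> W = Cn" if "subrepresentation G Vn ?r W" for W
  proof -
    have "subrepresentation H Vn rho_op W"
      using that H_sub unfolding subrepresentation_def
      by (metis (no_types, lifting) determined_action_H)
    then show ?thesis by (rule irreducible_matrix_repD(4)[OF irr])
  qed
  moreover have "Cn \<noteq> {0\<^sub>v n :: complex vec}"
    using irr unfolding irreducible_matrix_rep_def irreducible_representation_def by auto
  ultimately show ?thesis using rep unfolding irreducible_representation_def by auto
qed

end

section \<open>Additive maps on the twisted group space\<close>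

abbreviation single where "single \<equiv> Poly_Mapping.single"
abbreviation lookup where "lookup \<equiv> Poly_Mapping.lookup"
abbreviation keys where "keys \<equiv> Poly_Mapping.keys"

lemma conj_pow_simps [simp]:
  "conj_pow e (x + y) = conj_pow e x + conj_pow e y"
  "conj_pow e (x * y) = conj_pow e x * conj_pow e y"
  "conj_pow e 0 = 0" "conj_pow e 1 = 1" "conj_pow 0 x = x" "conj_pow 1 x = cnj x"
  by (simp_all add: conj_pow_def)

lemma group_space_closed [simp]:
  "0 \<in> group_space G"
  "m \<in> group_space G \<Longrightarrow> m' \<in> group_space G \<Longrightarrow> m + m' \<in> group_space G"
  "g \<in> carrier G \<Longrightarrow> single g c \<in> group_space G"
  using keys_add[of m m'] by (auto simp: group_space_def)

lemma sum_singles: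
  "m = (\<Sum>k\<in>keys m. single k (lookup m k))"
  by (rule poly_mapping_eqI) (auto simp: lookup_sum lookup_single when_def in_keys_iff)

lemma group_space_induct [consumes 1, case_names zero single add]:
  assumes m: "m \<in> group_space G" and "P 0"
    and single: "\<And>g c. g \<in> carrier G \<Longrightarrow> P (single g c)"
    and add: "\<And>m m'. m \<in> group_space G \<Longrightarrow> m' \<in> group_space G \<Longrightarrow> P m \<Longrightarrow> P m' \<Longrightarrow> P (m + m')"
  shows "P m"
proof -
  let ?s = "\<lambda>k. single k (lookup m k)"
  have "sum ?s A \<in> group_space G \<and> P (sum ?s A)" if "finite A" "A \<subseteq> carrier G" for A
    using that by (induction A rule: finite_induct) (auto simp: assms(2) single add)
  moreover have "keys m \<subseteq> carrier G" using m by (simp add: group_space_def)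
  ultimately show ?thesis using sum_singles[of m] finite_keys by metis
qed

text \<open>The keys of a sum can be fewer than those of its summands; a common superset makes such sums
  comparable and hence additive.\<close>

lemma sum_keys_superset:
  assumes "finite S" "keys m \<subseteq> S" "\<And>k. f k 0 = 0"
  shows "(\<Sum>k\<in>keys m. f k (lookup m k)) =
         (\<Sum>k\<in>S. f k (lookup m k))"
  using assms by (intro sum.mono_neutral_left) (auto simp: in_keys_iff)

lemma sum_keys_add:
  assumes "\<And>k. f k 0 = 0" "\<And>k x y. f k (x + y) = f k x + f k y"
  shows "(\<Sum>k\<in>keys (m + m'). f k (lookup (m + m') k)) =
         (\<Sum>k\<in>keys m. f k (lookup m k)) +
         (\<Sum>k\<in>keys m'. f k (lookup m' k))"
proof -
  let ?S = "keys m \<union> keys m'"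
  have "finite ?S" "keys (m + m') \<subseteq> ?S" using keys_add[of m m'] by auto
  then have "(\<Sum>k\<in>keys (m + m'). f k (lookup (m + m') k)) =
      (\<Sum>k\<in>?S. f k (lookup (m + m') k))"
    by (rule sum_keys_superset) (rule assms(1))
  also have "\<dots> = (\<Sum>k\<in>?S. f k (lookup m k)) + (\<Sum>k\<in>?S. f k (lookup m' k))"
    by (simp only: lookup_add assms(2) sum.distrib)
  finally show ?thesis
    using sum_keys_superset[of ?S m f] sum_keys_superset[of ?S m' f] assms(1) by simp
qed

lemma sum_keys_single:
  assumes "\<And>k. f k 0 = 0"
  shows "(\<Sum>k\<in>keys (single g c).
            f k (lookup (single g c) k)) = f g c"
  using assms sum_keys_superset[of "{g}" "single g c" f] by simp

lemma left_translate_add: "left_translate G \<phi> g (m + m') = left_translate G \<phi> g m + left_translate G \<phi> g m'"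
  unfolding left_translate_def by (rule sum_keys_add) (simp_all add: single_add)

lemma left_translate_single:
  "left_translate G \<phi> g (single k c) = single (g \<otimes>\<^bsub>G\<^esub> k) (conj_pow (\<phi> g) c)"
  unfolding left_translate_def by (rule sum_keys_single) simp

lemma right_mult_add_left: "right_mult G \<phi> (m + m') x = right_mult G \<phi> m x + right_mult G \<phi> m' x"
  unfolding right_mult_def
  by (rule sum_keys_add) (simp_all add: single_add distrib_right sum.distrib)

lemma right_mult_add_right: "right_mult G \<phi> m (x + x') = right_mult G \<phi> m x + right_mult G \<phi> m x'"
  unfolding right_mult_def sum.distrib[symmetric]
  by (intro sum.cong refl sum_keys_add) (simp_all add: single_add distrib_left)

lemma right_mult_single:
  "right_mult G \<phi> (single g c) (single h d) =
     single (g \<otimes>\<^bsub>G\<^esub> h) (c * conj_pow (\<phi> g) d)"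
  unfolding right_mult_def
  by (subst sum_keys_single) (simp, subst sum_keys_single, simp_all)

lemma lookup_scale: "lookup (group_space_scale z m) k = z * lookup m k"
  by (simp add: group_space_scale_def Poly_Mapping.map.rep_eq when_def)

lemma scale_add: "group_space_scale z (m + m') = group_space_scale z m + group_space_scale z m'"
  by (rule poly_mapping_eqI) (simp add: lookup_scale lookup_add distrib_left)

lemma scale_single: "group_space_scale z (single k c) = single k (z * c)"
  by (rule poly_mapping_eqI) (simp add: lookup_scale lookup_single when_def)

lemma right_mult_zero [simp]: "right_mult G \<phi> 0 x = 0" "right_mult G \<phi> m 0 = 0"
  by (simp_all add: right_mult_def)

lemma scale_zero [simp]: "group_space_scale z 0 = 0"
  by (rule poly_mapping_eqI) (simp add: lookup_scale)

lemma left_translate_zero [simp]: "left_translate G \<phi> g 0 = 0"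
  by (simp add: left_translate_def)

context magnetic
begin

lemma conj_pow_mult:
  "g \<in> carrier G \<Longrightarrow> h \<in> carrier G \<Longrightarrow>
     conj_pow (\<phi> (g \<otimes> h)) z = conj_pow (\<phi> g) (conj_pow (\<phi> h) z)"
  using phi_range[of g] phi_range[of h] by (auto simp: phi_mult)

lemma left_translate_closed:
  assumes "g \<in> carrier G" "m \<in> group_space G" shows "left_translate G \<phi> g m \<in> group_space G"
  using assms(2) by (induction rule: group_space_induct)
    (auto simp: left_translate_add left_translate_single assms(1))

lemma scale_closed: "m \<in> group_space G \<Longrightarrow> group_space_scale z m \<in> group_space G"
  by (induction rule: group_space_induct) (auto simp: scale_add scale_single)

lemma right_mult_closed:
  assumes "m \<in> group_space G" "x \<in> group_space H" shows "right_mult G \<phi> m x \<in> group_space G"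
  using assms(1)
proof (induction rule: group_space_induct)
  case (single g c)
  show ?case
    using assms(2) by (induction rule: group_space_induct)
      (auto simp: right_mult_add_right right_mult_single single)
qed (auto simp: right_mult_add_left)

text \<open>The conclusion is the condition under which \<open>f\<close> descends to the tensor product. Both sides are
  additive in \<open>m\<close> and in \<open>x\<close>, so the case of single elements decides.\<close>

lemma equivariant_if_on_singles:
  assumes add: "\<And>m m'. f (m + m') = f m + f m'" and f0: "f 0 = 0"
    and single: "\<And>g h c d. g \<in> carrier G \<Longrightarrow> h \<in> carrier H \<Longrightarrow>
      f (right_mult G \<phi> (single g c) (single h d)) =
      right_mult G \<phi> (f (single g c)) (single h d)"
    and "m \<in> group_space G" "x \<in> group_space H"
  shows "f (right_mult G \<phi> m x) = right_mult G \<phi> (f m) x"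
  using assms(4)
proof (induction rule: group_space_induct)
  case (single g c)
  show ?case
    using assms(5) by (induction rule: group_space_induct)
      (auto simp: right_mult_add_right f0 add assms(3) single)
qed (auto simp: f0 add right_mult_add_left)

lemma left_translate_right_mult:
  assumes "g \<in> carrier G" "m \<in> group_space G" "x \<in> group_space H"
  shows "left_translate G \<phi> g (right_mult G \<phi> m x) = right_mult G \<phi> (left_translate G \<phi> g m) x"
proof (rule equivariant_if_on_singles[where f = "left_translate G \<phi> g", OF left_translate_add left_translate_zero _ assms(2,3)])
  fix g' h c d assume "g' \<in> carrier G" "h \<in> carrier H"
  then have "g \<otimes> (g' \<otimes> h) = g \<otimes> g' \<otimes> h"
    "conj_pow (\<phi> (g \<otimes> g')) d = conj_pow (\<phi> g) (conj_pow (\<phi> g') d)"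
    using assms(1) by (simp_all add: m_assoc conj_pow_mult)
  then show "left_translate G \<phi> g (right_mult G \<phi> (single g' c) (single h d)) =
      right_mult G \<phi> (left_translate G \<phi> g (single g' c)) (single h d)"
    by (simp only: right_mult_single left_translate_single conj_pow_simps)
qed

lemma scale_right_mult:
  assumes "m \<in> group_space G" "x \<in> group_space H"
  shows "group_space_scale z (right_mult G \<phi> m x) = right_mult G \<phi> (group_space_scale z m) x"
  by (rule equivariant_if_on_singles[where f = "group_space_scale z", OF scale_add scale_zero _ assms])
     (simp only: right_mult_single scale_single mult.assoc)

end

section \<open>The tensor product over the group algebra of the kernel\<close>

context magnetic_irrep
begin

abbreviation relators where "relators \<equiv> tensor_relators G \<phi> Vn rho_op"
abbreviation act where "act \<equiv> algebra_act Vn rho_op"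
abbreviation FG where "FG \<equiv> pair_group G Vn"
abbreviation TK where "TK \<equiv> tensor_kernel G \<phi> Vn rho_op"
abbreviation tcoset where "tcoset c \<equiv> TK #>\<^bsub>FG\<^esub> c"

lemma FG_simps [simp]:
  "c \<in> carrier FG \<longleftrightarrow> keys c \<subseteq> group_space G \<times> Cn"
  "c \<otimes>\<^bsub>FG\<^esub> d = c + d" "\<one>\<^bsub>FG\<^esub> = 0"
  by (simp_all add: pair_group_def)

lemma FG_comm_group: "comm_group FG"
  by (simp add: pair_group_def abelian_free_Abelian_group)

lemma FG_inv: "c \<in> carrier FG \<Longrightarrow> inv\<^bsub>FG\<^esub> c = - c"
  unfolding pair_group_def by (simp add: FG_simps(1)[unfolded pair_group_def])

lemma FG_group: "group FG"
  using FG_comm_group by (rule comm_group.axioms(2))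

lemma keys_diff_subset:
  "keys x \<subseteq> S \<Longrightarrow> keys y \<subseteq> S \<Longrightarrow> keys (x - y) \<subseteq> S"
  for x y :: "'z \<Rightarrow>\<^sub>0 int"
  using keys_diff[of x y] by blast

lemma algebra_act_index:
  assumes x: "x \<in> group_space H" and v: "v \<in> Cn"
  shows "act x v =
    vec n (\<lambda>i. \<Sum>h\<in>keys x. lookup x h * (\<rho> h *\<^sub>v v) $ i)"
proof -
  interpret vs: vec_space "TYPE(complex)" n .
  let ?t = "\<lambda>h. lookup x h \<cdot>\<^sub>v (\<rho> h *\<^sub>v v)"
  have xH: "keys x \<subseteq> carrier H" using x by (simp add: group_space_def)
  have t: "?t \<in> keys x \<rightarrow> Cn" using xH v by auto
  have "act x v = finsum Vn ?t (keys x)"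
    using v by (simp add: algebra_act_def)
  also have "\<dots> = finsum_vec TYPE(complex) n ?t (keys x)" by simp
  also have "\<dots> = vec n (\<lambda>i. \<Sum>h\<in>keys x. lookup x h * (\<rho> h *\<^sub>v v) $ i)"
  proof (rule eq_vecI)
    have "finsum_vec TYPE(complex) n ?t (keys x) \<in> Cn"
      using t by (intro finsum_vec_closed)
    then show "dim_vec (finsum_vec TYPE(complex) n ?t (keys x)) =
      dim_vec (vec n (\<lambda>i. \<Sum>h\<in>keys x. lookup x h * (\<rho> h *\<^sub>v v) $ i))"
      by simp
    fix i assume "i < dim_vec (vec n (\<lambda>i. \<Sum>h\<in>keys x. lookup x h * (\<rho> h *\<^sub>v v) $ i))"
    then have i: "i < n" by simp
    have "dim_vec (\<rho> h *\<^sub>v v) = n" if "h \<in> keys x" for h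
      using carrier_matD(1)[OF rho(1)[of h]] that xH by auto
    then have "(\<Sum>h\<in>keys x. ?t h $ i) =
        (\<Sum>h\<in>keys x. lookup x h * (\<rho> h *\<^sub>v v) $ i)"
      using i by (intro sum.cong refl) (simp only: index_smult_vec)
    moreover have "finsum_vec TYPE(complex) n ?t (keys x) $ i = (\<Sum>h\<in>keys x. ?t h $ i)"
      by (rule index_finsum_vec[OF finite_keys i t])
    ultimately show "finsum_vec TYPE(complex) n ?t (keys x) $ i =
        vec n (\<lambda>i. \<Sum>h\<in>keys x. lookup x h * (\<rho> h *\<^sub>v v) $ i) $ i"
      using i by (simp only: index_vec)
  qed
  finally show ?thesis .
qed

lemma algebra_act_closed:
  "x \<in> group_space H \<Longrightarrow> v \<in> Cn \<Longrightarrow> act x v \<in> Cn"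
  by (simp add: algebra_act_index)

lemma algebra_act_add:
  assumes "x \<in> group_space H" "y \<in> group_space H" "v \<in> Cn"
  shows "act (x + y) v = act x v + act y v"
  using assms
  by (intro eq_vecI)
     (auto simp: algebra_act_index sum_keys_add[of "\<lambda>h c. c * (\<rho> h *\<^sub>v v) $ i" for i] distrib_right)

lemma algebra_act_single:
  assumes "h \<in> carrier H" "v \<in> Cn"
  shows "act (single h d) v = d \<cdot>\<^sub>v (\<rho> h *\<^sub>v v)"
proof (rule eq_vecI)
  have d: "dim_vec (\<rho> h *\<^sub>v v) = n" using carrier_matD(1)[OF rho(1)[OF assms(1)]] by simp
  then show "dim_vec (act (single h d) v) = dim_vec (d \<cdot>\<^sub>v (\<rho> h *\<^sub>v v))"
    using assms by (simp add: algebra_act_index)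
  fix i assume "i < dim_vec (d \<cdot>\<^sub>v (\<rho> h *\<^sub>v v))"
  then show "act (single h d) v $ i = (d \<cdot>\<^sub>v (\<rho> h *\<^sub>v v)) $ i"
    using assms d sum_keys_single[of "\<lambda>h c. c * (\<rho> h *\<^sub>v v) $ i" h d]
    by (simp add: algebra_act_index)
qed

lemma relators_intros:
  "m \<in> group_space G \<Longrightarrow> m' \<in> group_space G \<Longrightarrow> v \<in> Cn \<Longrightarrow>
     frag_of (m + m', v) - frag_of (m, v) - frag_of (m', v) \<in> relators"
  "m \<in> group_space G \<Longrightarrow> v \<in> Cn \<Longrightarrow> v' \<in> Cn \<Longrightarrow>
     frag_of (m, v + v') - frag_of (m, v) - frag_of (m, v') \<in> relators"
  "m \<in> group_space G \<Longrightarrow> x \<in> group_space H \<Longrightarrow> v \<in> Cn \<Longrightarrow>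
     frag_of (right_mult G \<phi> m x, v) - frag_of (m, act x v) \<in> relators"
  unfolding tensor_relators_def cspace_simps by blast+

lemma relators_cases:
  assumes "r \<in> relators"
  obtains m m' v where "m \<in> group_space G" "m' \<in> group_space G" "v \<in> Cn"
      "r = frag_of (m + m', v) - frag_of (m, v) - frag_of (m', v)"
  | m v v' where "m \<in> group_space G" "v \<in> Cn" "v' \<in> Cn"
      "r = frag_of (m, v + v') - frag_of (m, v) - frag_of (m, v')"
  | m x v where "m \<in> group_space G" "x \<in> group_space H" "v \<in> Cn"
      "r = frag_of (right_mult G \<phi> m x, v) - frag_of (m, act x v)"
  using assms unfolding tensor_relators_def cspace_simps by blast

lemma relators_carrier: "relators \<subseteq> carrier FG"
proof
  fix r assume "r \<in> relators"
  then have "keys r \<subseteq> group_space G \<times> Cn"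
    by (cases rule: relators_cases)
       (simp_all add: keys_diff_subset right_mult_closed algebra_act_closed)
  then show "r \<in> carrier FG" by simp
qed

lemma TK_subgroup: "subgroup TK FG"
  unfolding tensor_kernel_def
  by (rule group.generate_is_subgroup[OF FG_group relators_carrier])

lemma TK_normal: "normal TK FG"
  using comm_group.subgroup_imp_normal[OF FG_comm_group TK_subgroup] .

lemma relator_TK: "r \<in> relators \<Longrightarrow> r \<in> TK"
  unfolding tensor_kernel_def by (rule generate.incl)

lemma tcoset_eqI:
  assumes "c - d \<in> TK" "c \<in> carrier FG" "d \<in> carrier FG" shows "tcoset c = tcoset d"
proof -
  have "c \<in> tcoset d" using assms(1) by (auto simp: r_coset_def intro!: bexI[of _ "c - d"])
  then show ?thesis
    using group.repr_independence[OF FG_group _ assms(3) TK_subgroup] by blast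
qed

lemma tcoset_eqD:
  assumes "tcoset c = tcoset d" "c \<in> carrier FG" "d \<in> carrier FG" shows "c - d \<in> TK"
proof -
  have "c \<in> tcoset c" using group.rcos_self[OF FG_group assms(2) TK_subgroup] .
  then have "c \<in> tcoset d" using assms(1) by (simp only:)
  then show ?thesis by (auto simp: r_coset_def)
qed

abbreviation IndV where "IndV \<equiv> Ind_mat G \<phi> n \<rho>"

lemma IndV_simps:
  "carrier IndV = tcoset ` carrier FG" "\<zero>\<^bsub>IndV\<^esub> = TK"
  "z \<odot>\<^bsub>IndV\<^esub> X = first_factor_map G \<phi> Vn rho_op (group_space_scale z) X"
  by (simp_all add: Ind_def carrier_FactGroup)

lemma IndV_add: "c \<in> carrier FG \<Longrightarrow> d \<in> carrier FG \<Longrightarrow> tcoset c \<oplus>\<^bsub>IndV\<^esub> tcoset d = tcoset (c + d)"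
  using normal.rcos_sum[OF TK_normal, of c d] by (simp add: Ind_def)

lemma tcoset_zero: "tcoset 0 = TK"
  using group.coset_join2[OF FG_group _ TK_subgroup, of 0] subgroup.one_closed[OF TK_subgroup] by simp

abbreviation tens where "tens \<equiv> tensor G \<phi> Vn rho_op"

lemma tens_tcoset: "tens m v = tcoset (frag_of (m, v))"
  by (simp add: tensor_def)

lemma frag_carrier: "m \<in> group_space G \<Longrightarrow> v \<in> Cn \<Longrightarrow> frag_of (m, v) \<in> carrier FG"
  by simp

lemma FG_add: "c \<in> carrier FG \<Longrightarrow> d \<in> carrier FG \<Longrightarrow> c + d \<in> carrier FG"
  using keys_add[of c d] by auto

lemma tens_add_left:
  assumes "m \<in> group_space G" "m' \<in> group_space G" "v \<in> Cn"
  shows "tens (m + m') v = tens m v \<oplus>\<^bsub>IndV\<^esub> tens m' v"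
proof -
  have "frag_of (m + m', v) - frag_of (m, v) - frag_of (m', v) \<in> TK"
    using assms by (intro relator_TK relators_intros)
  then have "tcoset (frag_of (m + m', v)) = tcoset (frag_of (m, v) + frag_of (m', v))"
    using assms by (intro tcoset_eqI FG_add frag_carrier) (simp_all only: diff_diff_eq group_space_closed)
  then show ?thesis using assms by (simp only: tens_tcoset IndV_add frag_carrier)
qed

lemma tens_add_right:
  assumes "m \<in> group_space G" "v \<in> Cn" "v' \<in> Cn"
  shows "tens m (v + v') = tens m v \<oplus>\<^bsub>IndV\<^esub> tens m v'"
proof -
  have "frag_of (m, v + v') - frag_of (m, v) - frag_of (m, v') \<in> TK"
    using assms by (intro relator_TK relators_intros)
  then have "tcoset (frag_of (m, v + v')) = tcoset (frag_of (m, v) + frag_of (m, v'))"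
    using assms by (intro tcoset_eqI FG_add frag_carrier) (simp_all add: diff_diff_eq)
  then show ?thesis using assms by (simp only: tens_tcoset IndV_add frag_carrier)
qed

lemma tens_balanced:
  assumes "m \<in> group_space G" "x \<in> group_space H" "v \<in> Cn"
  shows "tens (right_mult G \<phi> m x) v = tens m (act x v)"
proof -
  have "frag_of (right_mult G \<phi> m x, v) - frag_of (m, act x v) \<in> TK"
    using assms by (intro relator_TK relators_intros)
  then show ?thesis
    unfolding tens_tcoset using assms
    by (intro tcoset_eqI frag_carrier right_mult_closed algebra_act_closed)
qed

text \<open>The map on the free group sends relators to relators, hence the subgroup they generate into itself.
  So the cosets in the union that defines \<open>first_factor_map\<close> all coincide.\<close>

lemma first_factor_map_tcoset:
  assumes cl: "\<And>m. m \<in> group_space G \<Longrightarrow> f m \<in> group_space G"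
    and add: "\<And>m m'. f (m + m') = f m + f m'"
    and eqv: "\<And>m x. m \<in> group_space G \<Longrightarrow> x \<in> group_space H \<Longrightarrow>
                f (right_mult G \<phi> m x) = right_mult G \<phi> (f m) x"
    and c: "c \<in> carrier FG"
  shows "first_factor_map G \<phi> Vn rho_op f (tcoset c) = tcoset (frag_extend (\<lambda>(m, v). frag_of (f m, v)) c)"
proof -
  let ?e = "frag_extend (\<lambda>(m, v). frag_of (f m, v))"
  have ecl: "?e d \<in> carrier FG" if "d \<in> carrier FG" for d
    using that keys_frag_extend[of "\<lambda>(m, v). frag_of (f m, v)" d] cl by fastforce
  have rel: "?e r \<in> relators" if "r \<in> relators" for r
    using that
  proof (cases rule: relators_cases)
    case (1 m m' v)
    then show ?thesis using relators_intros(1)[of "f m" "f m'" v] cl by (simp add: frag_extend_diff add)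
  next
    case (2 m v v')
    then show ?thesis using relators_intros(2)[of "f m" v v'] cl by (simp add: frag_extend_diff)
  next
    case (3 m x v)
    then show ?thesis using relators_intros(3)[of "f m" x v] cl by (simp add: frag_extend_diff eqv)
  qed
  have eTK: "?e k \<in> TK" if "k \<in> TK" for k
    using that[unfolded tensor_kernel_def]
  proof (induction rule: generate.induct)
    case one
    show ?case using subgroup.one_closed[OF TK_subgroup] by simp
  next
    case (incl h)
    then show ?case using rel relator_TK by blast
  next
    case (inv h)
    have "h \<in> carrier FG" using inv relators_carrier by blast
    moreover have "inv\<^bsub>FG\<^esub> (?e h) \<in> TK"
      using inv rel relator_TK subgroup.m_inv_closed[OF TK_subgroup] by blast
    ultimately show ?case using ecl by (simp only: FG_inv frag_extend_minus)
  next
    case (eng h k)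
    then show ?case
      using subgroup.m_closed[OF TK_subgroup] by (simp add: frag_extend_add)
  qed
  have "tcoset (?e d) = tcoset (?e c)" if d: "d \<in> tcoset c" for d
  proof -
    obtain k where k: "k \<in> TK" "d = k + c" using d by (auto simp: r_coset_def)
    then have "?e d - ?e c \<in> TK" using eTK by (simp add: frag_extend_add)
    moreover have "k \<in> carrier FG" using k TK_subgroup by (meson subgroup.mem_carrier)
    then have "d \<in> carrier FG" using k c FG_add by blast
    ultimately show ?thesis using ecl c by (intro tcoset_eqI)
  qed
  moreover have "c \<in> tcoset c" using group.rcos_self[OF FG_group c TK_subgroup] .
  ultimately show ?thesis unfolding first_factor_map_def by blast
qed

end

section \<open>The identification with the block form\<close>

context magnetic_irrep
begin

text \<open>The balanced map \<open>m, v \<mapsto> m \<cdot> (v, 0)\<close> into the block form. By the universal property of the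
  tensor product it gives the inverse of the identification.\<close>

definition balanced :: "('g \<Rightarrow>\<^sub>0 complex) \<Rightarrow> complex vec \<Rightarrow> complex vec" where
  "balanced m v = vec (n + n) (\<lambda>i. \<Sum>k\<in>keys m.
                lookup m k * block k (v @\<^sub>v 0\<^sub>v n) $ i)"

lemma balanced_closed [simp]: "balanced m v \<in> Cnn" "dim_vec (balanced m v) = n + n"
  by (simp_all add: balanced_def)

lemmas block_group_action =
  block_representation[unfolded representation_def, THEN conjunct2, THEN conjunct2, THEN conjunct1, simplified]

lemma block_closed [simp]:
  "g \<in> carrier G \<Longrightarrow> x \<in> Cnn \<Longrightarrow> block g x \<in> Cnn"
  using group_actionD(3)[OF block_group_action] .

lemma block_dim: "g \<in> carrier G \<Longrightarrow> x \<in> Cnn \<Longrightarrow> dim_vec (block g x) = n + n"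
  using block_closed carrier_vecD by blast

lemma block_mult:
  "g \<in> carrier G \<Longrightarrow> h \<in> carrier G \<Longrightarrow> x \<in> Cnn \<Longrightarrow>
     block (g \<otimes> h) x = block g (block h x)"
  using group_actionD(4)[OF block_group_action] .

lemma block_semilinear:
  assumes g: "g \<in> carrier G" and x: "x \<in> Cnn" and y: "y \<in> Cnn"
  shows "block g (x + y) = block g x + block g y"
    and "block g (z \<cdot>\<^sub>v x) = conj_pow (\<phi> g) z \<cdot>\<^sub>v block g x"
proof -
  have "block g (x + y) = block g x + block g y \<and> block g (z \<cdot>\<^sub>v x) = conj_pow (\<phi> g) z \<cdot>\<^sub>v block g x"
    using phi_range[OF g]
  proof
    assume "\<phi> g = 0"
    then have "linear_map class_ring Vnn Vnn (block g)"
      using block_representation g unfolding representation_def by blast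
    then show ?thesis using x y \<open>\<phi> g = 0\<close> unfolding linear_map_iff by simp
  next
    assume "\<phi> g = 1"
    then have "antilinear_map Vnn Vnn (block g)"
      using block_representation g unfolding representation_def by blast
    then show ?thesis using x y \<open>\<phi> g = 1\<close> unfolding antilinear_map_def by simp
  qed
  then show "block g (x + y) = block g x + block g y"
    and "block g (z \<cdot>\<^sub>v x) = conj_pow (\<phi> g) z \<cdot>\<^sub>v block g x" by blast+
qed

lemma append_zero_closed [simp]: "v \<in> Cn \<Longrightarrow> v @\<^sub>v 0\<^sub>v n \<in> Cnn"
  by simp

lemma append_zero_add:
  "u \<in> Cn \<Longrightarrow> v \<in> Cn \<Longrightarrow>
    (u + v) @\<^sub>v 0\<^sub>v n = (u @\<^sub>v 0\<^sub>v n) + (v @\<^sub>v (0\<^sub>v n :: complex vec))"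
  by (subst append_vec_add[of _ n _ _ n]) simp_all

lemma append_zero_smult: "(z \<cdot>\<^sub>v v) @\<^sub>v 0\<^sub>v n = z \<cdot>\<^sub>v (v @\<^sub>v (0\<^sub>v n :: complex vec))"
  unfolding append_vec_smult by (rule arg_cong[of _ _ "append_vec _"]) (intro eq_vecI, auto)

lemma balanced_add_left: "balanced (m + m') v = balanced m v + balanced m' v"
proof (rule eq_vecI)
  fix i assume "i < dim_vec (balanced m v + balanced m' v)"
  then show "balanced (m + m') v $ i = (balanced m v + balanced m' v) $ i"
    using sum_keys_add[of "\<lambda>k c. c * block k (v @\<^sub>v 0\<^sub>v n) $ i" m m']
    by (simp add: balanced_def distrib_right)
qed simp

lemma balanced_add_right:
  assumes m: "m \<in> group_space G" and v: "v \<in> Cn" "v' \<in> Cn"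
  shows "balanced m (v + v') = balanced m v + balanced m v'"
proof (rule eq_vecI)
  fix i assume "i < dim_vec (balanced m v + balanced m v')"
  then have i: "i < n + n" by simp
  have eq: "block k ((v + v') @\<^sub>v 0\<^sub>v n) $ i = block k (v @\<^sub>v 0\<^sub>v n) $ i + block k (v' @\<^sub>v 0\<^sub>v n) $ i"
    if "k \<in> keys m" for k
  proof -
    have k: "k \<in> carrier G" using that m by (auto simp: group_space_def)
    have "block k ((v + v') @\<^sub>v 0\<^sub>v n) = block k (v @\<^sub>v 0\<^sub>v n) + block k (v' @\<^sub>v 0\<^sub>v n)"
      unfolding append_zero_add[OF v] using k v by (intro block_semilinear(1)) simp_all
    then show ?thesis using i block_dim[OF k, of "v' @\<^sub>v 0\<^sub>v n"] v by simp
  qed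
  have "(\<Sum>k\<in>keys m. lookup m k * block k ((v + v') @\<^sub>v 0\<^sub>v n) $ i) =
    (\<Sum>k\<in>keys m. lookup m k * block k (v @\<^sub>v 0\<^sub>v n) $ i +
      lookup m k * block k (v' @\<^sub>v 0\<^sub>v n) $ i)"
    by (intro sum.cong refl) (simp only: eq distrib_left)
  then show "balanced m (v + v') $ i = (balanced m v + balanced m v') $ i"
    using i by (simp add: balanced_def sum.distrib)
qed simp

lemma balanced_single:
  assumes "k \<in> carrier G" "v \<in> Cn"
  shows "balanced (single k c) v = c \<cdot>\<^sub>v block k (v @\<^sub>v 0\<^sub>v n)"
proof (rule eq_vecI)
  fix i assume "i < dim_vec (c \<cdot>\<^sub>v block k (v @\<^sub>v 0\<^sub>v n))"
  then show "balanced (single k c) v $ i = (c \<cdot>\<^sub>v block k (v @\<^sub>v 0\<^sub>v n)) $ i"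
    using sum_keys_single[of "\<lambda>k c. c * block k (v @\<^sub>v 0\<^sub>v n) $ i" k c] block_dim[OF assms(1)] assms(2)
    by (simp add: balanced_def)
qed (use block_dim[OF assms(1)] assms(2) in simp)

lemma vec_zero_cancel: "x = x + y \<Longrightarrow> x \<in> carrier_vec k \<Longrightarrow> y \<in> carrier_vec k \<Longrightarrow> y = 0\<^sub>v k"
  for x y :: "complex vec"
proof (rule eq_vecI)
  fix i assume xy: "x = x + y" "x \<in> carrier_vec k" "y \<in> carrier_vec k" and "i < dim_vec (0\<^sub>v k)"
  then have i: "i < k" by simp
  have "x $ i = (x + y) $ i" using xy(1) by (rule arg_cong)
  also have "\<dots> = x $ i + y $ i" using xy i by (intro index_add_vec) simp
  finally show "y $ i = 0\<^sub>v k $ i" using i by simp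
qed simp

lemma balanced_zero: "balanced 0 v = 0\<^sub>v (n + n)"
  by (rule eq_vecI) (simp_all add: balanced_def)

lemma balanced_zero_right:
  assumes "m \<in> group_space G" shows "balanced m (0\<^sub>v n) = 0\<^sub>v (n + n)"
  using balanced_add_right[OF assms, of "0\<^sub>v n" "0\<^sub>v n"] by (intro vec_zero_cancel[of "balanced m (0\<^sub>v n)"]) simp_all

lemma algebra_act_zero: "v \<in> Cn \<Longrightarrow> act 0 v = 0\<^sub>v n"
  by (rule eq_vecI) (simp_all add: algebra_act_index)

lemma balanced_right_mult:
  assumes m: "m \<in> group_space G" and x: "x \<in> group_space H" and v: "v \<in> Cn"
  shows "balanced (right_mult G \<phi> m x) v = balanced m (act x v)"
  using m
proof (induction rule: group_space_induct)
  case zero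
  then show ?case by (simp add: balanced_zero)
next
  case (add m m')
  then show ?case by (simp add: right_mult_add_left balanced_add_left)
next
  case (single g c)
  show ?case
    using x
  proof (induction rule: group_space_induct)
    case zero
    show ?case using single by (simp add: balanced_zero algebra_act_zero v balanced_zero_right)
  next
    case (add x x')
    then show ?case
      using single v
      by (simp add: right_mult_add_right balanced_add_left algebra_act_add balanced_add_right algebra_act_closed)
  next
    case (single h d)
    have g: "g \<in> carrier G" by fact
    have h: "h \<in> carrier H" "h \<in> carrier G" using single by simp_all
    have "balanced (single g c) (d \<cdot>\<^sub>v (\<rho> h *\<^sub>v v)) =
          c \<cdot>\<^sub>v block g (d \<cdot>\<^sub>v block h (v @\<^sub>v 0\<^sub>v n))"
      using g h v by (simp add: balanced_single append_zero_smult block_H)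
    also have "\<dots> = (c * conj_pow (\<phi> g) d) \<cdot>\<^sub>v block (g \<otimes> h) (v @\<^sub>v 0\<^sub>v n)"
      using g h v block_semilinear(2)[OF g block_closed[OF h(2)], of "v @\<^sub>v 0\<^sub>v n" "v @\<^sub>v 0\<^sub>v n" d]
      by (simp add: block_mult smult_smult_assoc)
    finally show ?case
      using g h v by (simp add: right_mult_single algebra_act_single balanced_single)
  qed
qed

text \<open>The universal property of the tensor product, applied to the balanced map and stated on
  representatives: the extension to the free group vanishes on the relators.\<close>

lemma balanced_extension:
  obtains \<Psi> where "\<Psi> \<in> hom FG (add_monoid Vnn)"
    "\<And>m v. m \<in> group_space G \<Longrightarrow> v \<in> Cn \<Longrightarrow> \<Psi> (frag_of (m, v)) = balanced m v"
    "\<And>k. k \<in> TK \<Longrightarrow> \<Psi> k = 0\<^sub>v (n + n)"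
proof -
  let ?A = "add_monoid Vnn"
  have "abelian_group Vnn"
    using vec_vs[of "n + n"] unfolding vectorspace_def Module.module_def by blast
  then have A: "comm_group ?A" by (rule abelian_group.a_comm_group)
  have "(\<lambda>(m, v). balanced m v) ` (group_space G \<times> Cn) \<subseteq> carrier ?A" by auto
  then obtain \<Psi> where hom: "\<Psi> \<in> hom (free_Abelian_group (group_space G \<times> Cn)) ?A"
    and \<Psi>: "\<And>x. x \<in> group_space G \<times> Cn \<Longrightarrow> \<Psi> (frag_of x) = (\<lambda>(m, v). balanced m v) x"
    using comm_group.free_Abelian_group_universal[OF A] by metis
  have hom: "\<Psi> \<in> hom FG ?A" using hom by (simp add: pair_group_def)
  interpret \<Psi>: group_hom FG ?A \<Psi>
    using hom FG_group comm_group.axioms(2)[OF A] by (simp add: group_hom_def group_hom_axioms_def)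
  have b: "\<Psi> (frag_of (m, v)) = balanced m v" if "m \<in> group_space G" "v \<in> Cn" for m v
    using \<Psi> that by simp
  have diff: "\<Psi> (c - d) + \<Psi> d = \<Psi> c" if "c \<in> carrier FG" "d \<in> carrier FG" for c d
  proof -
    have "c - d \<in> carrier FG" using that keys_diff_subset by simp
    from \<Psi>.hom_mult[OF this that(2)] show ?thesis by simp
  qed
  have cl: "\<Psi> c \<in> Cnn" if "c \<in> carrier FG" for c
    using \<Psi>.hom_closed[OF that] by simp
  have cancel: "\<Psi> (c - d) = 0\<^sub>v (n + n)" if "c \<in> carrier FG" "d \<in> carrier FG" "\<Psi> c = \<Psi> d" for c d
  proof -
    have cd: "c - d \<in> carrier FG" using that keys_diff_subset by simp
    have "\<Psi> d = \<Psi> d + \<Psi> (c - d)"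
      using diff[OF that(1,2)] that(3) comm_add_vec[OF cl[OF cd] cl[OF that(2)]] by simp
    then show ?thesis using cl cd that(2) by (intro vec_zero_cancel[of "\<Psi> d"])
  qed
  have rel: "\<Psi> r = 0\<^sub>v (n + n)" if "r \<in> relators" for r
    using that
  proof (cases rule: relators_cases)
    case (1 m m' v)
    have "\<Psi> (frag_of (m, v) + frag_of (m', v)) = \<Psi> (frag_of (m + m', v))"
      using 1 \<Psi>.hom_mult[of "frag_of (m, v)" "frag_of (m', v)"] by (simp add: b balanced_add_left)
    then show ?thesis
      using 1 cancel[of "frag_of (m + m', v)" "frag_of (m, v) + frag_of (m', v)"]
      by (simp only: diff_diff_eq FG_add frag_carrier group_space_closed)
  next
    case (2 m v v')
    have "\<Psi> (frag_of (m, v) + frag_of (m, v')) = \<Psi> (frag_of (m, v + v'))"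
      using 2 \<Psi>.hom_mult[of "frag_of (m, v)" "frag_of (m, v')"] by (simp add: b balanced_add_right)
    then show ?thesis
      using 2 cancel[of "frag_of (m, v + v')" "frag_of (m, v) + frag_of (m, v')"]
      by (simp only: diff_diff_eq FG_add frag_carrier add_carrier_vec)
  next
    case (3 m x v)
    then show ?thesis
      using cancel[of "frag_of (right_mult G \<phi> m x, v)" "frag_of (m, act x v)"]
      by (simp add: b balanced_right_mult right_mult_closed algebra_act_closed)
  qed
  have "TK \<subseteq> {k \<in> carrier FG. \<Psi> k = \<one>\<^bsub>?A\<^esub>}"
    unfolding tensor_kernel_def
  proof (rule group.generate_subgroup_incl[OF FG_group])
    show "relators \<subseteq> {k \<in> carrier FG. \<Psi> k = \<one>\<^bsub>?A\<^esub>}"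
      using relators_carrier rel by (auto simp del: FG_simps(1))
    show "subgroup {k \<in> carrier FG. \<Psi> k = \<one>\<^bsub>?A\<^esub>} FG"
      using \<Psi>.subgroup_kernel by (simp only: kernel_def)
  qed
  then show ?thesis using that[OF hom b] by auto
qed

abbreviation ident where "ident \<equiv> Ind_ident G \<phi> a n \<rho>"
abbreviation ident_frag where
  "ident_frag u v \<equiv> frag_of (single \<one> 1, u) + frag_of (single a 1, conjugate v)"

lemma first_last_append [simp]:
  "u \<in> Cn \<Longrightarrow> v \<in> Cn \<Longrightarrow> vec_first (u @\<^sub>v v) n = u"
  "u \<in> Cn \<Longrightarrow> v \<in> Cn \<Longrightarrow> vec_last (u @\<^sub>v v) n = (v :: complex vec)"
  by (auto simp: vec_first_def vec_last_def intro!: eq_vecI)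

lemma ident_append:
  assumes "u \<in> Cn" "v \<in> Cn"
  shows "ident (u @\<^sub>v v) = tens (single \<one> 1) u \<oplus>\<^bsub>IndV\<^esub> tens (single a 1) (conjugate v)"
    and "ident (u @\<^sub>v v) = tcoset (ident_frag u v)"
    and "ident_frag u v \<in> carrier FG"
proof -
  show 1: "ident (u @\<^sub>v v) = tens (single \<one> 1) u \<oplus>\<^bsub>IndV\<^esub> tens (single a 1) (conjugate v)"
    using assms by (simp add: Ind_ident_def)
  show "ident_frag u v \<in> carrier FG" using assms by (intro FG_add frag_carrier) simp_all
  show "ident (u @\<^sub>v v) = tcoset (ident_frag u v)"
    unfolding 1 tens_tcoset using assms by (intro IndV_add frag_carrier) simp_all
qed

lemma IndV_comm_monoid: "comm_monoid (add_monoid IndV)"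
proof -
  have "comm_group (FG Mod TK)"
    by (rule comm_group.abelian_FactGroup[OF FG_comm_group TK_subgroup])
  then have c: "comm_monoid (FG Mod TK)" by (rule comm_group.axioms(1))
  show ?thesis
    by (rule comm_monoidI)
       (use comm_monoid.axioms(1)[OF c] comm_monoid.m_comm[OF c] monoid.m_assoc[OF comm_monoid.axioms(1)[OF c]]
          monoid.m_closed[OF comm_monoid.axioms(1)[OF c]] monoid.one_closed[OF comm_monoid.axioms(1)[OF c]]
          monoid.l_one[OF comm_monoid.axioms(1)[OF c]]
        in \<open>simp_all add: Ind_def\<close>)
qed

lemma tens_closed: "m \<in> group_space G \<Longrightarrow> v \<in> Cn \<Longrightarrow> tens m v \<in> carrier IndV"
  unfolding tens_tcoset IndV_simps by (intro imageI frag_carrier)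

lemma IndV_medial:
  assumes "p \<in> carrier IndV" "q \<in> carrier IndV" "r \<in> carrier IndV" "s \<in> carrier IndV"
  shows "(p \<oplus>\<^bsub>IndV\<^esub> q) \<oplus>\<^bsub>IndV\<^esub> (r \<oplus>\<^bsub>IndV\<^esub> s) = (p \<oplus>\<^bsub>IndV\<^esub> r) \<oplus>\<^bsub>IndV\<^esub> (q \<oplus>\<^bsub>IndV\<^esub> s)"
proof -
  interpret A: comm_monoid "add_monoid IndV" by (rule IndV_comm_monoid)
  show ?thesis
    using A.m_assoc A.m_comm A.m_lcomm A.m_closed assms by simp
qed

lemma ident_add:
  assumes "x \<in> Cnn" "y \<in> Cnn"
  shows "ident (x + y) = ident x \<oplus>\<^bsub>IndV\<^esub> ident y"
proof -
  obtain u v where x: "u \<in> Cn" "v \<in> Cn" "x = u @\<^sub>v v"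
    using vec_split[OF assms(1)] .
  obtain u' v' where y: "u' \<in> Cn" "v' \<in> Cn" "y = u' @\<^sub>v v'"
    using vec_split[OF assms(2)] .
  have xy: "x + y = (u + u') @\<^sub>v (v + v')"
    using x y append_vec_add[of u n u' v n v'] by simp
  have "ident (x + y) = (tens (single \<one> 1) u \<oplus>\<^bsub>IndV\<^esub> tens (single \<one> 1) u') \<oplus>\<^bsub>IndV\<^esub>
      (tens (single a 1) (conjugate v) \<oplus>\<^bsub>IndV\<^esub> tens (single a 1) (conjugate v'))"
    unfolding xy using x(1,2) y(1,2)
    by (simp add: ident_append(1) tens_add_right conjugate_add_vec[of _ n])
  also have "\<dots> = ident x \<oplus>\<^bsub>IndV\<^esub> ident y"
    unfolding x(3) y(3) using x(1,2) y(1,2)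
    by (simp add: ident_append(1) IndV_medial tens_closed)
  finally show ?thesis .
qed

lemma IndV_zero: "p \<in> carrier IndV \<Longrightarrow> p \<oplus>\<^bsub>IndV\<^esub> \<zero>\<^bsub>IndV\<^esub> = p" "p \<in> carrier IndV \<Longrightarrow> \<zero>\<^bsub>IndV\<^esub> \<oplus>\<^bsub>IndV\<^esub> p = p"
  using monoid.r_one[OF comm_monoid.axioms(1)[OF IndV_comm_monoid], of p]
    monoid.l_one[OF comm_monoid.axioms(1)[OF IndV_comm_monoid], of p] by simp_all

lemma IndV_cancel:
  assumes "p \<in> carrier IndV" "q \<in> carrier IndV" "r \<in> carrier IndV" "p \<oplus>\<^bsub>IndV\<^esub> r = q \<oplus>\<^bsub>IndV\<^esub> r"
  shows "p = q"
proof -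
  have "group (FG Mod TK)" by (rule normal.factorgroup_is_group[OF TK_normal])
  then show ?thesis using group.right_cancel[of "FG Mod TK" r p q] assms by (simp add: Ind_def)
qed

lemma IndV_zero_tcoset: "\<zero>\<^bsub>IndV\<^esub> = tcoset 0"
  by (simp add: IndV_simps tcoset_zero)

lemma tens_zero_right:
  assumes "m \<in> group_space G" shows "tens m (0\<^sub>v n) = \<zero>\<^bsub>IndV\<^esub>"
proof (rule IndV_cancel[of _ _ "tens m (0\<^sub>v n)"])
  show "\<zero>\<^bsub>IndV\<^esub> \<in> carrier IndV" unfolding IndV_zero_tcoset IndV_simps(1) by (intro imageI) simp
  show "tens m (0\<^sub>v n) \<oplus>\<^bsub>IndV\<^esub> tens m (0\<^sub>v n) = \<zero>\<^bsub>IndV\<^esub> \<oplus>\<^bsub>IndV\<^esub> tens m (0\<^sub>v n)"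
    using tens_add_right[OF assms, of "0\<^sub>v n" "0\<^sub>v n"] IndV_zero(2)[OF tens_closed[OF assms, of "0\<^sub>v n"]] by simp
qed (use tens_closed[OF assms] in simp_all)

lemma ident_zero: "ident (0\<^sub>v (n + n)) = \<zero>\<^bsub>IndV\<^esub>"
proof -
  have "\<zero>\<^bsub>IndV\<^esub> \<in> carrier IndV" unfolding IndV_zero_tcoset IndV_simps(1) by (intro imageI) simp
  then show ?thesis
    unfolding append_vec_zero[symmetric] ident_append(1)[OF zero_carrier_vec zero_carrier_vec]
    by (simp add: tens_zero_right IndV_zero)
qed

text \<open>Coefficients and elements of the kernel can be moved across the tensor sign, so that only \<open>1\<close> or \<open>a\<close>
  remains on the left. A coefficient that passes \<open>a\<close> is conjugated; this is why the second coordinate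
  enters the identification through its conjugate.\<close>

lemma tens_single:
  assumes k: "k \<in> carrier G" and v: "v \<in> Cn"
  shows "tens (single k c) v = ident (c \<cdot>\<^sub>v block k (v @\<^sub>v 0\<^sub>v n))"
  using k
proof (cases rule: carrier_cases)
  case 1
  have "tens (right_mult G \<phi> (single \<one> 1) (single k c)) v =
      tens (single \<one> 1) (act (single k c) v)"
    using 1 v by (intro tens_balanced) simp_all
  then have "tens (single k c) v = tens (single \<one> 1) (c \<cdot>\<^sub>v (\<rho> k *\<^sub>v v))"
    using 1 k v by (simp add: right_mult_single algebra_act_single)
  also have "\<dots> = ident ((c \<cdot>\<^sub>v (\<rho> k *\<^sub>v v)) @\<^sub>v 0\<^sub>v n)"
    using 1 v by (simp add: ident_append(1) tens_zero_right IndV_zero tens_closed)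
  finally show ?thesis using 1 v by (simp add: append_zero_smult block_H)
next
  case (2 h)
  have "tens (right_mult G \<phi> (single a 1) (single h (cnj c))) v =
      tens (single a 1) (act (single h (cnj c)) v)"
    using 2 v by (intro tens_balanced) simp_all
  then have "tens (single k c) v = tens (single a 1) (cnj c \<cdot>\<^sub>v (\<rho> h *\<^sub>v v))"
    using 2 v by (simp add: right_mult_single algebra_act_single)
  also have "\<dots> = ident (0\<^sub>v n @\<^sub>v (c \<cdot>\<^sub>v conjugate (\<rho> h *\<^sub>v v)))"
    using 2 v by (simp add: ident_append(1) tens_zero_right IndV_zero tens_closed conjugate_smult_vec)
  also have "0\<^sub>v n @\<^sub>v (c \<cdot>\<^sub>v conjugate (\<rho> h *\<^sub>v v)) = c \<cdot>\<^sub>v (0\<^sub>v n @\<^sub>v conjugate (\<rho> h *\<^sub>v v))"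
    unfolding append_vec_smult by (rule arg_cong[of _ _ "\<lambda>x. x @\<^sub>v _"]) (intro eq_vecI, auto)
  finally show ?thesis using 2 v by (simp add: block_aH)
qed

lemma tens_zero_left:
  assumes "v \<in> Cn" shows "tens 0 v = \<zero>\<^bsub>IndV\<^esub>"
proof -
  have "tens (single \<one> 0) v = ident (0 \<cdot>\<^sub>v block \<one> (v @\<^sub>v 0\<^sub>v n))"
    by (rule tens_single[OF one_closed assms])
  moreover have "0 \<cdot>\<^sub>v block \<one> (v @\<^sub>v 0\<^sub>v n) = 0\<^sub>v (n + n)"
    using block_dim[OF one_closed append_zero_closed[OF assms]] by (intro eq_vecI) auto
  ultimately show ?thesis by (simp add: ident_zero)
qed

lemma tens_eq_balanced:
  assumes "m \<in> group_space G" and v: "v \<in> Cn"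
  shows "tens m v = ident (balanced m v)"
  using assms(1)
proof (induction rule: group_space_induct)
  case zero
  show ?case using v by (simp add: tens_zero_left balanced_zero ident_zero)
next
  case (single g c)
  then show ?case using v by (simp add: tens_single balanced_single)
next
  case (add m m')
  then show ?case using v by (simp add: tens_add_left balanced_add_left ident_add)
qed

lemma ident_closed: "x \<in> Cnn \<Longrightarrow> ident x \<in> carrier IndV"
  by (elim vec_split) (simp add: ident_append(2,3) IndV_simps del: FG_simps(1))

text \<open>The extension of the balanced map inverts the identification: on the representatives of the image
  it returns the coordinates, and conversely every coset is the image of its value, which is checked
  on generators.\<close>

lemma ident_bij: "bij_betw ident Cnn (carrier IndV)"
proof -
  obtain \<Psi> where \<Psi>: "\<Psi> \<in> hom FG (add_monoid Vnn)"
    "\<And>m v. m \<in> group_space G \<Longrightarrow> v \<in> Cn \<Longrightarrow> \<Psi> (frag_of (m, v)) = balanced m v"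
    "\<And>k. k \<in> TK \<Longrightarrow> \<Psi> k = 0\<^sub>v (n + n)"
    by (rule balanced_extension) (rule that)
  have \<Psi>add: "\<Psi> (c + d) = \<Psi> c + \<Psi> d" if "c \<in> carrier FG" "d \<in> carrier FG" for c d
    using hom_mult[OF \<Psi>(1) that] by simp
  have \<Psi>cl: "\<Psi> c \<in> Cnn" if "c \<in> carrier FG" for c
    using hom_in_carrier[OF \<Psi>(1) that] by simp
  have \<Psi>t: "\<Psi> (ident_frag u v) = u @\<^sub>v v" if uv: "u \<in> Cn" "v \<in> Cn" for u v
  proof -
    have "\<Psi> (ident_frag u v) = balanced (single \<one> 1) u + balanced (single a 1) (conjugate v)"
      using uv \<Psi>add[of "frag_of (single \<one> 1, u)" "frag_of (single a 1, conjugate v)"]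
      by (simp add: \<Psi>(2))
    also have "\<dots> = (u @\<^sub>v 0\<^sub>v n) + (0\<^sub>v n @\<^sub>v v)"
      using uv by (simp add: balanced_single block_H block_a)
    finally show ?thesis using uv by (simp add: append_vec_add[of _ n _ _ n])
  qed
  show ?thesis
  proof (rule bij_betw_imageI)
    show "inj_on ident Cnn"
    proof (rule inj_onI)
      fix x y assume xy: "x \<in> Cnn" "y \<in> Cnn" "ident x = ident y"
      obtain u v where x: "u \<in> Cn" "v \<in> Cn" "x = u @\<^sub>v v"
        using vec_split[OF xy(1)] .
      obtain u' v' where y: "u' \<in> Cn" "v' \<in> Cn" "y = u' @\<^sub>v v'"
        using vec_split[OF xy(2)] .
      have "tcoset (ident_frag u v) = tcoset (ident_frag u' v')" using xy(3) x y by (simp only: ident_append(2))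
      then have d: "ident_frag u v - ident_frag u' v' \<in> TK" using x y by (intro tcoset_eqD ident_append(3))
      then have "ident_frag u v - ident_frag u' v' \<in> carrier FG" using TK_subgroup by (meson subgroup.mem_carrier)
      then have "\<Psi> (ident_frag u v - ident_frag u' v' + ident_frag u' v') = \<Psi> (ident_frag u v - ident_frag u' v') + \<Psi> (ident_frag u' v')"
        using y by (intro \<Psi>add ident_append(3))
      then have "x = 0\<^sub>v (n + n) + y" using x y \<Psi>t \<Psi>(3)[OF d] by simp
      then show "x = y" using xy(2) by simp
    qed
    have c: "tcoset c = ident (\<Psi> c)" if "keys c \<subseteq> group_space G \<times> Cn" for c
    proof (rule free_Abelian_group_induct[OF that])
      show "tcoset 0 = ident (\<Psi> 0)"
        using \<Psi>(3)[OF subgroup.one_closed[OF TK_subgroup]] ident_zero by (simp add: IndV_zero_tcoset)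
    next
      fix c d assume "keys c \<subseteq> group_space G \<times> Cn"
        "keys d \<subseteq> group_space G \<times> Cn"
        and IH: "tcoset c = ident (\<Psi> c)" "tcoset d = ident (\<Psi> d)"
      then have cd: "c \<in> carrier FG" "d \<in> carrier FG" "c - d \<in> carrier FG"
        using keys_diff_subset by simp_all
      show "tcoset (c - d) = ident (\<Psi> (c - d))"
      proof (rule IndV_cancel)
        show "tcoset (c - d) \<in> carrier IndV" "tcoset d \<in> carrier IndV" "ident (\<Psi> (c - d)) \<in> carrier IndV"
          using cd \<Psi>cl ident_closed unfolding IndV_simps(1) by blast+
        have "tcoset (c - d) \<oplus>\<^bsub>IndV\<^esub> tcoset d = tcoset c" using IndV_add[OF cd(3,2)] by simp
        also have "\<dots> = ident (\<Psi> (c - d) + \<Psi> d)" using IH \<Psi>add[OF cd(3,2)] by simp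
        also have "\<dots> = ident (\<Psi> (c - d)) \<oplus>\<^bsub>IndV\<^esub> tcoset d"
          using IH cd \<Psi>cl by (simp only: ident_add)
        finally show "tcoset (c - d) \<oplus>\<^bsub>IndV\<^esub> tcoset d = ident (\<Psi> (c - d)) \<oplus>\<^bsub>IndV\<^esub> tcoset d" .
      qed
    next
      fix p :: "('g \<Rightarrow>\<^sub>0 complex) \<times> complex vec" assume "p \<in> group_space G \<times> Cn"
      then show "tcoset (frag_of p) = ident (\<Psi> (frag_of p))"
        using tens_eq_balanced \<Psi>(2) by (auto simp: tens_tcoset[symmetric])
    qed
    show "ident ` Cnn = carrier IndV"
    proof
      show "ident ` Cnn \<subseteq> carrier IndV" using ident_closed by blast
      show "carrier IndV \<subseteq> ident ` Cnn"
        unfolding IndV_simps(1) using c \<Psi>cl by force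
    qed
  qed
qed

lemma first_factor_map_ident_frag:
  assumes cl: "\<And>m. m \<in> group_space G \<Longrightarrow> f m \<in> group_space G"
    and add: "\<And>m m'. f (m + m') = f m + f m'"
    and eqv: "\<And>m x. m \<in> group_space G \<Longrightarrow> x \<in> group_space H \<Longrightarrow>
                f (right_mult G \<phi> m x) = right_mult G \<phi> (f m) x"
    and uv: "u \<in> Cn" "v \<in> Cn"
  shows "first_factor_map G \<phi> Vn rho_op f (ident (u @\<^sub>v v)) =
    ident (balanced (f (single \<one> 1)) u + balanced (f (single a 1)) (conjugate v))"
proof -
  have "first_factor_map G \<phi> Vn rho_op f (ident (u @\<^sub>v v)) =
      tcoset (frag_of (f (single \<one> 1), u) + frag_of (f (single a 1), conjugate v))"
    unfolding ident_append(2)[OF uv]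
    using first_factor_map_tcoset[OF cl add eqv ident_append(3)[OF uv]] by (simp add: frag_extend_add)
  also have "\<dots> = tens (f (single \<one> 1)) u \<oplus>\<^bsub>IndV\<^esub> tens (f (single a 1)) (conjugate v)"
    unfolding tens_tcoset using uv by (intro IndV_add[symmetric] frag_carrier cl) simp_all
  finally show ?thesis using uv by (simp add: tens_eq_balanced cl ident_add)
qed

lemma ident_smult:
  assumes "x \<in> Cnn" shows "ident (z \<cdot>\<^sub>v x) = z \<odot>\<^bsub>IndV\<^esub> ident x"
proof -
  obtain u v where x: "u \<in> Cn" "v \<in> Cn" "x = u @\<^sub>v v"
    using vec_split[OF assms] .
  have "z \<odot>\<^bsub>IndV\<^esub> ident x = ident (balanced (group_space_scale z (single \<one> 1)) u +
      balanced (group_space_scale z (single a 1)) (conjugate v))"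
    unfolding x(3) IndV_simps
    by (rule first_factor_map_ident_frag[OF scale_closed scale_add scale_right_mult x(1,2)])
  also have "balanced (group_space_scale z (single \<one> 1)) u +
      balanced (group_space_scale z (single a 1)) (conjugate v) =
      z \<cdot>\<^sub>v (u @\<^sub>v 0\<^sub>v n) + z \<cdot>\<^sub>v (0\<^sub>v n @\<^sub>v v)"
    using x by (simp add: scale_single balanced_single block_H block_a)
  also have "\<dots> = z \<cdot>\<^sub>v ((u @\<^sub>v 0\<^sub>v n) + (0\<^sub>v n @\<^sub>v v))"
    using x by (intro smult_add_distrib_vec[symmetric, of _ "n + n"]) simp_all
  also have "(u @\<^sub>v 0\<^sub>v n) + (0\<^sub>v n @\<^sub>v v) = x"
    using x by (simp add: append_vec_add[of _ n _ _ n])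
  finally show ?thesis by simp
qed

lemma ident_act:
  assumes g: "g \<in> carrier G" and x: "x \<in> Cnn"
  shows "ident (block g x) = Ind_mat_act G \<phi> n \<rho> g (ident x)"
proof -
  obtain u v where uv: "u \<in> Cn" "v \<in> Cn" "x = u @\<^sub>v v"
    using vec_split[OF x] .
  have "Ind_mat_act G \<phi> n \<rho> g (ident x) = ident (balanced (left_translate G \<phi> g (single \<one> 1)) u +
      balanced (left_translate G \<phi> g (single a 1)) (conjugate v))"
    using first_factor_map_ident_frag[OF left_translate_closed[OF g] left_translate_add
        left_translate_right_mult[OF g] uv(1,2)] ident_closed[OF x]
    by (simp add: Ind_act_def uv(3))
  also have "balanced (left_translate G \<phi> g (single \<one> 1)) u +
      balanced (left_translate G \<phi> g (single a 1)) (conjugate v) =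
      block g (u @\<^sub>v 0\<^sub>v n) + block (g \<otimes> a) (conjugate v @\<^sub>v 0\<^sub>v n)"
    using g uv by (simp add: left_translate_single balanced_single)
  also have "block (g \<otimes> a) (conjugate v @\<^sub>v 0\<^sub>v n) = block g (0\<^sub>v n @\<^sub>v v)"
    using g uv by (simp add: block_mult block_a)
  also have "block g (u @\<^sub>v 0\<^sub>v n) + block g (0\<^sub>v n @\<^sub>v v) = block g ((u @\<^sub>v 0\<^sub>v n) + (0\<^sub>v n @\<^sub>v v))"
    using g uv by (intro block_semilinear(1)[symmetric]) simp_all
  also have "(u @\<^sub>v 0\<^sub>v n) + (0\<^sub>v n @\<^sub>v v) = x"
    using uv by (simp add: append_vec_add[of _ n _ _ n])
  finally show ?thesis by simp
qed

lemma Ind_ident_iso: "rep_iso G Vnn block IndV (Ind_mat_act G \<phi> n \<rho>) ident"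
  unfolding rep_iso_def
  using vectorspace_transport(1)[of "Vnn" ident IndV, OF vec_vs cspace_fin_dim]
    ident_bij ident_add ident_zero ident_smult ident_act by simp

lemma Ind_irreducible_if_block:
  assumes "irreducible_representation G \<phi> Vnn block"
  shows "irreducible_representation G \<phi> IndV (Ind_mat_act G \<phi> n \<rho>)"
  by (rule irreducible_transport[OF assms Ind_ident_iso]) (simp add: Ind_act_def)

lemma Ind_coords_eq_block:
  assumes "g \<in> carrier G" shows "Ind_coords G \<phi> a n \<rho> g = block g"
proof (rule extensionalityI)
  show "Ind_coords G \<phi> a n \<rho> g \<in> extensional Cnn" by (simp add: Ind_coords_def)
  show "block g \<in> extensional Cnn"
    using group_actionD(2)[OF block_group_action assms] .
  fix x :: "complex vec" assume "x \<in> Cnn"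
  then show "Ind_coords G \<phi> a n \<rho> g x = block g x"
    using assms ident_bij by (simp add: Ind_coords_def ident_act[symmetric] bij_betw_def)
qed

end

section \<open>Change of basis in the quaternionic case\<close>

lemma uminus_mat_mult_vec:
  "A \<in> carrier_mat m n \<Longrightarrow> v \<in> carrier_vec n \<Longrightarrow> - A *\<^sub>v v = - (A *\<^sub>v (v :: complex vec))"
  by simp

lemma zero_smult_vec: "w \<in> carrier_vec n \<Longrightarrow> 0 \<cdot>\<^sub>v w = (0\<^sub>v n :: complex vec)"
  by (intro eq_vecI) auto

lemma bij_mat_inverse:
  assumes A: "A \<in> carrier_mat n n" and bij: "bij_betw (\<lambda>v. A *\<^sub>v v) (carrier_vec n) (carrier_vec n)"
  obtains B :: "complex mat" where "B \<in> carrier_mat n n" "A * B = 1\<^sub>m n" "B * A = 1\<^sub>m n"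
proof -
  have "linear_map class_ring (cspace n) (cspace n) (\<lambda>v. A *\<^sub>v v)"
    unfolding linear_map_iff using A by (auto simp: vec_vs mult_add_distrib_mat_vec mult_mat_vec)
  then have "linear_map class_ring (cspace n) (cspace n) (inv_into (carrier (cspace n)) (\<lambda>v. A *\<^sub>v v))"
    by (rule linear_map_inv_into) (use bij in simp)
  then obtain B where B: "B \<in> carrier_mat n n"
    "\<And>v. v \<in> carrier_vec n \<Longrightarrow> inv_into (carrier_vec n) (\<lambda>v. A *\<^sub>v v) v = B *\<^sub>v v"
    using linear_map_cspace_matrix by (metis cspace_simps(1))
  have "A *\<^sub>v (B *\<^sub>v v) = v" "B *\<^sub>v (A *\<^sub>v v) = v" if v: "v \<in> carrier_vec n" for v
  proof -
    show "A *\<^sub>v (B *\<^sub>v v) = v"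
      unfolding B(2)[OF v, symmetric] using bij_betw_inv_into_right[OF bij v] .
    have "A *\<^sub>v v \<in> carrier_vec n" using A v by simp
    then show "B *\<^sub>v (A *\<^sub>v v) = v"
      using bij_betw_inv_into_left[OF bij v] B(2) by simp
  qed
  then have "A * B = 1\<^sub>m n" "B * A = 1\<^sub>m n"
    using A B(1) by (auto intro!: mat_eqI_mult_vec[of _ n n] simp: assoc_mult_mat_vec[of _ n n _ n])
  then show ?thesis using that B(1) by blast
qed

context magnetic_irrep
begin

text \<open>On the kernel this is the intertwining property of \<open>T\<close>. For \<open>a\<close> the upper right entry becomes
  \<open>\<rho>(a\<^sup>2)\<close> times the inverse of the conjugate of \<open>T\<close>, and the quaternionic relation turns it into \<open>- T\<close>.\<close>

lemma quaternionic_change_basis: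
  assumes T: "matrix_rep_iso H n crho \<rho> T" and sq: "T * cnj_mat T = - \<rho> (a \<otimes> a)"
    and g: "g \<in> carrier G"
  shows "change_basis (n + n) (four_block_mat (1\<^sub>m n) (0\<^sub>m n n) (0\<^sub>m n n) T) (Ind_coords G \<phi> a n \<rho> g) =
         determined_action G \<phi> a Cnn
           (\<lambda>h. mat_op (n + n) (four_block_mat (\<rho> h) (0\<^sub>m n n) (0\<^sub>m n n) (\<rho> h)))
           (conj_mat_op (n + n) (four_block_mat (0\<^sub>m n n) (- T) T (0\<^sub>m n n))) g"
proof -
  note TD = intertwinerD[OF T]
  let ?P = "four_block_mat (1\<^sub>m n) (0\<^sub>m n n) (0\<^sub>m n n) T"
  obtain B where B: "B \<in> carrier_mat n n" "T * B = 1\<^sub>m n" "B * T = 1\<^sub>m n"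
    using bij_mat_inverse[OF TD(1,4)] .
  let ?Q = "four_block_mat (1\<^sub>m n) (0\<^sub>m n n) (0\<^sub>m n n) B"
  have Bv: "B *\<^sub>v v \<in> Cn" "T *\<^sub>v (B *\<^sub>v v) = v" "B *\<^sub>v (T *\<^sub>v v) = v"
    if "v \<in> Cn" for v
    using that B TD(1) by (simp_all flip: assoc_mult_mat_vec[of _ n n _ n])
  have P: "?P *\<^sub>v (u @\<^sub>v v) = u @\<^sub>v T *\<^sub>v v" if "u \<in> Cn" "v \<in> Cn" for u v
    using mult_mat_vec_split[OF one_carrier_mat TD(1) that] that by simp
  have Q: "?Q *\<^sub>v (u @\<^sub>v v) = u @\<^sub>v B *\<^sub>v v" if "u \<in> Cn" "v \<in> Cn" for u v
    using mult_mat_vec_split[OF one_carrier_mat B(1) that] that by simp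
  have PQ: "?P \<in> carrier_mat (n + n) (n + n)" "?Q \<in> carrier_mat (n + n) (n + n)"
    using TD(1) B(1) by (auto intro: four_block_carrier_mat)
  have "?P * ?Q = 1\<^sub>m (n + n)"
  proof (rule mat_eqI_mult_vec)
    fix x :: "complex vec" assume x: "x \<in> Cnn"
    obtain u v where uv: "u \<in> Cn" "v \<in> Cn" "x = u @\<^sub>v v" using vec_split[OF x] .
    show "?P * ?Q *\<^sub>v x = 1\<^sub>m (n + n) *\<^sub>v x"
      unfolding assoc_mult_mat_vec[OF PQ x] using uv x by (simp only: Q P Bv one_mult_mat_vec)
  qed (use PQ in auto)
  moreover have "?Q * ?P = 1\<^sub>m (n + n)"
  proof (rule mat_eqI_mult_vec)
    fix x :: "complex vec" assume x: "x \<in> Cnn"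
    obtain u v where uv: "u \<in> Cn" "v \<in> Cn" "x = u @\<^sub>v v" using vec_split[OF x] .
    show "?Q * ?P *\<^sub>v x = 1\<^sub>m (n + n) *\<^sub>v x"
      unfolding assoc_mult_mat_vec[OF PQ(2,1) x] using uv x TD(2) by (simp only: Q P Bv one_mult_mat_vec)
  qed (use PQ in auto)
  ultimately have inv: "inv\<^bsub>GL (n + n)\<^esub> ?P = ?Q"
    using PQ by (intro group.inv_equality[OF group_GL]) (auto simp: GL_carrier_iff)
  let ?s = "\<lambda>h. mat_op (n + n) (four_block_mat (\<rho> h) (0\<^sub>m n n) (0\<^sub>m n n) (\<rho> h))"
  let ?A = "conj_mat_op (n + n) (four_block_mat (0\<^sub>m n n) (- T) T (0\<^sub>m n n))"
  have s: "?s h (u @\<^sub>v v) = \<rho> h *\<^sub>v u @\<^sub>v \<rho> h *\<^sub>v v"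
    if "h \<in> carrier H" "u \<in> Cn" "v \<in> Cn" for h u v
    using that mult_mat_vec_split[OF rho(1) rho(1)] by simp
  have A: "?A (u @\<^sub>v v) = - (T *\<^sub>v conjugate v) @\<^sub>v T *\<^sub>v conjugate u"
    if "u \<in> Cn" "v \<in> Cn" for u v
    using that TD(1) four_block_mat_mult_vec[of "0\<^sub>m n n" n n "- T" n T n "0\<^sub>m n n" "conjugate u" "conjugate v"]
    by (simp add: append_vec_conjugate zero_mat_mult_vec uminus_mat_mult_vec)
  show ?thesis
    unfolding Ind_coords_eq_block[OF g]
  proof (rule extensionalityI)
    show "change_basis (n + n) ?P (block g) \<in> extensional Cnn"
      by (simp add: change_basis_def)
    show "determined_action G \<phi> a Cnn ?s ?A g \<in> extensional Cnn"
      by (simp add: determined_action_def)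
    fix x :: "complex vec" assume x: "x \<in> Cnn"
    obtain u v where uv: "u \<in> Cn" "v \<in> Cn" "x = u @\<^sub>v v" using vec_split[OF x] .
    have lhs: "change_basis (n + n) ?P (block g) x = ?P *\<^sub>v block g (u @\<^sub>v B *\<^sub>v v)"
      using x uv by (simp only: change_basis_def restrict_apply' inv Q)
    show "change_basis (n + n) ?P (block g) x = determined_action G \<phi> a Cnn ?s ?A g x"
      using g
    proof (cases rule: carrier_cases)
      case 1
      have "T *\<^sub>v (crho g *\<^sub>v (B *\<^sub>v v)) = \<rho> g *\<^sub>v v" using 1 uv TD(3) Bv by simp
      then show ?thesis
        unfolding lhs using 1 uv Bv(1)[of v]
        by (simp only: block_H P rho_cl crho_cl determined_action_H s)
    next
      case (2 h)
      let ?y = "crho h *\<^sub>v (B *\<^sub>v v)"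
      have y: "?y \<in> Cn" "T *\<^sub>v ?y = \<rho> h *\<^sub>v v"
        using 2 uv TD(3) Bv by simp_all
      have "- (T *\<^sub>v conjugate (\<rho> h *\<^sub>v v)) = \<rho> (a \<otimes> a) *\<^sub>v conjugate ?y"
        using square_eq[OF TD(1) sq, of "conjugate ?y"] y rho(1)[of "a \<otimes> a"]
        by (simp add: uminus_mat_mult_vec)
      then show ?thesis
        unfolding lhs unfolding 2(2) using 2(1) uv Bv(1)[of v] y(1)
        by (simp only: block_aH determined_action_coset append_carrier_vec s A rho_cl P conjugate_carrier
            H_mem)
    qed
  qed
qed

section \<open>Normalising an intertwiner\<close>

text \<open>Let \<open>T\<close> be any intertwiner, and write \<open>q\<close> for the square of \<open>T \<circ> K\<close>. Both \<open>q\<close> and \<open>\<rho>(a\<^sup>2)\<close> conjugate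
  \<open>\<rho>\<close> in the same way, so they differ by a scalar \<open>c\<close>. As \<open>q\<close> commutes with \<open>T \<circ> K\<close>, this scalar
  is real, and rescaling \<open>T\<close> changes it by a positive factor.\<close>

lemma normalised_intertwiner:
  assumes "\<not> complex_type G \<phi> a n \<rho>"
  obtains T where "matrix_rep_iso H n crho \<rho> T"
    "T * cnj_mat T = \<rho> (a \<otimes> a) \<or> T * cnj_mat T = - \<rho> (a \<otimes> a)"
proof -
  obtain S where S: "rep_iso H Vn rho_op Vn crho_op S"
    using assms unfolding complex_type_def rep_isomorphic_def by blast
  let ?S' = "inv_into Cn S"
  have S': "rep_iso H Vn crho_op Vn rho_op ?S'"
    using rep_iso_sym[OF S] by simp
  then obtain T where Tc: "T \<in> carrier_mat n n" and TS: "\<And>v. v \<in> Cn \<Longrightarrow> ?S' v = T *\<^sub>v v"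
    using linear_map_cspace_matrix unfolding rep_iso_def by blast
  have bij: "bij_betw (\<lambda>v. T *\<^sub>v v) Cn Cn"
    using S' TS unfolding rep_iso_def by (subst bij_betw_cong[of _ _ ?S']) simp_all
  have cl: "T *\<^sub>v v \<in> Cn" if "v \<in> Cn" for v using Tc that by simp
  have comm: "T *\<^sub>v (crho h *\<^sub>v v) = \<rho> h *\<^sub>v (T *\<^sub>v v)" if "h \<in> carrier H" "v \<in> Cn" for h v
  proof -
    have "?S' (mat_op n (crho h) v) = mat_op n (\<rho> h) (?S' v)"
      using S' that unfolding rep_iso_def by simp
    then show ?thesis using that by (simp add: TS cl)
  qed
  have Tlin: "T *\<^sub>v (u + v) = T *\<^sub>v u + T *\<^sub>v v" "T *\<^sub>v (z \<cdot>\<^sub>v v) = z \<cdot>\<^sub>v (T *\<^sub>v v)"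
    if "u \<in> Cn" "v \<in> Cn" for u v z
    using Tc that by (simp_all add: mult_add_distrib_mat_vec mult_mat_vec)
  have T0: "v = 0\<^sub>v n" if "T *\<^sub>v v = 0\<^sub>v n" "v \<in> Cn" for v
  proof -
    have "T *\<^sub>v 0\<^sub>v n = 0\<^sub>v n" using Tc by auto
    then show ?thesis using bij that by (metis (no_types, lifting) bij_betw_imp_inj_on inj_onD zero_carrier_vec)
  qed
  define q where "q w = T *\<^sub>v conjugate (T *\<^sub>v conjugate w)" for w
  have qcl: "q w \<in> Cn" if "w \<in> Cn" for w using that cl by (simp add: q_def)
  have qlin: "q (u + v) = q u + q v" "q (z \<cdot>\<^sub>v v) = z \<cdot>\<^sub>v q v"
    if "u \<in> Cn" "v \<in> Cn" for u v z
    using that cl by (simp_all add: q_def conjugate_add_vec[of _ n] conjugate_smult_vec Tlin[of "conjugate v"]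
        Tlin[of "conjugate u"] Tlin[of "conjugate (T *\<^sub>v conjugate u)"] Tlin[of "conjugate (T *\<^sub>v conjugate v)"])
  have crho_conj: "crho h *\<^sub>v conjugate w = conjugate (\<rho> (inv a \<otimes> h \<otimes> a) *\<^sub>v w)"
    if "h \<in> carrier H" "w \<in> Cn" for h w
    using that by (simp add: crho_eq)
  have qcomm: "\<rho> h *\<^sub>v q w = q (\<rho> (inv a \<otimes> (inv a \<otimes> h \<otimes> a) \<otimes> a) *\<^sub>v w)"
    if h: "h \<in> carrier H" and w: "w \<in> Cn" for h w
  proof -
    let ?h = "inv a \<otimes> h \<otimes> a"
    have h': "?h \<in> carrier H" using h by simp
    have "\<rho> h *\<^sub>v q w = T *\<^sub>v (crho h *\<^sub>v conjugate (T *\<^sub>v conjugate w))"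
      unfolding q_def using h w cl by (intro comm[symmetric]) simp_all
    also have "\<dots> = T *\<^sub>v conjugate (\<rho> ?h *\<^sub>v (T *\<^sub>v conjugate w))"
      using crho_conj[OF h] w cl by simp
    also have "\<dots> = T *\<^sub>v conjugate (T *\<^sub>v (crho ?h *\<^sub>v conjugate w))"
      using comm[OF h'] w by simp
    also have "\<dots> = q (\<rho> (inv a \<otimes> ?h \<otimes> a) *\<^sub>v w)"
      unfolding q_def using crho_conj[OF h' w] by simp
    finally show ?thesis .
  qed
  \<comment> \<open>\<open>?k\<close> is the inverse of \<open>a\<^sup>2\<close>; Schur's lemma is applied to \<open>q \<circ> \<rho>(a\<^sup>2)\<^sup>-\<^sup>1\<close>\<close>
  let ?k = "inv a \<otimes> inv a"
  have k: "?k \<in> carrier H" unfolding carrier_H by (simp add: phi_mult phi_inv)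
  have "\<exists>c. \<forall>v\<in>Cn. q (\<rho> ?k *\<^sub>v v) = c \<cdot>\<^sub>v v"
  proof (rule Schur_scalar[OF irr])
    show "linear_map class_ring Vn Vn (\<lambda>v. q (\<rho> ?k *\<^sub>v v))"
      unfolding linear_map_iff using k by (auto simp: vec_vs qcl rho_lin qlin)
    fix h and v :: "complex vec" assume h: "h \<in> carrier H" and v: "v \<in> Cn"
    have "inv a \<otimes> (inv a \<otimes> h \<otimes> a) \<otimes> a \<otimes> ?k = ?k \<otimes> h"
      using h by (simp add: m_assoc)
    then have "\<rho> (inv a \<otimes> (inv a \<otimes> h \<otimes> a) \<otimes> a) *\<^sub>v (\<rho> ?k *\<^sub>v v) = \<rho> ?k *\<^sub>v (\<rho> h *\<^sub>v v)"
      using h k v by (metis H_mem(3) rho_mult)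
    then show "q (\<rho> ?k *\<^sub>v (\<rho> h *\<^sub>v v)) = \<rho> h *\<^sub>v q (\<rho> ?k *\<^sub>v v)"
      using qcomm[OF h, of "\<rho> ?k *\<^sub>v v"] k v by simp
  qed
  then obtain c where c: "\<And>v. v \<in> Cn \<Longrightarrow> q (\<rho> ?k *\<^sub>v v) = c \<cdot>\<^sub>v v" by blast
  have q: "q w = c \<cdot>\<^sub>v (\<rho> (a \<otimes> a) *\<^sub>v w)" if w: "w \<in> Cn" for w
  proof -
    have "?k \<otimes> (a \<otimes> a) = \<one>" by (simp add: m_assoc)
    then have "\<rho> ?k *\<^sub>v (\<rho> (a \<otimes> a) *\<^sub>v w) = w" using rho_mult[OF k H_mem(2) w] w by simp
    then show ?thesis using c[of "\<rho> (a \<otimes> a) *\<^sub>v w"] w by simp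
  qed
  define e where "e = (unit_vec n 0 :: complex vec)"
  have e: "e \<in> Cn" "e \<noteq> 0\<^sub>v n"
    using irreducible_matrix_repD(1)[OF irr] by (auto simp: e_def)
  define y where "y = T *\<^sub>v conjugate e"
  have y: "y \<in> Cn" "y \<noteq> 0\<^sub>v n"
    using e cl T0[of "conjugate e"] by (auto simp: y_def)
  define z where "z = \<rho> (a \<otimes> a) *\<^sub>v y"
  have z: "z \<in> Cn" "z \<noteq> 0\<^sub>v n"
    using y rho_inj[of "a \<otimes> a" y] by (auto simp: z_def)
  obtain i where i: "i < n" "z $ i \<noteq> 0"
  proof -
    have "\<exists>i<n. z $ i \<noteq> 0"
    proof (rule ccontr)
      assume "\<not> (\<exists>i<n. z $ i \<noteq> 0)"
      then have "z = 0\<^sub>v n" using z(1) by (intro eq_vecI) auto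
      then show False using z by blast
    qed
    then show ?thesis using that by blast
  qed
  \<comment> \<open>both sides are \<open>T \<circ> K\<close> applied three times to \<open>e\<close>\<close>
  have "q y = T *\<^sub>v conjugate (q e)" by (simp add: q_def y_def)
  also have "q e = c \<cdot>\<^sub>v (\<rho> (a \<otimes> a) *\<^sub>v e)" using q e by simp
  also have "T *\<^sub>v conjugate (c \<cdot>\<^sub>v (\<rho> (a \<otimes> a) *\<^sub>v e)) = cnj c \<cdot>\<^sub>v (T *\<^sub>v conjugate (\<rho> (a \<otimes> a) *\<^sub>v e))"
    using e by (simp add: conjugate_smult_vec Tlin(2)[of "conjugate (\<rho> (a \<otimes> a) *\<^sub>v e)" "conjugate (\<rho> (a \<otimes> a) *\<^sub>v e)"])
  also have "conjugate (\<rho> (a \<otimes> a) *\<^sub>v e) = crho (a \<otimes> a) *\<^sub>v conjugate e"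
    using crho_conj[of "a \<otimes> a" e] e by (simp add: m_assoc)
  also have "T *\<^sub>v (crho (a \<otimes> a) *\<^sub>v conjugate e) = z"
    using comm[of "a \<otimes> a" "conjugate e"] e by (simp add: z_def y_def)
  finally have "c \<cdot>\<^sub>v z = cnj c \<cdot>\<^sub>v z" using q[OF y(1)] by (simp add: z_def)
  then have "c * z $ i = cnj c * z $ i" using i z(1) by (metis carrier_vecD index_smult_vec(1))
  then have "c = cnj c" using i by simp
  then obtain x where x: "c = complex_of_real x" by (metis complex_cnj_cancel_iff complex_cnj_complex_of_real Reals_cnj_iff Reals_cases)
  have "x \<noteq> 0"
  proof
    assume "x = 0"
    then have "q e = 0\<^sub>v n" using q[OF e(1)] x zero_smult_vec[OF rho_cl[OF H_mem(2) e(1)]] by simp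
    then have "conjugate (T *\<^sub>v conjugate e) = 0\<^sub>v n"
      unfolding q_def by (rule T0) (use e cl in simp)
    then show False using y by (simp add: y_def)
  qed
  \<comment> \<open>a real factor \<open>s\<close> on \<open>T\<close> multiplies \<open>q\<close> by \<open>s\<^sup>2\<close>\<close>
  define s where "s = complex_of_real (1 / sqrt \<bar>x\<bar>)"
  have s: "s \<noteq> 0" "cnj s = s" using \<open>x \<noteq> 0\<close> by (simp_all add: s_def)
  have ssc: "s * s * c = complex_of_real (sgn x)"
  proof -
    have "1 / sqrt \<bar>x\<bar> * (1 / sqrt \<bar>x\<bar>) * x = sgn x"
      using \<open>x \<noteq> 0\<close> by (simp add: sgn_real_def)
    moreover have "s * s * c = complex_of_real (1 / sqrt \<bar>x\<bar> * (1 / sqrt \<bar>x\<bar>) * x)"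
      unfolding s_def x by (simp only: of_real_mult)
    ultimately show ?thesis by simp
  qed
  let ?T = "s \<cdot>\<^sub>m T"
  have T': "?T \<in> carrier_mat n n" using Tc by simp
  have T'v: "?T *\<^sub>v v = s \<cdot>\<^sub>v (T *\<^sub>v v)" if "v \<in> Cn" for v
    using Tc that by (intro eq_vecI) auto
  have smul: "r \<cdot>\<^sub>v (t \<cdot>\<^sub>v v) = (r * t) \<cdot>\<^sub>v v" for r t :: complex and v by (simp add: smult_smult_assoc)
  have "matrix_rep_iso H n crho \<rho> ?T"
    unfolding matrix_rep_iso_def rep_iso_def
  proof (intro conjI ballI)
    show "?T \<in> carrier_mat n n" by (rule T')
    show "linear_map class_ring Vn Vn (mat_op n ?T)" by (rule linear_map_mat_op[OF T'])
    show "bij_betw (mat_op n ?T) (carrier Vn) (carrier Vn)"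
    proof -
      obtain B where B: "B \<in> carrier_mat n n" "T * B = 1\<^sub>m n" "B * T = 1\<^sub>m n"
        using bij_mat_inverse[OF Tc bij] .
      have Bv: "B *\<^sub>v v \<in> Cn" "T *\<^sub>v (B *\<^sub>v v) = v" "B *\<^sub>v (T *\<^sub>v v) = v"
        "B *\<^sub>v (t \<cdot>\<^sub>v v) = t \<cdot>\<^sub>v (B *\<^sub>v v)"
        if "v \<in> Cn" for v t
        using that B Tc by (simp_all add: mult_mat_vec flip: assoc_mult_mat_vec[of _ n n _ n])
      show ?thesis
        by (rule bij_betwI[where g = "\<lambda>v. inverse s \<cdot>\<^sub>v (B *\<^sub>v v)"])
           (use s cl Bv Tlin(2) in \<open>auto simp: T'v smul\<close>)
    qed
    fix h v assume h: "h \<in> carrier H" and "v \<in> carrier Vn"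
    then have v: "v \<in> Cn" by simp
    have "s \<cdot>\<^sub>v (T *\<^sub>v (crho h *\<^sub>v v)) = \<rho> h *\<^sub>v (s \<cdot>\<^sub>v (T *\<^sub>v v))"
      using comm[OF h v] rho_lin(2)[OF h cl cl, of v v s] v by simp
    then show "mat_op n ?T (mat_op n (crho h) v) = mat_op n (\<rho> h) (mat_op n ?T v)"
      using h v cl by (simp add: T'v)
  qed
  moreover have TT: "(?T * cnj_mat ?T) *\<^sub>v v = complex_of_real (sgn x) \<cdot>\<^sub>v (\<rho> (a \<otimes> a) *\<^sub>v v)"
    if v: "v \<in> Cn" for v
  proof -
    have "(?T * cnj_mat ?T) *\<^sub>v v = ?T *\<^sub>v conjugate (?T *\<^sub>v conjugate v)"
      using square_eq[OF T' refl v] by simp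
    also have "\<dots> = s \<cdot>\<^sub>v (T *\<^sub>v (s \<cdot>\<^sub>v conjugate (T *\<^sub>v conjugate v)))"
      using v cl s by (simp add: T'v conjugate_smult_vec)
    also have "\<dots> = (s * s) \<cdot>\<^sub>v q v"
      using v cl Tlin(2)[of "conjugate (T *\<^sub>v conjugate v)" "conjugate (T *\<^sub>v conjugate v)" s]
      by (simp add: smul q_def)
    finally show ?thesis using q[OF v] ssc by (simp add: smul)
  qed
  then have "?T * cnj_mat ?T = \<rho> (a \<otimes> a) \<or> ?T * cnj_mat ?T = - \<rho> (a \<otimes> a)"
  proof (cases "x > 0")
    case True
    have "?T * cnj_mat ?T = \<rho> (a \<otimes> a)"
      by (rule mat_eqI_mult_vec[of _ n n]) (use T' rho(1)[of "a \<otimes> a"] TT True in auto)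
    then show ?thesis ..
  next
    case False
    then have sg: "complex_of_real (sgn x) = -1" using \<open>x \<noteq> 0\<close> by simp
    have "?T * cnj_mat ?T = - \<rho> (a \<otimes> a)"
    proof (rule mat_eqI_mult_vec[of _ n n])
      fix v :: "complex vec" assume v: "v \<in> Cn"
      have "- \<rho> (a \<otimes> a) *\<^sub>v v = - (\<rho> (a \<otimes> a) *\<^sub>v v)"
        using v rho(1)[of "a \<otimes> a"] by (simp add: uminus_mat_mult_vec)
      also have "\<dots> = (-1) \<cdot>\<^sub>v (\<rho> (a \<otimes> a) *\<^sub>v v)" by (intro eq_vecI) auto
      finally show "?T * cnj_mat ?T *\<^sub>v v = - \<rho> (a \<otimes> a) *\<^sub>v v" using TT[OF v] sg by simp
    qed (use T' rho(1)[of "a \<otimes> a"] in auto)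
    then show ?thesis ..
  qed
  ultimately show ?thesis by (rule that)
qed

text \<open>For \<open>T\<close> with \<open>T \<circ> K\<close> squaring to \<open>\<rho>(a\<^sup>2)\<close>, the graph \<open>{(T w, w)}\<close> is invariant.\<close>

lemma block_reducible_real:
  assumes T: "matrix_rep_iso H n crho \<rho> T" and sq: "T * cnj_mat T = \<rho> (a \<otimes> a)"
  shows "\<not> irreducible_representation G \<phi> Vnn block"
proof
  assume irrb: "irreducible_representation G \<phi> Vnn block"
  note TD = intertwinerD[OF T]
  let ?W = "{(T *\<^sub>v w) @\<^sub>v w | w. w \<in> Cn}"
  have T0: "T *\<^sub>v 0\<^sub>v n = 0\<^sub>v n" using TD(1) by auto
  have "subrepresentation G Vnn block ?W"
    unfolding block_subrepresentation_iff
  proof (intro conjI ballI allI)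
    show "?W \<subseteq> Cnn" using TD(2) by auto
    show "0\<^sub>v (n + n) \<in> ?W" using T0 by (auto simp: append_vec_zero intro!: exI[of _ "0\<^sub>v n"])
    fix x y z h assume "x \<in> ?W"
    then obtain w where w: "w \<in> Cn" "x = (T *\<^sub>v w) @\<^sub>v w" by blast
    { assume "y \<in> ?W"
      then obtain w' where w': "w' \<in> Cn" "y = (T *\<^sub>v w') @\<^sub>v w'" by blast
      have "x + y = (T *\<^sub>v (w + w')) @\<^sub>v (w + w')"
        using w w' TD(1,2) by (simp add: append_vec_add[of _ n _ _ n] mult_add_distrib_mat_vec[of _ n n])
      then show "x + y \<in> ?W" using w w' by (metis (mono_tags, lifting) add_carrier_vec mem_Collect_eq) }
    have "z \<cdot>\<^sub>v x = (T *\<^sub>v (z \<cdot>\<^sub>v w)) @\<^sub>v (z \<cdot>\<^sub>v w)"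
      using w TD(1) by (simp add: append_vec_smult mult_mat_vec)
    then show "z \<cdot>\<^sub>v x \<in> ?W" using w by (metis (mono_tags, lifting) smult_carrier_vec mem_Collect_eq)
    have "block a x = (T *\<^sub>v conjugate (T *\<^sub>v w)) @\<^sub>v conjugate (T *\<^sub>v w)"
      using w TD(2) square_eq[OF TD(1) sq, of "conjugate w"] by (simp add: block_a)
    then show "block a x \<in> ?W" using w TD(2) by (metis (mono_tags, lifting) conjugate_carrier mem_Collect_eq)
    assume h: "h \<in> carrier H"
    have "block h x = (T *\<^sub>v (crho h *\<^sub>v w)) @\<^sub>v (crho h *\<^sub>v w)"
      using w TD(2,3) h by (simp add: block_H)
    then show "block h x \<in> ?W" using w h by (metis (mono_tags, lifting) crho_cl mem_Collect_eq)
  qed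
  then have "?W = {0\<^sub>v (n + n)} \<or> ?W = Cnn"
    using irrb unfolding irreducible_representation_def by auto
  moreover define e where "e = (unit_vec n 0 :: complex vec)"
  have e: "e \<in> Cn" "e \<noteq> 0\<^sub>v n"
    using irreducible_matrix_repD(1)[OF irr] by (auto simp: e_def)
  have "(T *\<^sub>v e) @\<^sub>v e \<in> ?W" using e by blast
  moreover have "(T *\<^sub>v e) @\<^sub>v e \<noteq> 0\<^sub>v (n + n)"
    unfolding append_vec_zero[symmetric] using append_vec_eq[OF TD(2)[OF e(1)] zero_carrier_vec] e by blast
  moreover have "e @\<^sub>v 0\<^sub>v n \<notin> ?W"
  proof
    assume "e @\<^sub>v 0\<^sub>v n \<in> ?W"
    then obtain w where w: "w \<in> Cn" "e @\<^sub>v 0\<^sub>v n = (T *\<^sub>v w) @\<^sub>v w" by blast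
    then have "e = T *\<^sub>v w" "w = 0\<^sub>v n" using append_vec_eq[OF e(1) TD(2)[OF w(1)]] by metis+
    then show False using T0 e by simp
  qed
  ultimately show False using e append_zero_closed by blast
qed

end

section \<open>Classification\<close>

text \<open>An invariant subspace of least dimension among the nonzero ones, written in coordinates.\<close>

lemma irreducible_constituent:
  assumes rep: "representation K (\<lambda>_. 0) V r" and ne: "carrier V \<noteq> {\<zero>\<^bsub>V\<^esub>}"
  obtains n \<rho> j where "irreducible_matrix_rep K n \<rho>"
    "linear_map class_ring (cspace n) V j" "inj_on j (carrier_vec n)"
    "\<And>h v. h \<in> carrier K \<Longrightarrow> v \<in> carrier_vec n \<Longrightarrow> j (\<rho> h *\<^sub>v v) = r h (j v)"
proof -
  have V: "vectorspace class_ring V" "vectorspace.fin_dim class_ring V"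
    and ga: "group_action K (carrier V) r"
    and lin: "\<And>h. h \<in> carrier K \<Longrightarrow> linear_map class_ring V V (r h)"
    using rep unfolding representation_def by auto
  interpret V: vectorspace class_ring V by (rule V(1))
  note gaD = group_actionD[OF ga]
  interpret K: group K by (rule gaD(1))
  define hinv where "hinv W \<longleftrightarrow> subrepresentation K V r W \<and> W \<noteq> {\<zero>\<^bsub>V\<^esub>}" for W
  let ?d = "\<lambda>W. vectorspace.dim class_ring (V\<lparr>carrier := W\<rparr>)"
  have "hinv (carrier V)"
    unfolding hinv_def subrepresentation_def subspace_iff
    using V ne gaD(3) V.smult_closed by auto
  then obtain W where W: "hinv W" and min: "\<And>W'. hinv W' \<Longrightarrow> ?d W \<le> ?d W'"
    using ex_has_least_nat[of hinv "carrier V" ?d] by blast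
  have subW: "VectorSpace.subspace class_ring W V" and invW: "\<And>h v. h \<in> carrier K \<Longrightarrow> v \<in> W \<Longrightarrow> r h v \<in> W"
    and neW: "W \<noteq> {\<zero>\<^bsub>V\<^esub>}"
    using W unfolding hinv_def subrepresentation_def by auto
  note sW = subW[unfolded subspace_iff]
  have WV: "w \<in> carrier V" if "w \<in> W" for w using sW that by blast
  let ?W = "V\<lparr>carrier := W\<rparr>"
  have vsW: "vectorspace class_ring ?W" by (rule V.subspace_is_vs[OF subW])
  have fdW: "vectorspace.fin_dim class_ring ?W" by (rule subspace_fin_dim(1)[OF V subW])
  have minW: "W' = W" if "hinv W'" "W' \<subseteq> W" for W'
  proof -
    have sub': "VectorSpace.subspace class_ring W' ?W"
      using that vsW unfolding hinv_def subrepresentation_def subspace_iff by auto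
    have "?d W' \<le> ?d W" using subspace_fin_dim(2)[OF vsW fdW sub'] by simp
    then have "?d W' = ?d W" using min[OF that(1)] by simp
    then show ?thesis using subspace_fin_dim(3)[OF vsW fdW sub'] by simp
  qed
  obtain n j where j: "linear_map class_ring (cspace n) ?W j" and bij: "bij_betw j (carrier_vec n) W"
    using coordinates_exist[OF vsW fdW] by auto
  have jW: "j v \<in> W" if "v \<in> carrier_vec n" for v using bij that by (rule bij_betw_apply)
  have jV: "linear_map class_ring (cspace n) V j"
    using j sW unfolding linear_map_iff by auto
  have inj: "inj_on j (carrier_vec n)" using bij by (rule bij_betw_imp_inj_on)
  have jlin: "j (u + v) = j u \<oplus>\<^bsub>V\<^esub> j v" "j (z \<cdot>\<^sub>v v) = z \<odot>\<^bsub>V\<^esub> j v" "j (0\<^sub>v n) = \<zero>\<^bsub>V\<^esub>"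
    if "u \<in> carrier_vec n" "v \<in> carrier_vec n" for u v z
    using jV that linear_map.T0_is_0[OF jV] unfolding linear_map_iff by auto
  have "\<exists>A\<in>carrier_mat n n. \<forall>v\<in>carrier_vec n. j (A *\<^sub>v v) = r h (j v)" if h: "h \<in> carrier K" for h
  proof -
    have "linear_map class_ring ?W ?W (r h)"
      using lin[OF h] vsW invW[OF h] unfolding linear_map_iff by (auto simp: WV)
    then have "linear_map class_ring (cspace n) (cspace n)
        (\<lambda>v. inv_into (carrier (cspace n)) j (r h (j v)))"
      using linear_map_compose[OF linear_map_compose[OF j] linear_map_inv_into[OF j]] bij by simp
    then obtain A where A: "A \<in> carrier_mat n n"
      "\<And>v. v \<in> carrier_vec n \<Longrightarrow> inv_into (carrier_vec n) j (r h (j v)) = A *\<^sub>v v"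
      using linear_map_cspace_matrix by (metis cspace_simps(1))
    have "j (A *\<^sub>v v) = r h (j v)" if "v \<in> carrier_vec n" for v
      using A(2)[OF that, symmetric] bij_betw_inv_into_right[OF bij invW[OF h jW[OF that]]] by simp
    then show ?thesis using A(1) by blast
  qed
  then obtain \<rho> where \<rho>: "\<And>h. h \<in> carrier K \<Longrightarrow> \<rho> h \<in> carrier_mat n n"
    and eq: "\<And>h v. h \<in> carrier K \<Longrightarrow> v \<in> carrier_vec n \<Longrightarrow> j (\<rho> h *\<^sub>v v) = r h (j v)"
    by metis
  have cl: "\<rho> h *\<^sub>v v \<in> carrier_vec n" if "h \<in> carrier K" "v \<in> carrier_vec n" for h v
    using \<rho>[OF that(1)] that(2) by simp
  have jVc: "j v \<in> carrier V" if "v \<in> carrier_vec n" for v using jW[OF that] sW by blast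
  have mult: "\<rho> (g \<otimes>\<^bsub>K\<^esub> h) = \<rho> g * \<rho> h" if g: "g \<in> carrier K" and h: "h \<in> carrier K" for g h
  proof (rule mat_eqI_mult_vec[of _ n n])
    fix v :: "complex vec" assume v: "v \<in> carrier_vec n"
    have "j (\<rho> (g \<otimes>\<^bsub>K\<^esub> h) *\<^sub>v v) = j (\<rho> g *\<^sub>v (\<rho> h *\<^sub>v v))"
      using g h v by (simp add: eq cl gaD(4) jVc)
    then have "\<rho> (g \<otimes>\<^bsub>K\<^esub> h) *\<^sub>v v = \<rho> g *\<^sub>v (\<rho> h *\<^sub>v v)"
      using inj g h v cl by (auto dest: inj_onD)
    then show "\<rho> (g \<otimes>\<^bsub>K\<^esub> h) *\<^sub>v v = \<rho> g * \<rho> h *\<^sub>v v"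
      using assoc_mult_mat_vec[OF \<rho>[OF g] \<rho>[OF h] v] by simp
  qed (use mult_carrier_mat[OF \<rho>[OF g] \<rho>[OF h]] \<rho>[OF K.m_closed[OF g h]] in auto)
  have one: "\<rho> \<one>\<^bsub>K\<^esub> = 1\<^sub>m n"
  proof (rule mat_eqI_mult_vec[of _ n n])
    fix v :: "complex vec" assume v: "v \<in> carrier_vec n"
    have "j (\<rho> \<one>\<^bsub>K\<^esub> *\<^sub>v v) = j v" using v by (simp add: eq gaD(5) jVc)
    then have "\<rho> \<one>\<^bsub>K\<^esub> *\<^sub>v v = v" using inj v cl by (auto dest: inj_onD)
    then show "\<rho> \<one>\<^bsub>K\<^esub> *\<^sub>v v = 1\<^sub>m n *\<^sub>v v" using v by simp
  qed (use \<rho> in auto)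
  have "\<rho> h \<in> carrier (GL n)" if h: "h \<in> carrier K" for h
    unfolding GL_carrier_iff
    using \<rho> h mult[of "inv\<^bsub>K\<^esub> h" h] mult[of h "inv\<^bsub>K\<^esub> h"] one
    by (auto intro!: bexI[of _ "\<rho> (inv\<^bsub>K\<^esub> h)"])
  then have hom: "\<rho> \<in> hom K (GL n)" using mult by (auto intro!: homI)
  have "U = {0\<^sub>v n} \<or> U = carrier_vec n"
    if U: "subrepresentation K (cspace n) (\<lambda>g. mat_op n (\<rho> g)) U" for U
  proof (cases "j ` U = {\<zero>\<^bsub>V\<^esub>}")
    case True
    have Us: "U \<subseteq> carrier_vec n" "0\<^sub>v n \<in> U" using U unfolding matrix_subrepresentation_iff by auto
    have "u = 0\<^sub>v n" if "u \<in> U" for u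
    proof -
      have "j u \<in> {\<zero>\<^bsub>V\<^esub>}" using True that by blast
      then have "j u = j (0\<^sub>v n)" using jlin(3)[OF zero_carrier_vec zero_carrier_vec] by simp
      then show ?thesis using inj that Us by (meson inj_onD subsetD zero_carrier_vec)
    qed
    then show ?thesis using Us by blast
  next
    case False
    have Us: "U \<subseteq> carrier_vec n" "0\<^sub>v n \<in> U" "\<And>u v. u \<in> U \<Longrightarrow> v \<in> U \<Longrightarrow> u + v \<in> U"
      "\<And>z v. v \<in> U \<Longrightarrow> z \<cdot>\<^sub>v v \<in> U" "\<And>h v. h \<in> carrier K \<Longrightarrow> v \<in> U \<Longrightarrow> \<rho> h *\<^sub>v v \<in> U"
      using U unfolding matrix_subrepresentation_iff by auto
    have Uc: "u \<in> carrier_vec n" if "u \<in> U" for u using Us that by blast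
    have "subrepresentation K V r (j ` U)"
      unfolding subrepresentation_def subspace_iff
    proof (intro conjI ballI allI subsetI)
      show "vectorspace class_ring V" by (rule V(1))
      show "x \<in> carrier V" if "x \<in> j ` U" for x using that Uc jVc by blast
      show "\<zero>\<^bsub>V\<^esub> \<in> j ` U" using Us(2) jlin(3)[OF zero_carrier_vec zero_carrier_vec] by force
      fix x z assume "x \<in> j ` U"
      then obtain u where u: "u \<in> U" "x = j u" by blast
      have "z \<odot>\<^bsub>V\<^esub> x = j (z \<cdot>\<^sub>v u)" using u Uc jlin(2)[of u u] by simp
      then show "z \<odot>\<^bsub>V\<^esub> x \<in> j ` U" using Us(4) u by blast
      fix y assume "y \<in> j ` U"
      then obtain v where v: "v \<in> U" "y = j v" by blast
      have "x \<oplus>\<^bsub>V\<^esub> y = j (u + v)" using u v Uc jlin(1) by simp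
      then show "x \<oplus>\<^bsub>V\<^esub> y \<in> j ` U" using Us(3) u v by blast
    next
      fix h x assume h: "h \<in> carrier K" and "x \<in> r h ` (j ` U)"
      then obtain u where u: "u \<in> U" "x = r h (j u)" by blast
      then have "x = j (\<rho> h *\<^sub>v u)" using eq[OF h] Uc by simp
      then show "x \<in> j ` U" using Us(5)[OF h] u by blast
    qed
    then have "j ` U = W" using False Us(1) jW by (intro minW) (auto simp: hinv_def)
    then have "j ` U = j ` carrier_vec n" using bij by (simp add: bij_betw_def)
    then have "U = carrier_vec n" using inj_on_image_eq_iff[OF inj Us(1) subset_refl] by simp
    then show ?thesis ..
  qed
  moreover have "carrier_vec n \<noteq> {0\<^sub>v n :: complex vec}"
  proof
    assume "carrier_vec n = {0\<^sub>v n :: complex vec}"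
    then have "W = {j (0\<^sub>v n)}" using bij by (metis bij_betw_imp_surj_on image_empty image_insert)
    then show False using neW jlin(3)[OF zero_carrier_vec zero_carrier_vec] by simp
  qed
  ultimately have "irreducible_matrix_rep K n \<rho>"
    unfolding irreducible_matrix_rep_def irreducible_representation_def
    using hom matrix_representation[OF gaD(1) hom] by auto
  then show ?thesis using that jV inj eq by blast
qed

lemma (in magnetic) restrict_to_kernel:
  assumes rep: "representation G \<phi> V r"
  shows "representation H (\<lambda>_. 0) V r"
proof -
  have ga: "group_action G (carrier V) r" using rep unfolding representation_def by blast
  have "group_action H (carrier V) r"
    by (rule group_actionI[OF group_H]) (simp_all add: group_actionD[OF ga])
  moreover have "linear_map class_ring V V (r h)" if "h \<in> carrier H" for h
    using rep that unfolding representation_def carrier_H by blast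
  ultimately show ?thesis using rep unfolding representation_def by auto
qed

context magnetic_irrep
begin

text \<open>The map \<open>f (u, v) = j u + a j (K v)\<close> from the block form to \<open>V\<close> is equivariant, and onto because \<open>V\<close> is
  irreducible. Its kernel is a proper invariant subspace. If it is zero, \<open>f\<close> is an isomorphism. If it
  is a graph, then the first summand already maps onto \<open>V\<close>, so that \<open>j\<close> is an isomorphism and \<open>T\<close> is
  read off from the action of \<open>a\<close>.\<close>

lemma constituent_dichotomy:
  assumes irrV: "irreducible_representation G \<phi> V r"
    and j: "linear_map class_ring Vn V j" and inj: "inj_on j Cn"
    and jeq: "\<And>h v. h \<in> carrier H \<Longrightarrow> v \<in> Cn \<Longrightarrow> j (\<rho> h *\<^sub>v v) = r h (j v)"
  shows "(\<exists>f. rep_iso G Vnn block V r f) \<or>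
    (\<exists>T. matrix_rep_iso H n crho \<rho> T \<and> T * cnj_mat T = \<rho> (a \<otimes> a) \<and>
       rep_isomorphic G V r Vn
         (determined_action G \<phi> a Cn rho_op (conj_mat_op n T)))"
proof -
  have rep: "representation G \<phi> V r" using irrV unfolding irreducible_representation_def by blast
  have V: "vectorspace class_ring V" and ga: "group_action G (carrier V) r"
    using rep unfolding representation_def by auto
  interpret V: vectorspace class_ring V by (rule V)
  note gaD = group_actionD[OF ga]
  have jcl: "j v \<in> carrier V" if "v \<in> Cn" for v
    using j that unfolding linear_map_iff by auto
  have jlin: "j (u + v) = j u \<oplus>\<^bsub>V\<^esub> j v" "j (z \<cdot>\<^sub>v v) = z \<odot>\<^bsub>V\<^esub> j v"
    if "u \<in> Cn" "v \<in> Cn" for u v z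
    using j that unfolding linear_map_iff by auto
  have j0: "j (0\<^sub>v n) = \<zero>\<^bsub>V\<^esub>" using linear_map.T0_is_0[OF j] by simp
  have smV: "z \<odot>\<^bsub>V\<^esub> v \<in> carrier V" if "v \<in> carrier V" for v z
    using that V.smult_closed[of z] by auto
  have ra: "antilinear_map V V (r a)" using rep unfolding representation_def by auto
  have racl: "r a v \<in> carrier V" if "v \<in> carrier V" for v using gaD(3) that by simp
  have ralin: "r a (u \<oplus>\<^bsub>V\<^esub> v) = r a u \<oplus>\<^bsub>V\<^esub> r a v" "r a (z \<odot>\<^bsub>V\<^esub> v) = cnj z \<odot>\<^bsub>V\<^esub> r a v"
    if "u \<in> carrier V" "v \<in> carrier V" for u v z
    using ra that unfolding antilinear_map_def by auto
  have rhlin: "r h (u \<oplus>\<^bsub>V\<^esub> v) = r h u \<oplus>\<^bsub>V\<^esub> r h v"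
    if "h \<in> carrier H" "u \<in> carrier V" "v \<in> carrier V" for h u v
    using rep that unfolding representation_def linear_map_iff carrier_H by auto
  have ra_a: "r a (r a v) = r (a \<otimes> a) v" if "v \<in> carrier V" for v
    using gaD(4)[of a a v] that by simp
  have rh_a: "r h (r a v) = r a (r (inv a \<otimes> h \<otimes> a) v)" if h: "h \<in> carrier H" and v: "v \<in> carrier V" for h v
  proof -
    have "h \<otimes> a = a \<otimes> (inv a \<otimes> h \<otimes> a)" using h by (simp add: m_assoc)
    then show ?thesis using gaD(4)[of h a v] gaD(4)[of a "inv a \<otimes> h \<otimes> a" v] h v by simp
  qed
  define p where "p v = r a (j (conjugate v))" for v
  have pcl: "p v \<in> carrier V" if "v \<in> Cn" for v using that by (simp add: p_def racl jcl)
  have plin: "p (u + v) = p u \<oplus>\<^bsub>V\<^esub> p v" "p (z \<cdot>\<^sub>v v) = z \<odot>\<^bsub>V\<^esub> p v"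
    if "u \<in> Cn" "v \<in> Cn" for u v z
    using that jcl
    by (simp_all add: p_def conjugate_add_vec[of _ n] conjugate_smult_vec jlin[of "conjugate v"]
        jlin[of "conjugate u"] ralin[of "j (conjugate v)"] ralin[of "j (conjugate u)"])
  have p_rho: "p (crho h *\<^sub>v v) = r h (p v)" if "h \<in> carrier H" "v \<in> Cn" for h v
    using that by (simp add: p_def crho_eq jeq rh_a jcl)
  define f where "f x = j (vec_first x n) \<oplus>\<^bsub>V\<^esub> p (vec_last x n)" for x
  have f: "f (u @\<^sub>v v) = j u \<oplus>\<^bsub>V\<^esub> p v" if "u \<in> Cn" "v \<in> Cn" for u v
    using that by (simp add: f_def)
  have fcl: "f x \<in> carrier V" if "x \<in> Cnn" for x
    using that by (simp add: f_def jcl pcl)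
  have flm: "linear_map class_ring Vnn V f"
    unfolding linear_map_iff
  proof (intro conjI ballI allI)
    show "vectorspace class_ring Vnn" by (rule vec_vs)
    show "vectorspace class_ring V" by (rule V)
    show "f \<in> carrier Vnn \<rightarrow> carrier V" using fcl by auto
    fix x y z assume "y \<in> carrier Vnn"
    then have y': "y \<in> Cnn" by simp
    obtain u' v' where y: "u' \<in> Cn" "v' \<in> Cn" "y = u' @\<^sub>v v'" using vec_split[OF y'] .
    show "f (z \<odot>\<^bsub>Vnn\<^esub> y) = z \<odot>\<^bsub>V\<^esub> f y"
      using y jcl pcl V.smult_r_distr[of z "j u'" "p v'"]
      by (simp add: append_vec_smult f jlin(2)[OF y(1) y(1)] plin(2)[OF y(2) y(2)])
    assume "x \<in> carrier Vnn"
    then have x': "x \<in> Cnn" by simp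
    obtain u v where x: "u \<in> Cn" "v \<in> Cn" "x = u @\<^sub>v v" using vec_split[OF x'] .
    have "f (x + y) = (j u \<oplus>\<^bsub>V\<^esub> j u') \<oplus>\<^bsub>V\<^esub> (p v \<oplus>\<^bsub>V\<^esub> p v')"
      using x y by (simp add: append_vec_add[of _ n _ _ n] f jlin plin)
    also have "\<dots> = (j u \<oplus>\<^bsub>V\<^esub> p v) \<oplus>\<^bsub>V\<^esub> (j u' \<oplus>\<^bsub>V\<^esub> p v')"
      using x y jcl pcl V.M.a_assoc V.M.a_comm V.M.a_lcomm by simp
    finally show "f (x \<oplus>\<^bsub>Vnn\<^esub> y) = f x \<oplus>\<^bsub>V\<^esub> f y" using x y by (simp add: f)
  qed
  have feqH: "f (block h x) = r h (f x)" if h: "h \<in> carrier H" and x: "x \<in> Cnn" for h x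
  proof -
    obtain u v where uv: "u \<in> Cn" "v \<in> Cn" "x = u @\<^sub>v v" using vec_split[OF x] .
    then show ?thesis using h by (simp add: block_H f jeq p_rho rhlin jcl pcl)
  qed
  have feqa: "f (block a x) = r a (f x)" if x: "x \<in> Cnn" for x
  proof -
    obtain u v where uv: "u \<in> Cn" "v \<in> Cn" "x = u @\<^sub>v v" using vec_split[OF x] .
    have "f (block a x) = j (\<rho> (a \<otimes> a) *\<^sub>v conjugate v) \<oplus>\<^bsub>V\<^esub> r a (j u)"
      using uv by (simp add: block_a f p_def)
    also have "\<dots> = r a (p v) \<oplus>\<^bsub>V\<^esub> r a (j u)" using uv by (simp add: jeq p_def ra_a jcl)
    also have "\<dots> = r a (f x)"
      using uv by (simp add: f ralin(1)[OF jcl pcl] V.M.a_comm racl jcl pcl)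
    finally show ?thesis .
  qed
  have feq: "f (block g x) = r g (f x)" if g: "g \<in> carrier G" and x: "x \<in> Cnn" for g x
    using g
  proof (cases rule: carrier_cases)
    case (2 h)
    then show ?thesis
      using x by (simp add: block_mult feqa feqH gaD(4) fcl)
  qed (simp add: feqH x)
  have surj: "f ` Cnn = carrier V"
  proof -
    have im: "VectorSpace.subspace class_ring (f ` Cnn) V"
      using linear_map.imT_is_subspace[OF flm] mod_hom.im_def[of class_ring "Vnn" V f] flm
      unfolding linear_map_def by simp
    have "subrepresentation G V r (f ` Cnn)"
      unfolding subrepresentation_def
    proof (intro conjI ballI im subsetI)
      fix g y assume g: "g \<in> carrier G" and "y \<in> r g ` (f ` Cnn)"
      then obtain x where "x \<in> Cnn" "y = r g (f x)" by blast
      then show "y \<in> f ` Cnn" using feq[OF g] block_closed[OF g] by (metis image_eqI)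
    qed
    moreover have "f ` Cnn \<noteq> {\<zero>\<^bsub>V\<^esub>}"
    proof
      assume z: "f ` Cnn = {\<zero>\<^bsub>V\<^esub>}"
      define e where "e = (unit_vec n 0 :: complex vec)"
      have e: "e \<in> Cn" "e \<noteq> 0\<^sub>v n"
        using irreducible_matrix_repD(1)[OF irr] by (auto simp: e_def)
      have "p (0\<^sub>v n) = \<zero>\<^bsub>V\<^esub>"
        using plin(2)[of "0\<^sub>v n" "0\<^sub>v n" 0] V.lmult_0[OF pcl[OF zero_carrier_vec]] zero_smult_vec[of "0\<^sub>v n" n] by simp
      then have "f (e @\<^sub>v 0\<^sub>v n) = j e" using e by (simp add: f jcl)
      then have "j e = j (0\<^sub>v n)" using z append_zero_closed[OF e(1)] j0 by (metis imageI singletonD)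
      then show False using inj e by (meson inj_onD zero_carrier_vec)
    qed
    ultimately show ?thesis using irrV unfolding irreducible_representation_def by blast
  qed
  let ?K = "{x \<in> Cnn. f x = \<zero>\<^bsub>V\<^esub>}"
  have flin: "f (x + y) = f x \<oplus>\<^bsub>V\<^esub> f y" "f (z \<cdot>\<^sub>v x) = z \<odot>\<^bsub>V\<^esub> f x"
    if "x \<in> Cnn" "y \<in> Cnn" for x y z
    using flm that unfolding linear_map_iff by auto
  have r0: "r g \<zero>\<^bsub>V\<^esub> = \<zero>\<^bsub>V\<^esub>" if "g \<in> carrier G" for g
  proof -
    have "r g \<zero>\<^bsub>V\<^esub> = f (block g (0\<^sub>v (n + n)))"
      using feq[OF that, of "0\<^sub>v (n + n)"] linear_map.T0_is_0[OF flm] by simp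
    also have "block g (0\<^sub>v (n + n)) = 0\<^sub>v (n + n)"
      using block_semilinear(1)[OF that, of "0\<^sub>v (n + n)" "0\<^sub>v (n + n)"] block_closed[OF that zero_carrier_vec]
      by (intro vec_zero_cancel[of "block g (0\<^sub>v (n + n))"]) simp_all
    finally show ?thesis using linear_map.T0_is_0[OF flm] by simp
  qed
  have subK: "subrepresentation G Vnn block ?K"
    unfolding block_subrepresentation_iff
    using linear_map.T0_is_0[OF flm] by (auto simp: flin feq r0 V.M.l_zero)
  have properK: "?K \<noteq> Cnn"
  proof
    assume "?K = Cnn"
    then have "\<forall>x\<in>Cnn. f x = \<zero>\<^bsub>V\<^esub>" by (metis (mono_tags, lifting) mem_Collect_eq)
    then have "carrier V \<subseteq> {\<zero>\<^bsub>V\<^esub>}" unfolding surj[symmetric] by blast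
    then have "carrier V = {\<zero>\<^bsub>V\<^esub>}" using V.M.zero_closed by blast
    then show False using irrV unfolding irreducible_representation_def by blast
  qed
  show ?thesis
  proof (cases "?K = {0\<^sub>v (n + n)}")
    case True
    have "inj_on f Cnn"
      using linear_map.Ke0_imp_inj[OF flm] mod_hom.ker_def[of class_ring "Vnn" V f] flm True
      unfolding linear_map_def by simp
    then have "rep_iso G Vnn block V r f"
      unfolding rep_iso_def using flm surj feq by (auto simp: bij_betw_def)
    then show ?thesis by blast
  next
    case False
    obtain S where
      S: "rep_iso H Vn rho_op Vn crho_op S"
      and KS: "\<And>u v. u \<in> Cn \<Longrightarrow> v \<in> Cn \<Longrightarrow> u @\<^sub>v v \<in> ?K \<longleftrightarrow> v = S u"
      by (rule invariant_subspace_is_graph[OF subK False properK]) (rule that)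
    have Sbij: "bij_betw S Cn Cn" using S unfolding rep_iso_def by simp
    have jsurj: "y \<in> j ` Cn" if yV: "y \<in> carrier V" for y
    proof -
      obtain x where x: "x \<in> Cnn" "y = f x"
        using yV unfolding surj[symmetric] by blast
      obtain u v where uv: "u \<in> Cn" "v \<in> Cn" "x = u @\<^sub>v v" using vec_split[OF x(1)] .
      obtain w where w: "w \<in> Cn" "S w = v"
        using Sbij uv(2) by (metis bij_betw_imp_surj_on imageE)
      \<comment> \<open>subtracting this element of the kernel clears the second coordinate of \<open>x\<close>\<close>
      have wv: "w @\<^sub>v v \<in> ?K" using KS w uv by blast
      have uw: "u - w \<in> Cn" using uv w by simp
      have "x = ((u - w) @\<^sub>v 0\<^sub>v n) + (w @\<^sub>v v)"
        using uv w by (simp add: append_vec_add[of _ n _ _ n]) (intro eq_vecI, auto)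
      then have "y = f ((u - w) @\<^sub>v 0\<^sub>v n) \<oplus>\<^bsub>V\<^esub> f (w @\<^sub>v v)"
        using x(2) flin(1) append_zero_closed[OF uw] wv by simp
      also have "f (w @\<^sub>v v) = \<zero>\<^bsub>V\<^esub>" using wv by blast
      also have "p (0\<^sub>v n) = \<zero>\<^bsub>V\<^esub>"
        using plin(2)[of "0\<^sub>v n" "0\<^sub>v n" 0] V.lmult_0[OF pcl[OF zero_carrier_vec]] zero_smult_vec[of "0\<^sub>v n" n] by simp
      then have "f ((u - w) @\<^sub>v 0\<^sub>v n) \<oplus>\<^bsub>V\<^esub> \<zero>\<^bsub>V\<^esub> = j (u - w)" using uw by (simp add: f jcl)
      finally show ?thesis using uw by blast
    qed
    then have jbij: "bij_betw j Cn (carrier V)"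
      using inj jcl jsurj unfolding bij_betw_def by blast
    let ?i = "inv_into Cn j"
    have ji: "j (?i y) = y" "?i y \<in> Cn" if "y \<in> carrier V" for y
      using jbij that by (simp_all add: bij_betw_inv_into_right bij_betw_def inv_into_into)
    have ij: "?i (j v) = v" if "v \<in> Cn" for v
      using jbij that by (simp add: bij_betw_inv_into_left)
    have plm: "linear_map class_ring Vn V p"
      unfolding linear_map_iff using V plin pcl by (auto simp: vec_vs)
    have "linear_map class_ring V Vn ?i"
      using linear_map_inv_into[OF j] jbij by simp
    from linear_map_compose[OF plm this]
    obtain T where T: "T \<in> carrier_mat n n" "\<And>v. v \<in> Cn \<Longrightarrow> ?i (p v) = T *\<^sub>v v"
      using linear_map_cspace_matrix by blast
    have jT: "j (T *\<^sub>v v) = p v" if "v \<in> Cn" for v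
      using T(2)[OF that, symmetric] ji(1)[OF pcl[OF that]] by simp
    have Tcl: "T *\<^sub>v v \<in> Cn" if "v \<in> Cn" for v using T(1) that by simp
    have jinj: "u = v" if "j u = j v" "u \<in> Cn" "v \<in> Cn" for u v
      using inj that by (meson inj_onD)
    have ra_inj: "x = y" if "r a x = r a y" "x \<in> carrier V" "y \<in> carrier V" for x y
      using group_action.inj_prop[OF ga a_carrier] that by (meson inj_onD)
    have Tbij: "bij_betw (mat_op n T) Cn Cn"
    proof (rule bij_betw_imageI)
      show "inj_on (mat_op n T) Cn"
      proof (rule inj_onI)
        fix u v assume uv: "u \<in> Cn" "v \<in> Cn" "mat_op n T u = mat_op n T v"
        then have "p u = p v" using jT by (metis mat_op_simps(1))
        then have "j (conjugate u) = j (conjugate v)"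
          unfolding p_def by (rule ra_inj) (use uv(1,2) jcl in simp_all)
        then have "conjugate u = conjugate v" by (rule jinj) (use uv(1,2) in simp_all)
        then show "u = v" by simp
      qed
      have "u \<in> mat_op n T ` Cn" if u: "u \<in> Cn" for u
      proof -
        obtain y where y: "y \<in> carrier V" "r a y = j u"
          using group_action.surj_prop[OF ga a_carrier] jcl[OF u] by (metis imageE)
        let ?v = "conjugate (?i y)"
        have v: "?v \<in> Cn" using ji(2)[OF y(1)] by simp
        have "j (T *\<^sub>v ?v) = j u" using jT[OF v] y ji(1) by (simp add: p_def)
        then have "T *\<^sub>v ?v = u" by (rule jinj[OF _ Tcl[OF v] u])
        then have "mat_op n T ?v = u" using v by simp
        then show ?thesis using v by blast
      qed
      then show "mat_op n T ` Cn = Cn" using Tcl by auto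
    qed
    have Tcomm: "T *\<^sub>v (crho h *\<^sub>v v) = \<rho> h *\<^sub>v (T *\<^sub>v v)" if "h \<in> carrier H" "v \<in> Cn" for h v
      using that by (intro jinj) (simp_all add: jT p_rho jeq Tcl)
    have Tiso: "matrix_rep_iso H n crho \<rho> T"
      unfolding matrix_rep_iso_def rep_iso_def
      using T(1) linear_map_mat_op[OF T(1)] Tbij Tcomm Tcl by simp
    have sq: "T * cnj_mat T = \<rho> (a \<otimes> a)"
    proof (rule mat_eqI_mult_vec[of _ n n])
      fix v :: "complex vec" assume v: "v \<in> Cn"
      have "j (T *\<^sub>v conjugate (T *\<^sub>v conjugate v)) = j (\<rho> (a \<otimes> a) *\<^sub>v v)"
      proof -
        have "j (T *\<^sub>v conjugate (T *\<^sub>v conjugate v)) = r a (j (T *\<^sub>v conjugate v))"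
          using v Tcl by (simp add: jT[of "conjugate _"] p_def)
        also have "\<dots> = r a (r a (j v))" using v by (simp add: jT p_def)
        finally show ?thesis using v by (simp add: ra_a jcl jeq)
      qed
      then have "T *\<^sub>v conjugate (T *\<^sub>v conjugate v) = \<rho> (a \<otimes> a) *\<^sub>v v"
        using v Tcl by (intro jinj) simp_all
      then show "T * cnj_mat T *\<^sub>v v = \<rho> (a \<otimes> a) *\<^sub>v v" using square_eq[OF T(1) refl v] by simp
    qed (use T(1) rho(1)[of "a \<otimes> a"] in auto)
    let ?r = "determined_action G \<phi> a Cn rho_op (conj_mat_op n T)"
    have deq: "j (?r g v) = r g (j v)" if g: "g \<in> carrier G" and v: "v \<in> Cn" for g v
      using g
    proof (cases rule: carrier_cases)
      case 1
      then show ?thesis using v by (simp add: determined_action_H jeq)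
    next
      case (2 h)
      then have "j (?r g v) = r a (j (\<rho> h *\<^sub>v v))"
        using v by (simp add: determined_action_coset jT p_def)
      then show ?thesis using 2 v by (simp add: jeq gaD(4) jcl)
    qed
    have "representation G \<phi> Vn ?r"
      using real_extension_irreducible[OF Tiso sq] unfolding irreducible_representation_def by blast
    then have "group_action G (carrier Vn) ?r" unfolding representation_def by blast
    note cl = group_actionD(3)[OF this]
    have "rep_iso G Vn ?r V r j"
      unfolding rep_iso_def using j jbij deq by simp
    from rep_iso_sym[OF this cl] have "rep_isomorphic G V r Vn ?r"
      unfolding rep_isomorphic_def by blast
    then show ?thesis using Tiso sq by blast
  qed
qed

end

lemma (in magnetic) classification:
  assumes irrV: "irreducible_representation G \<phi> V r"
  shows "\<exists>n \<rho>. irreducible_matrix_rep H n \<rho> \<and>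
    ((\<exists>T. matrix_rep_iso H n (conjugate_rep G a \<rho>) \<rho> T \<and> T * cnj_mat T = \<rho> (a \<otimes> a) \<and>
        rep_isomorphic G V r (cspace n)
          (determined_action G \<phi> a (carrier_vec n) (\<lambda>g. mat_op n (\<rho> g)) (conj_mat_op n T))) \<or>
     (complex_type G \<phi> a n \<rho> \<and> rep_isomorphic G V r (Ind_mat G \<phi> n \<rho>) (Ind_mat_act G \<phi> n \<rho>)) \<or>
     (quaternionic_type G \<phi> a n \<rho> \<and> rep_isomorphic G V r (Ind_mat G \<phi> n \<rho>) (Ind_mat_act G \<phi> n \<rho>)))"
proof -
  have rep: "representation G \<phi> V r" and ne: "carrier V \<noteq> {\<zero>\<^bsub>V\<^esub>}"
    using irrV unfolding irreducible_representation_def by auto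
  obtain n \<rho> j where \<rho>: "irreducible_matrix_rep H n \<rho>"
    and j: "linear_map class_ring (cspace n) V j" "inj_on j (carrier_vec n)"
      "\<And>h v. h \<in> carrier H \<Longrightarrow> v \<in> carrier_vec n \<Longrightarrow> j (\<rho> h *\<^sub>v v) = r h (j v)"
    using irreducible_constituent[OF restrict_to_kernel[OF rep] ne] by blast
  interpret magnetic_irrep G \<phi> a n \<rho> by unfold_locales (rule \<rho>)
  show ?thesis
    using constituent_dichotomy[OF irrV j]
  proof
    assume "\<exists>f. rep_iso G (cspace (n + n)) block V r f"
    then obtain f where f: "rep_iso G (cspace (n + n)) block V r f" by blast
    then have f': "rep_iso G V r (cspace (n + n)) block (inv_into (carrier (cspace (n + n))) f)"
      by (rule rep_iso_sym) simp
    have Ind: "rep_isomorphic G V r (Ind_mat G \<phi> n \<rho>) (Ind_mat_act G \<phi> n \<rho>)"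
      unfolding rep_isomorphic_def using rep_iso_trans[OF f' Ind_ident_iso] by blast
    have irrb: "irreducible_representation G \<phi> (cspace (n + n)) block"
      by (rule irreducible_transport[OF irrV f'])
        (use group_actionD(2)[OF block_group_action] in simp)
    show ?thesis
    proof (cases "complex_type G \<phi> a n \<rho>")
      case True
      then show ?thesis using Ind \<rho> by blast
    next
      case False
      then obtain T where T: "matrix_rep_iso H n crho \<rho> T"
        "T * cnj_mat T = \<rho> (a \<otimes> a) \<or> T * cnj_mat T = - \<rho> (a \<otimes> a)"
        by (rule normalised_intertwiner)
      then have "T * cnj_mat T = - \<rho> (a \<otimes> a)" using block_reducible_real irrb by blast
      then have "quaternionic_type G \<phi> a n \<rho>" using T(1) unfolding quaternionic_type_def by blast
      then show ?thesis using Ind \<rho> by blast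
    qed
  next
    assume "\<exists>T. matrix_rep_iso H n crho \<rho> T \<and> T * cnj_mat T = \<rho> (a \<otimes> a) \<and>
       rep_isomorphic G V r (cspace n)
         (determined_action G \<phi> a (carrier_vec n) (\<lambda>g. mat_op n (\<rho> g)) (conj_mat_op n T))"
    with \<rho> show ?thesis by (intro exI[of _ n] exI[of _ \<rho>] conjI disjI1)
  qed
qed

theorem mainTheorem2:
  fixes G :: "('g, 'b) monoid_scheme" and \<phi> :: "'g \<Rightarrow> int" and a :: 'g
  assumes "magnetic_group G \<phi>" and "finite (carrier G)"
    and "a \<in> carrier G" and "a \<notin> carrier (unitary_subgroup G \<phi>)"
  shows
    "(\<forall>n \<rho> T.
        irreducible_matrix_rep (unitary_subgroup G \<phi>) n \<rho> \<and> real_type G \<phi> a n \<rho> \<and>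
        matrix_rep_iso (unitary_subgroup G \<phi>) n (conjugate_rep G a \<rho>) \<rho> T \<and>
        T * cnj_mat T = \<rho> (a \<otimes>\<^bsub>G\<^esub> a) \<longrightarrow>
        irreducible_representation G \<phi> (cspace n)
          (determined_action G \<phi> a (carrier_vec n) (\<lambda>g. mat_op n (\<rho> g)) (conj_mat_op n T)))
     \<and>
     (\<forall>n \<rho>.
        irreducible_matrix_rep (unitary_subgroup G \<phi>) n \<rho> \<and> complex_type G \<phi> a n \<rho> \<longrightarrow>
        irreducible_representation G \<phi> (Ind_mat G \<phi> n \<rho>) (Ind_mat_act G \<phi> n \<rho>))
     \<and>
     (\<forall>n \<rho> T.
        irreducible_matrix_rep (unitary_subgroup G \<phi>) n \<rho> \<and> quaternionic_type G \<phi> a n \<rho> \<and>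
        matrix_rep_iso (unitary_subgroup G \<phi>) n (conjugate_rep G a \<rho>) \<rho> T \<and>
        T * cnj_mat T = - \<rho> (a \<otimes>\<^bsub>G\<^esub> a) \<longrightarrow>
        irreducible_representation G \<phi> (Ind_mat G \<phi> n \<rho>) (Ind_mat_act G \<phi> n \<rho>) \<and>
        rep_iso G (cspace (n + n)) (Ind_coords G \<phi> a n \<rho>)
          (Ind_mat G \<phi> n \<rho>) (Ind_mat_act G \<phi> n \<rho>) (Ind_ident G \<phi> a n \<rho>) \<and>
        (\<forall>g\<in>carrier G.
           change_basis (n + n) (four_block_mat (1\<^sub>m n) (0\<^sub>m n n) (0\<^sub>m n n) T)
             (Ind_coords G \<phi> a n \<rho> g) =
           determined_action G \<phi> a (carrier_vec (n + n))
             (\<lambda>h. mat_op (n + n) (four_block_mat (\<rho> h) (0\<^sub>m n n) (0\<^sub>m n n) (\<rho> h)))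
             (conj_mat_op (n + n) (four_block_mat (0\<^sub>m n n) (- T) T (0\<^sub>m n n))) g))
     \<and>
     (\<forall>(V :: (complex, 'v, 'm) module_scheme) r.
        irreducible_representation G \<phi> V r \<longrightarrow>
        (\<exists>n \<rho>.
           irreducible_matrix_rep (unitary_subgroup G \<phi>) n \<rho> \<and>
           ((\<exists>T. matrix_rep_iso (unitary_subgroup G \<phi>) n (conjugate_rep G a \<rho>) \<rho> T \<and>
                 T * cnj_mat T = \<rho> (a \<otimes>\<^bsub>G\<^esub> a) \<and>
                 rep_isomorphic G V r (cspace n)
                   (determined_action G \<phi> a (carrier_vec n)
                      (\<lambda>g. mat_op n (\<rho> g)) (conj_mat_op n T)))
            \<or>
            (complex_type G \<phi> a n \<rho> \<and>
             rep_isomorphic G V r (Ind_mat G \<phi> n \<rho>) (Ind_mat_act G \<phi> n \<rho>))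
            \<or>
            (quaternionic_type G \<phi> a n \<rho> \<and>
             rep_isomorphic G V r (Ind_mat G \<phi> n \<rho>) (Ind_mat_act G \<phi> n \<rho>)))))"
proof -
  have "group G" using assms(1) by (simp add: magnetic_group_def)
  then interpret magnetic G \<phi> a
    using assms by (simp add: magnetic_def magnetic_axioms_def)
  show ?thesis
  proof (intro conjI allI impI; (elim conjE)?)
    fix n \<rho> T
    assume "irreducible_matrix_rep H n \<rho>"
      and T: "matrix_rep_iso H n (conjugate_rep G a \<rho>) \<rho> T" "T * cnj_mat T = \<rho> (a \<otimes>\<^bsub>G\<^esub> a)"
    then interpret magnetic_irrep G \<phi> a n \<rho> by unfold_locales
    show "irreducible_representation G \<phi> (cspace n)
       (determined_action G \<phi> a (carrier_vec n) (\<lambda>g. mat_op n (\<rho> g)) (conj_mat_op n T))"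
      by (rule real_extension_irreducible[OF T])
  next
    fix n \<rho>
    assume "irreducible_matrix_rep H n \<rho>" and c: "complex_type G \<phi> a n \<rho>"
    then interpret magnetic_irrep G \<phi> a n \<rho> by unfold_locales
    show "irreducible_representation G \<phi> (Ind_mat G \<phi> n \<rho>) (Ind_mat_act G \<phi> n \<rho>)"
      by (rule Ind_irreducible_if_block[OF block_irreducible_complex[OF c]])
  next
    fix n \<rho> T
    assume "irreducible_matrix_rep H n \<rho>"
      and T: "matrix_rep_iso H n (conjugate_rep G a \<rho>) \<rho> T" "T * cnj_mat T = - \<rho> (a \<otimes>\<^bsub>G\<^esub> a)"
    then interpret magnetic_irrep G \<phi> a n \<rho> by unfold_locales
    show "irreducible_representation G \<phi> (Ind_mat G \<phi> n \<rho>) (Ind_mat_act G \<phi> n \<rho>)"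
      by (rule Ind_irreducible_if_block[OF block_irreducible_quaternionic[OF T]])
    show "rep_iso G (cspace (n + n)) (Ind_coords G \<phi> a n \<rho>)
       (Ind_mat G \<phi> n \<rho>) (Ind_mat_act G \<phi> n \<rho>) (Ind_ident G \<phi> a n \<rho>)"
      using Ind_ident_iso by (simp add: rep_iso_def Ind_coords_eq_block)
    show "\<forall>g\<in>carrier G.
        change_basis (n + n) (four_block_mat (1\<^sub>m n) (0\<^sub>m n n) (0\<^sub>m n n) T) (Ind_coords G \<phi> a n \<rho> g) =
        determined_action G \<phi> a (carrier_vec (n + n))
          (\<lambda>h. mat_op (n + n) (four_block_mat (\<rho> h) (0\<^sub>m n n) (0\<^sub>m n n) (\<rho> h)))
          (conj_mat_op (n + n) (four_block_mat (0\<^sub>m n n) (- T) T (0\<^sub>m n n))) g"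
      by (intro ballI quaternionic_change_basis[OF T])
  next
    fix V :: "(complex, 'v, 'm) module_scheme" and r
    assume "irreducible_representation G \<phi> V r"
    then show "\<exists>n \<rho>. irreducible_matrix_rep H n \<rho> \<and>
      ((\<exists>T. matrix_rep_iso H n (conjugate_rep G a \<rho>) \<rho> T \<and> T * cnj_mat T = \<rho> (a \<otimes>\<^bsub>G\<^esub> a) \<and>
          rep_isomorphic G V r (cspace n)
            (determined_action G \<phi> a (carrier_vec n) (\<lambda>g. mat_op n (\<rho> g)) (conj_mat_op n T))) \<or>
       (complex_type G \<phi> a n \<rho> \<and> rep_isomorphic G V r (Ind_mat G \<phi> n \<rho>) (Ind_mat_act G \<phi> n \<rho>)) \<or>
       (quaternionic_type G \<phi> a n \<rho> \<and> rep_isomorphic G V r (Ind_mat G \<phi> n \<rho>) (Ind_mat_act G \<phi> n \<rho>)))"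
      by (rule classification)
  qed
qed

end
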